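(* Let $\alpha>0$ be a constant and let $p=p(n)$ satisfy $p=\omega\left(\log^8 n/n\right)$. Then for all sufficiently large $n$, every $(n,\alpha,p)$-pseudorandom digraph contains a directed Hamilton cycle.
   Context: For a digraph $D$ and $X,Y\subseteq V(D)$, $e_D(X,Y)$ is the number of arcs $(x,y)$ with $x\in X$, $y\in Y$, and $e_D(X)=e_D(X,X)$. $N^+(v,Y)$ (resp. $N^-(v,Y)$) is the set of out-neighbours (resp. in-neighbours) of $v$ in $Y$, $d^{\pm}_D(v,Y)=\min\{|N^+(v,Y)|,|N^-(v,Y)|\}$. A digraph $D$ on $n$ vertices is $(n,\alpha,p)$-pseudorandom if: (P1) $d^{\pm}_D(v,V(D))\ge(1/2+2\alpha)np$ for every $v\in V(D)$; (P2) every $X\subseteq V(D)$ with $|X|\le \log^2 n/p$ satisfies $e_D(X)\le |X|\log^{2.1}n$; (P3) every two disjoint $X,Y\subseteq V(D)$ with $|X|,|Y|\ge \log^{1.1}n/p$ satisfy $e_D(X,Y)\le(1+\alpha/2)|X||Y|p$. *)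

theory Defs
  imports
    Complex_Main
    "HOL-Library.Landau_Symbols"
    "Graph_Theory.Arc_Walk"
begin

definition arcs_between :: "('a, 'b) pre_digraph \<Rightarrow> 'a set \<Rightarrow> 'a set \<Rightarrow> nat" where
  "arcs_between D X Y = card {a \<in> arcs D. tail D a \<in> X \<and> head D a \<in> Y}"

definition out_nbrs :: "('a, 'b) pre_digraph \<Rightarrow> 'a \<Rightarrow> 'a set \<Rightarrow> 'a set" where
  "out_nbrs D v Y = {w \<in> Y. v \<rightarrow>\<^bsub>D\<^esub> w}"

definition in_nbrs :: "('a, 'b) pre_digraph \<Rightarrow> 'a \<Rightarrow> 'a set \<Rightarrow> 'a set" where
  "in_nbrs D v Y = {w \<in> Y. w \<rightarrow>\<^bsub>D\<^esub> v}"

definition semidegree :: "('a, 'b) pre_digraph \<Rightarrow> 'a \<Rightarrow> 'a set \<Rightarrow> nat" where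
  "semidegree D v Y = min (card (out_nbrs D v Y)) (card (in_nbrs D v Y))"

text \<open>The locale \<^locale>\<open>digraph\<close> means finite, without loops and without parallel arcs; a pair
  of opposite arcs between two vertices is allowed.\<close>

definition pseudorandom :: "nat \<Rightarrow> real \<Rightarrow> real \<Rightarrow> ('a, 'b) pre_digraph \<Rightarrow> bool" where
  "pseudorandom n \<alpha> p D \<longleftrightarrow>
     digraph D \<and> card (verts D) = n \<and>
     (\<forall>v \<in> verts D. real (semidegree D v (verts D)) \<ge> (1/2 + 2 * \<alpha>) * real n * p) \<and>
     (\<forall>X \<subseteq> verts D. real (card X) \<le> (ln (real n))^2 / p \<longrightarrow>
        real (arcs_between D X X) \<le> real (card X) * ln (real n) powr 2.1) \<and>
     (\<forall>X \<subseteq> verts D. \<forall>Y \<subseteq> verts D. X \<inter> Y = {} \<and>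
        real (card X) \<ge> ln (real n) powr 1.1 / p \<and>
        real (card Y) \<ge> ln (real n) powr 1.1 / p \<longrightarrow>
        real (arcs_between D X Y) \<le> (1 + \<alpha> / 2) * real (card X) * real (card Y) * p)"

text \<open>A cycle is given by its list of arcs, so the vertices on it are the tails of these arcs.\<close>

definition hamilton_cycle :: "('a, 'b) pre_digraph \<Rightarrow> 'b list \<Rightarrow> bool" where
  "hamilton_cycle D c \<longleftrightarrow> pre_digraph.cycle D c \<and> tail D ` set c = verts D"

end

theory Submission
  imports Defs "HOL-Library.FuncSet" "HOL-Library.Disjoint_Sets" "HOL-Library.Multiset"
    "HOL-Real_Asymp.Real_Asymp"
begin

text \<open>The proof is by absorption.  In a random colouring of the vertices with about \<open>ln n powr 5.5\<close>
  colours every vertex has its proportional share of neighbours in every colour class.  By (P2) small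
  sets expand by a constant factor into unions of classes, and by (P1) and (P3) sets of size at least
  \<open>ln n powr 1.1 / p\<close> have neighbours in more than half of such a union.  Hence forward and backward
  searches meet, and many pairs of vertices can be joined by disjoint paths of length \<open>O(ln n)\<close> through
  a reservoir of classes.  Joining each vertex \<open>x\<close> of a small set \<open>U\<close> to itself by an antidirected
  path, and then the ends of the arcs on it by directed paths, yields a path that can absorb any subset
  of \<open>U\<close>.  The vertices outside this path and \<open>U\<close> are covered by \<open>O(ln n powr 1.1 / p)\<close> paths: since
  large sets have out- and in-neighbourhoods larger than half, three of too many paths could be
  recombined into two.  All these paths are linked to a cycle through \<open>U\<close>, and the unused vertices of
  \<open>U\<close> are absorbed.\<close>

section \<open>Balanced colourings\<close>

text \<open>The exponents are a budget in powers of \<open>L = ln n\<close>. Doubling searches give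
  paths with \<open>l = O(L)\<close> vertices. The vertices of finished paths block later searches,
  so a greedy linking is only sure to serve a fraction \<open>1 / l\<close> of its pairs; it is
  repeated in \<open>J = O(L^2)\<close> rounds, each in fresh vertices, until
  \<open>(1 - 1 / l) ^ J * n < 1\<close>. If \<open>U\<close> consists of \<open>4 * J\<close>
  classes, its absorbers produce \<open>O(J * l)\<close> classes' worth of pairs to link, so a
  reservoir block needs more than \<open>L^3\<close> classes, whence \<open>K\<close> about
  \<open>L^3.2\<close>. This spends \<open>O(J * K)\<close>, about \<open>L^5.2\<close>, of the
  \<open>L^5.5\<close> classes, a vanishing part. With \<open>n * p\<close> at least
  \<open>L^8\<close>, a vertex has order \<open>L^2.5\<close> or more neighbours in each class,
  which beats both \<open>L^2.1\<close> in (P2) and the union bound over polynomially many events in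
  \<open>n = exp L\<close>. The obstacle is that (P3) is only an upper bound and only for large
  disjoint sets. Every lower bound on a neighbourhood therefore comes from degrees: too few
  neighbours would make some pair or set too dense. \<open>U\<close> has two roles, absorbable set
  and reservoir of the last linking, so whatever that linking leaves over is harmless.\<close>

lemma sum_PiE_power_card:
  fixes w :: real
  assumes "finite V" "S \<subseteq> V" "c < N"
  shows "(\<Sum>f\<in>V \<rightarrow>\<^sub>E {..<N}. w ^ card {v\<in>S. f v = c})
           = real N ^ card V * (1 + (w - 1) / real N) ^ card S"
proof -
  let ?h = "\<lambda>v x. if v \<in> S \<and> x = c then w else 1"
  have fS: "finite S" using assms finite_subset by blast
  have N: "real N \<noteq> 0" using assms(3) by simp
  have "(\<Prod>v\<in>V. ?h v (f v)) = w ^ card {v\<in>S. f v = c}" for f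
  proof -
    have "(\<Prod>v\<in>V. ?h v (f v)) = (\<Prod>v\<in>{v\<in>V. v \<in> S \<and> f v = c}. w)"
      using assms(1) by (simp add: prod.If_cases Int_def)
    also have "{v\<in>V. v \<in> S \<and> f v = c} = {v\<in>S. f v = c}" using assms(2) by auto
    finally show ?thesis by simp
  qed
  then have "(\<Sum>f\<in>V \<rightarrow>\<^sub>E {..<N}. w ^ card {v\<in>S. f v = c})
      = (\<Sum>f\<in>V \<rightarrow>\<^sub>E {..<N}. \<Prod>v\<in>V. ?h v (f v))" by simp
  \<comment> \<open>Distributivity takes the place of independence: the sum over all maps is
    \<open>N ^ card V\<close> times the generating function of a binomial variable with success
    probability 1/N.\<close>
  also have "\<dots> = (\<Prod>v\<in>V. \<Sum>x<N. ?h v x)"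
    using assms(1) by (subst prod_sum_PiE) auto
  also have "\<dots> = (\<Prod>v\<in>V. real N * (if v \<in> S then 1 + (w - 1) / real N else 1))"
  proof (rule prod.cong)
    fix v assume "v \<in> V"
    have "(\<Sum>x<N. if x = c then w else 1) = (\<Sum>x<N. 1 + (if x = c then w - 1 else 0))"
      by (rule sum.cong) auto
    also have "\<dots> = real N + (w - 1)"
      using assms(3) by (simp add: sum.distrib)
    finally have "(\<Sum>x<N. if x = c then w else 1) = real N * (1 + (w - 1) / real N)"
      using N by (simp add: distrib_left)
    then show "(\<Sum>x<N. ?h v x) = real N * (if v \<in> S then 1 + (w - 1) / real N else 1)"
      by simp
  qed simp
  also have "\<dots> = real N ^ card V * (1 + (w - 1) / real N) ^ card S"
  proof -
    have "(\<Prod>v\<in>V. (if v \<in> S then 1 + (w - 1) / real N else 1)) = (1 + (w - 1) / real N) ^ card S"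
      using assms(1,2) by (simp add: prod.If_cases Int_absorb1)
    then show ?thesis by (simp add: prod.distrib)
  qed
  finally show ?thesis .
qed

text \<open>Chernoff's bound, with probabilities replaced by counting maps. The exponential moment
  is taken at \<open>- \<delta>\<close> rather than at the optimal \<open>ln (1 - \<delta>)\<close>,
  so a quadratic estimate of \<open>exp\<close> suffices.\<close>

lemma card_lower_tail:
  fixes \<delta> :: real
  assumes "finite V" "S \<subseteq> V" "c < N" "0 < \<delta>" "\<delta> \<le> 1"
  shows "real (card {f \<in> V \<rightarrow>\<^sub>E {..<N}. real (card {v\<in>S. f v = c}) \<le> (1 - \<delta>) * real (card S) / real N})
           \<le> real N ^ card V * exp (- (\<delta>\<^sup>2 * real (card S) / (2 * real N)))"
proof -
  define \<mu> where "\<mu> = real (card S) / real N"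
  have \<mu>: "\<mu> \<ge> 0" by (simp add: \<mu>_def)
  let ?B = "{f \<in> V \<rightarrow>\<^sub>E {..<N}. real (card {v\<in>S. f v = c}) \<le> (1 - \<delta>) * real (card S) / real N}"
  have fin: "finite (V \<rightarrow>\<^sub>E {..<N})" using assms(1) by (simp add: finite_PiE)
  have N: "real N > 0" using assms(3) by simp
  have "real (card ?B) * exp (- \<delta> * (1 - \<delta>) * \<mu>) = (\<Sum>f\<in>?B. exp (- \<delta> * ((1 - \<delta>) * \<mu>)))" by simp
  also have "\<dots> \<le> (\<Sum>f\<in>?B. exp (- \<delta>) ^ card {v\<in>S. f v = c})"
  proof (rule sum_mono)
    fix f assume "f \<in> ?B"
    then have "\<delta> * real (card {v\<in>S. f v = c}) \<le> \<delta> * ((1 - \<delta>) * \<mu>)"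
      using assms(4) by (intro mult_left_mono) (auto simp: \<mu>_def)
    then have "exp (- \<delta> * ((1 - \<delta>) * \<mu>)) \<le> exp (real (card {v\<in>S. f v = c}) * - \<delta>)"
      by (simp add: mult.commute)
    then show "exp (- \<delta> * ((1 - \<delta>) * \<mu>)) \<le> exp (- \<delta>) ^ card {v\<in>S. f v = c}"
      by (simp only: exp_of_nat_mult)
  qed
  also have "\<dots> \<le> (\<Sum>f\<in>V \<rightarrow>\<^sub>E {..<N}. exp (- \<delta>) ^ card {v\<in>S. f v = c})"
    by (rule sum_mono2) (auto simp: fin)
  also have "\<dots> = real N ^ card V * (1 + (exp (- \<delta>) - 1) / real N) ^ card S"
    by (rule sum_PiE_power_card) fact+
  also have "\<dots> \<le> real N ^ card V * exp (- (\<delta> - \<delta>\<^sup>2 / 2) / real N) ^ card S"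
  proof (intro mult_left_mono power_mono)
    have "exp (- \<delta>) \<le> 1 - \<delta> + \<delta>\<^sup>2 / 2"
    proof -
      have "(\<Sum>k<3. \<delta> ^ k / fact k) \<le> exp \<delta>"
        using sum_le_suminf[OF summable_exp_generic[of \<delta>], of "{..<3}"] assms(4)
        by (simp add: exp_def divide_simps)
      then have "1 + \<delta> + \<delta>\<^sup>2 / 2 \<le> exp \<delta>"
        by (simp add: numeral_3_eq_3 power2_eq_square)
      then have "exp (- \<delta>) \<le> 1 / (1 + \<delta> + \<delta>\<^sup>2 / 2)"
        using assms(4) by (simp add: exp_minus field_simps add_pos_nonneg)
      also have "\<dots> \<le> 1 - \<delta> + \<delta>\<^sup>2 / 2"
      proof -
        \<comment> \<open>The product is 1 + \<delta>^4 / 4.\<close>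
        have "1 \<le> (1 - \<delta> + \<delta>\<^sup>2 / 2) * (1 + \<delta> + \<delta>\<^sup>2 / 2)"
          using assms(4) by (simp add: algebra_simps power2_eq_square)
        moreover have "1 + \<delta> + \<delta>\<^sup>2 / 2 > 0" using assms(4) by (simp add: add_pos_nonneg)
        ultimately show ?thesis by (simp add: divide_le_eq)
      qed
      finally show ?thesis .
    qed
    then have "(exp (- \<delta>) - 1) / real N \<le> - (\<delta> - \<delta>\<^sup>2 / 2) / real N"
      using N by (intro divide_right_mono) auto
    then show "1 + (exp (- \<delta>) - 1) / real N \<le> exp (- (\<delta> - \<delta>\<^sup>2 / 2) / real N)"
      using exp_ge_add_one_self[of "- (\<delta> - \<delta>\<^sup>2 / 2) / real N"] by linarith
    have "(1 - exp (- \<delta>)) / real N \<le> 1"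
    proof -
      have "1 - exp (- \<delta>) \<le> 1" by simp
      also have "1 \<le> real N" using assms(3) by simp
      finally show ?thesis using N by (simp add: divide_le_eq)
    qed
    then show "0 \<le> 1 + (exp (- \<delta>) - 1) / real N" by (simp add: diff_divide_distrib)
  qed auto
  also have "\<dots> = real N ^ card V * exp (- (\<delta> - \<delta>\<^sup>2 / 2) * \<mu>)"
    by (simp add: exp_of_nat_mult[symmetric] \<mu>_def mult.commute)
  finally have "real (card ?B) \<le> real N ^ card V * exp (- (\<delta> - \<delta>\<^sup>2 / 2) * \<mu>) / exp (- \<delta> * (1 - \<delta>) * \<mu>)"
    by (simp add: le_divide_eq)
  also have "\<dots> = real N ^ card V * exp (- (\<delta>\<^sup>2 * real (card S) / (2 * real N)))"
  proof -
    have "- (\<delta> - \<delta>\<^sup>2 / 2) * \<mu> - - \<delta> * (1 - \<delta>) * \<mu> = - (\<delta>\<^sup>2 * \<mu> / 2)"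
      by (simp add: algebra_simps power2_eq_square)
    then have "exp (- (\<delta> - \<delta>\<^sup>2 / 2) * \<mu>) / exp (- \<delta> * (1 - \<delta>) * \<mu>) = exp (- (\<delta>\<^sup>2 * \<mu> / 2))"
      unfolding exp_diff[symmetric] by (simp only:)
    moreover have "\<delta>\<^sup>2 * real (card S) / (2 * real N) = \<delta>\<^sup>2 * \<mu> / 2" by (simp add: \<mu>_def)
    ultimately show ?thesis by (metis times_divide_eq_right)
  qed
  finally show ?thesis .
qed

text \<open>Allowing the deviation \<open>2 * \<delta>\<close> makes the crude bound exp \<delta>
  \<le> 1 + \<delta> + \<delta>^2 enough: the exponent becomes (\<delta> + \<delta>^2) - \<delta> (1
  + 2 \<delta>) = - \<delta>^2 times the mean.\<close>

lemma card_upper_tail: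
  fixes \<delta> :: real
  assumes "finite V" "S \<subseteq> V" "c < N" "0 < \<delta>" "\<delta> \<le> 1"
  shows "real (card {f \<in> V \<rightarrow>\<^sub>E {..<N}. real (card {v\<in>S. f v = c}) \<ge> (1 + 2 * \<delta>) * real (card S) / real N})
           \<le> real N ^ card V * exp (- (\<delta>\<^sup>2 * real (card S) / real N))"
proof -
  define \<mu> where "\<mu> = real (card S) / real N"
  have \<mu>: "\<mu> \<ge> 0" by (simp add: \<mu>_def)
  let ?B = "{f \<in> V \<rightarrow>\<^sub>E {..<N}. real (card {v\<in>S. f v = c}) \<ge> (1 + 2 * \<delta>) * real (card S) / real N}"
  have fin: "finite (V \<rightarrow>\<^sub>E {..<N})" using assms(1) by (simp add: finite_PiE)
  have N: "real N > 0" using assms(3) by simp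
  have "real (card ?B) * exp (\<delta> * (1 + 2 * \<delta>) * \<mu>) = (\<Sum>f\<in>?B. exp (\<delta> * ((1 + 2 * \<delta>) * \<mu>)))" 
    by (simp add: mult.assoc)
  also have "\<dots> \<le> (\<Sum>f\<in>?B. exp \<delta> ^ card {v\<in>S. f v = c})"
  proof (rule sum_mono)
    fix f assume "f \<in> ?B"
    then have "\<delta> * ((1 + 2 * \<delta>) * \<mu>) \<le> \<delta> * real (card {v\<in>S. f v = c})"
      using assms(4) by (intro mult_left_mono) (auto simp: \<mu>_def)
    then have "exp (\<delta> * ((1 + 2 * \<delta>) * \<mu>)) \<le> exp (real (card {v\<in>S. f v = c}) * \<delta>)"
      by (simp add: mult.commute)
    then show "exp (\<delta> * ((1 + 2 * \<delta>) * \<mu>)) \<le> exp \<delta> ^ card {v\<in>S. f v = c}"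
      by (simp only: exp_of_nat_mult)
  qed
  also have "\<dots> \<le> (\<Sum>f\<in>V \<rightarrow>\<^sub>E {..<N}. exp \<delta> ^ card {v\<in>S. f v = c})"
    by (rule sum_mono2) (auto simp: fin)
  also have "\<dots> = real N ^ card V * (1 + (exp \<delta> - 1) / real N) ^ card S"
    by (rule sum_PiE_power_card) fact+
  also have "\<dots> \<le> real N ^ card V * exp ((\<delta> + \<delta>\<^sup>2) / real N) ^ card S"
  proof (intro mult_left_mono power_mono)
    have "exp \<delta> \<le> 1 + \<delta> + \<delta>\<^sup>2" using exp_bound assms(4,5) by simp
    then have "(exp \<delta> - 1) / real N \<le> (\<delta> + \<delta>\<^sup>2) / real N"
      using N by (intro divide_right_mono) auto
    then show "1 + (exp \<delta> - 1) / real N \<le> exp ((\<delta> + \<delta>\<^sup>2) / real N)"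
      using exp_ge_add_one_self[of "(\<delta> + \<delta>\<^sup>2) / real N"] by linarith
    show "0 \<le> 1 + (exp \<delta> - 1) / real N" using assms(4) by (simp add: add_nonneg_nonneg)
  qed auto
  also have "\<dots> = real N ^ card V * exp ((\<delta> + \<delta>\<^sup>2) * \<mu>)"
    by (simp add: exp_of_nat_mult[symmetric] \<mu>_def mult.commute)
  finally have "real (card ?B) \<le> real N ^ card V * exp ((\<delta> + \<delta>\<^sup>2) * \<mu>) / exp (\<delta> * (1 + 2 * \<delta>) * \<mu>)"
    by (simp add: le_divide_eq)
  also have "\<dots> = real N ^ card V * exp (- (\<delta>\<^sup>2 * real (card S) / real N))"
  proof -
    have "(\<delta> + \<delta>\<^sup>2) * \<mu> - \<delta> * (1 + 2 * \<delta>) * \<mu> = - (\<delta>\<^sup>2 * \<mu>)"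
      by (simp add: algebra_simps power2_eq_square)
    then have "exp ((\<delta> + \<delta>\<^sup>2) * \<mu>) / exp (\<delta> * (1 + 2 * \<delta>) * \<mu>) = exp (- (\<delta>\<^sup>2 * \<mu>))"
      by (simp add: exp_diff[symmetric] del: exp_minus)
    then show ?thesis by (simp add: \<mu>_def times_divide_eq_right[symmetric] del: times_divide_eq_right)
  qed
  finally show ?thesis .
qed

lemma union_bound:
  fixes B :: "'i \<Rightarrow> 'f \<Rightarrow> bool"
  assumes "finite F" "finite A" "\<And>a. a \<in> A \<Longrightarrow> real (card {f\<in>F. B a f}) \<le> \<epsilon> * real (card F)"
    and "real (card A) * \<epsilon> < 1" "F \<noteq> {}"
  shows "\<exists>f\<in>F. \<forall>a\<in>A. \<not> B a f"
proof (rule ccontr)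
  assume "\<not> ?thesis"
  then have "F \<subseteq> (\<Union>a\<in>A. {f\<in>F. B a f})" by auto
  then have "card F \<le> card (\<Union>a\<in>A. {f\<in>F. B a f})"
    using assms(1,2) by (intro card_mono) auto
  also have "\<dots> \<le> (\<Sum>a\<in>A. card {f\<in>F. B a f})" by (rule card_UN_le) fact
  finally have "real (card F) \<le> (\<Sum>a\<in>A. real (card {f\<in>F. B a f}))"
    by (metis of_nat_le_iff of_nat_sum)
  also have "\<dots> \<le> (\<Sum>a\<in>A. \<epsilon> * real (card F))" using assms(3) by (intro sum_mono)
  also have "\<dots> = (real (card A) * \<epsilon>) * real (card F)" by simp
  also have "\<dots> < 1 * real (card F)"
    using assms(1,4,5) by (intro mult_strict_right_mono) (auto simp: card_gt_0_iff)
  finally show False by simp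
qed

text \<open>There is one bad event for each set, colour and tail, which explains the factor 2 in
  \<open>small\<close>. The lower tail has the weaker exponent and so governs both.\<close>

lemma balanced_colouring:
  fixes \<delta> d :: real and V :: "'a set"
  assumes "finite V" "finite \<S>" "\<And>S. S \<in> \<S> \<Longrightarrow> S \<subseteq> V \<and> d \<le> real (card S)"
    and "0 < N" "0 < \<delta>" "\<delta> \<le> 1"
    and small: "2 * real (card \<S>) * real N * exp (- (\<delta>\<^sup>2 * d / (2 * real N))) < 1"
  shows "\<exists>f. (\<forall>v\<in>V. f v < N) \<and> (\<forall>S\<in>\<S>. \<forall>c<N.
           (1 - \<delta>) * real (card S) / real N < real (card {v\<in>S. f v = c}) \<and>
           real (card {v\<in>S. f v = c}) < (1 + 2 * \<delta>) * real (card S) / real N)"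
proof -
  let ?F = "V \<rightarrow>\<^sub>E {..<N}"
  let ?A = "(UNIV :: bool set) \<times> \<S> \<times> {..<N}"
  define B :: "bool \<times> 'a set \<times> nat \<Rightarrow> ('a \<Rightarrow> nat) \<Rightarrow> bool"
    where "B = (\<lambda>(b, S, c) f. if b then real (card {v\<in>S. f v = c}) \<le> (1 - \<delta>) * real (card S) / real N
     else real (card {v\<in>S. f v = c}) \<ge> (1 + 2 * \<delta>) * real (card S) / real N)"
  have "\<exists>f\<in>?F. \<forall>a\<in>?A. \<not> B a f"
  proof (rule union_bound)
    show "finite ?F" using assms(1) by (simp add: finite_PiE)
    show "finite ?A" using assms(2) by simp
    show "?F \<noteq> {}" using assms(4) by (auto simp: PiE_eq_empty_iff)
    have "real (card ?A) = 2 * real (card \<S>) * real N" by (simp add: card_cartesian_product)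
    then show "real (card ?A) * exp (- (\<delta>\<^sup>2 * d / (2 * real N))) < 1" using small by (simp only:)
    fix a assume "a \<in> ?A"
    then obtain b S c where a: "a = (b, S, c)" "S \<in> \<S>" "c < N" by auto
    have cF: "real (card ?F) = real N ^ card V" using assms(1) by (simp add: card_PiE)
    have d: "d \<le> real (card S)" "S \<subseteq> V" using assms(3) a by auto
    have "\<delta>\<^sup>2 * d / (2 * real N) \<le> \<delta>\<^sup>2 * real (card S) / (2 * real N)"
      using d by (intro divide_right_mono mult_left_mono) auto
    then have 1: "exp (- (\<delta>\<^sup>2 * real (card S) / (2 * real N))) \<le> exp (- (\<delta>\<^sup>2 * d / (2 * real N)))"
      by (simp only: exp_le_cancel_iff neg_le_iff_le)
    have "\<delta>\<^sup>2 * real (card S) / (2 * real N) \<le> \<delta>\<^sup>2 * real (card S) / real N"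
      using assms(4) by (intro divide_left_mono) auto
    then have 2: "exp (- (\<delta>\<^sup>2 * real (card S) / real N)) \<le> exp (- (\<delta>\<^sup>2 * real (card S) / (2 * real N)))"
      by (simp only: exp_le_cancel_iff neg_le_iff_le)
    show "real (card {f\<in>?F. B a f}) \<le> exp (- (\<delta>\<^sup>2 * d / (2 * real N))) * real (card ?F)"
    proof (cases b)
      case True
      then have "real (card {f\<in>?F. B a f}) \<le> real N ^ card V * exp (- (\<delta>\<^sup>2 * real (card S) / (2 * real N)))"
        using card_lower_tail[OF assms(1) d(2) a(3) assms(5,6)] by (simp add: B_def a)
      also have "\<dots> \<le> real N ^ card V * exp (- (\<delta>\<^sup>2 * d / (2 * real N)))"
        by (rule mult_left_mono[OF 1]) simp
      finally show ?thesis unfolding cF by (simp only: mult.commute)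
    next
      case False
      then have "real (card {f\<in>?F. B a f}) \<le> real N ^ card V * exp (- (\<delta>\<^sup>2 * real (card S) / real N))"
        using card_upper_tail[OF assms(1) d(2) a(3) assms(5,6)] by (simp add: B_def a)
      also have "\<dots> \<le> real N ^ card V * exp (- (\<delta>\<^sup>2 * d / (2 * real N)))"
        by (rule mult_left_mono[OF order.trans[OF 2 1]]) simp
      finally show ?thesis unfolding cF by (simp only: mult.commute)
    qed
  qed
  then obtain f where f: "f \<in> ?F" "\<And>b S c. S \<in> \<S> \<Longrightarrow> c < N \<Longrightarrow> \<not> B (b, S, c) f" by blast
  show ?thesis
  proof (intro exI[of _ f] conjI ballI allI impI)
    fix v assume "v \<in> V" then show "f v < N" using f(1) by auto
  next
    fix S c assume "S \<in> \<S>" "c < N"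
    then have "\<not> B (True, S, c) f" "\<not> B (False, S, c) f" using f(2) by blast+
    then show "(1 - \<delta>) * real (card S) / real N < real (card {v\<in>S. f v = c})"
       "real (card {v\<in>S. f v = c}) < (1 + 2 * \<delta>) * real (card S) / real N"
      by (simp_all only: B_def prod.case if_True if_False not_le)
  qed
qed

section \<open>Disjoint paths in expanding relations\<close>

definition nb :: "('a \<Rightarrow> 'a \<Rightarrow> bool) \<Rightarrow> 'a set \<Rightarrow> 'a set" where
  "nb E X = {y. \<exists>x\<in>X. E x y}"

fun reach :: "('a \<Rightarrow> 'a \<Rightarrow> bool) \<Rightarrow> 'a set \<Rightarrow> nat \<Rightarrow> 'a set \<Rightarrow> 'a set" where
  "reach E G 0 X = X"
| "reach E G (Suc k) X = reach E G k X \<union> (nb E (reach E G k X) \<inter> G)"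

lemma nb_mono: "X \<subseteq> Y \<Longrightarrow> nb E X \<subseteq> nb E Y"
  by (auto simp: nb_def)

lemma nb_Un: "nb E (X \<union> Y) = nb E X \<union> nb E Y"
  by (auto simp: nb_def)

lemma reach_subset: "X \<subseteq> G \<Longrightarrow> reach E G k X \<subseteq> G"
  by (induction k) auto

lemma reach_add: "reach E G (m + k) X = reach E G m (reach E G k X)"
  by (induction m) auto

lemma reach_increasing: "k \<le> m \<Longrightarrow> reach E G k X \<subseteq> reach E G m X"
  by (induction m) (auto simp: le_Suc_eq)

lemma reach_mono: "X \<subseteq> Y \<Longrightarrow> G \<subseteq> G' \<Longrightarrow> reach E G k X \<subseteq> reach E G' k Y"
proof (induction k)
  case (Suc k)
  then show ?case using nb_mono[of "reach E G k X" "reach E G' k Y" E] by auto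
qed simp

lemma reach_walk:
  assumes "y \<in> reach E G k X" "X \<subseteq> G"
  shows "\<exists>xs. xs \<noteq> [] \<and> hd xs \<in> X \<and> last xs = y \<and> successively E xs \<and> set xs \<subseteq> G \<and> length xs \<le> k + 1"
  using assms(1)
proof (induction k arbitrary: y)
  case 0
  then show ?case using assms(2) by (intro exI[of _ "[y]"]) auto
next
  case (Suc k)
  show ?case
  proof (cases "y \<in> reach E G k X")
    case True
    from Suc.IH[OF this] show ?thesis by fastforce
  next
    case False
    with Suc.prems obtain z where z: "z \<in> reach E G k X" "E z y" "y \<in> G" by (auto simp: nb_def)
    from Suc.IH[OF z(1)] obtain xs where xs: "xs \<noteq> []" "hd xs \<in> X" "last xs = z" "successively E xs"
      "set xs \<subseteq> G" "length xs \<le> k + 1" by blast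
    show ?thesis
      using xs z by (intro exI[of _ "xs @ [y]"]) (auto simp: successively_append_iff)
  qed
qed

lemma walk_to_path:
  assumes "successively E xs" "xs \<noteq> []"
  shows "\<exists>ys. ys \<noteq> [] \<and> distinct ys \<and> successively E ys \<and> hd ys = hd xs \<and> last ys = last xs \<and>
    set ys \<subseteq> set xs \<and> length ys \<le> length xs"
  using assms
proof (induction "length xs" arbitrary: xs rule: less_induct)
  case less
  show ?case
  proof (cases "distinct xs")
    case True
    then show ?thesis using less.prems by blast
  next
    case False
    then obtain as bs cs y where xs: "xs = as @ [y] @ bs @ [y] @ cs" using not_distinct_decomp by blast
    let ?zs = "as @ [y] @ cs"
    have "successively E ?zs"
      using less.prems(1) unfolding xs by (auto simp: successively_append_iff successively_Cons)
    moreover have "hd ?zs = hd xs" "last ?zs = last xs" "set ?zs \<subseteq> set xs" "length ?zs < length xs"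
      by (auto simp: xs hd_append)
    ultimately show ?thesis using less.hyps[of ?zs] by fastforce
  qed
qed

text \<open>Deleting from the free vertices a largest set that fails to double leaves a graph in which
  every small set doubles, so that even single vertices reach many others.\<close>

lemma most_reach_many:
  fixes M w :: real
  assumes R: "finite R" "W \<subseteq> R" "real (card W) \<le> w" and M: "0 < M"
    and small: "\<And>X. X \<subseteq> R \<Longrightarrow> real (card X) \<le> M \<Longrightarrow> 16 * card X \<le> card (nb E X \<inter> R)"
    and large: "\<And>X. X \<subseteq> R \<Longrightarrow> M / 2 \<le> real (card X) \<Longrightarrow> w + 2 * M < real (card (nb E X \<inter> R))"
    and I: "finite I"
    and smallI: "\<And>X. X \<subseteq> I \<Longrightarrow> real (card X) \<le> M \<Longrightarrow> 16 * card X \<le> card (\<Union>(P ` X) \<inter> R)"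
    and largeI: "\<And>X. X \<subseteq> I \<Longrightarrow> M / 2 \<le> real (card X) \<Longrightarrow> w + 2 * M < real (card (\<Union>(P ` X) \<inter> R))"
    and k: "card R < 2 ^ k"
  shows "\<exists>B\<subseteq>I. 8 * card B \<le> card W \<and> (\<forall>i\<in>I - B. M / 2 \<le> real (card (reach E (R - W) k (P i \<inter> (R - W)))))"
proof -
  define G where "G = R - W"
  have finG: "finite G" using R by (simp add: G_def)
  define \<Q> where "\<Q> = {Q. Q \<subseteq> G \<and> real (card Q) \<le> M \<and> card (nb E Q \<inter> G - Q) \<le> card Q}"
  have "{} \<in> \<Q>" using M by (simp add: \<Q>_def nb_def)
  moreover have "finite \<Q>" using finG by (auto simp: \<Q>_def intro: finite_subset[of _ "Pow G"])
  ultimately have "Max (card ` \<Q>) \<in> card ` \<Q>" and fin: "finite (card ` \<Q>)" by (auto intro: Max_in)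
  then obtain Q where Q: "Q \<in> \<Q>" "card Q = Max (card ` \<Q>)" by auto
  have max: "card Z \<le> card Q" if "Z \<in> \<Q>" for Z using that Q fin by simp
  have QG: "Q \<subseteq> G" "real (card Q) \<le> M" and Qn: "card (nb E Q \<inter> G - Q) \<le> card Q" using Q(1) by (auto simp: \<Q>_def)
  have finQ: "finite Q" using QG finG finite_subset by blast
  have finW: "finite W" using R finite_subset by blast
  have QR: "Q \<subseteq> R" using QG by (auto simp: G_def)
  \<comment> \<open>The neighbours of \<open>Q\<close> in \<open>R\<close> are blocked, in
    \<open>Q\<close>, or among the at most \<open>card Q\<close> free ones outside
    \<open>Q\<close>.\<close>
  have nbQ: "card (nb E Q \<inter> R) \<le> card W + 2 * card Q"
  proof -
    have "nb E Q \<inter> R \<subseteq> W \<union> Q \<union> (nb E Q \<inter> G - Q)" by (auto simp: G_def)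
    then have "card (nb E Q \<inter> R) \<le> card (W \<union> Q \<union> (nb E Q \<inter> G - Q))"
      using finW finQ finG by (intro card_mono) auto
    also have "\<dots> \<le> card W + card Q + card (nb E Q \<inter> G - Q)"
      by (meson add_le_mono card_Un_le le_refl order_trans)
    finally show ?thesis using Qn by simp
  qed
  have Qhalf: "real (card Q) < M / 2"
  proof (rule ccontr)
    assume "\<not> ?thesis"
    then have "w + 2 * M < real (card (nb E Q \<inter> R))" using large QR by auto
    moreover have "real (card (nb E Q \<inter> R)) \<le> real (card W) + 2 * real (card Q)"
      using nbQ of_nat_mono by fastforce
    ultimately show False using R QG by linarith
  qed
  \<comment> \<open>From 16 |Q| \<le> |W| + 2 |Q|: only blocked vertices can keep a set from
    expanding.\<close>
  have QW: "14 * card Q \<le> card W"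
    using small[OF QR QG(2)] nbQ by linarith
  define G' where "G' = G - Q"
  have G'R: "G' \<subseteq> R" "finite G'" using finG by (auto simp: G'_def G_def)
  \<comment> \<open>Otherwise \<open>Z \<union> Q\<close> would be a larger set that fails to
    double.\<close>
  have double: "card Z < card (nb E Z \<inter> G' - Z)"
    if Z: "Z \<subseteq> G'" "Z \<noteq> {}" "real (card Z) + real (card Q) \<le> M" for Z
  proof (rule ccontr)
    assume n: "\<not> ?thesis"
    have finZ: "finite Z" using Z(1) G'R finite_subset by blast
    have cardZ: "card (Z \<union> Q) = card Z + card Q"
      using Z(1) finZ finQ by (intro card_Un_disjoint) (auto simp: G'_def)
    have "nb E (Z \<union> Q) \<inter> G - (Z \<union> Q) \<subseteq> (nb E Z \<inter> G' - Z) \<union> (nb E Q \<inter> G - Q)"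
      by (auto simp: nb_Un G'_def)
    then have "card (nb E (Z \<union> Q) \<inter> G - (Z \<union> Q)) \<le> card ((nb E Z \<inter> G' - Z) \<union> (nb E Q \<inter> G - Q))"
      using G'R finG by (intro card_mono) auto
    also have "\<dots> \<le> card (nb E Z \<inter> G' - Z) + card (nb E Q \<inter> G - Q)" by (rule card_Un_le)
    also have "\<dots> \<le> card (Z \<union> Q)" using n Qn cardZ by linarith
    finally have "Z \<union> Q \<in> \<Q>" using Z QG cardZ by (auto simp: \<Q>_def G'_def)
    from max[OF this] cardZ have "card Z = 0" by simp
    with Z(2) finZ show False by simp
  qed
  \<comment> \<open>The indices whose start sets are swallowed by \<open>W \<union> Q\<close>. The
    start sets expand as a family, so many such indices would need more room than
    \<open>W \<union> Q\<close> offers.\<close>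
  define B where "B = {i\<in>I. P i \<inter> G' = {}}"
  have BI: "B \<subseteq> I" by (auto simp: B_def)
  have "\<Union>(P ` B) \<inter> R \<subseteq> W \<union> Q" by (auto simp: B_def G'_def G_def)
  then have "card (\<Union>(P ` B) \<inter> R) \<le> card (W \<union> Q)" using finW finQ by (intro card_mono) auto
  then have PB: "card (\<Union>(P ` B) \<inter> R) \<le> card W + card Q" using card_Un_le le_trans by blast
  have "real (card B) < M / 2"
  proof (rule ccontr)
    assume "\<not> ?thesis"
    then have "w + 2 * M < real (card (\<Union>(P ` B) \<inter> R))" using largeI BI by auto
    moreover have "real (card (\<Union>(P ` B) \<inter> R)) \<le> real (card W) + real (card Q)"
      using PB of_nat_mono by fastforce
    ultimately show False using R QG M by linarith
  qed
  then have "16 * card B \<le> card W + card Q" using smallI[OF BI] M PB by linarith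
  then have B8: "8 * card B \<le> card W" using QW by linarith
  have "M / 2 \<le> real (card (reach E G k (P i \<inter> G)))" if i: "i \<in> I - B" for i
  proof -
    obtain z where z: "z \<in> P i \<inter> G'" using i by (auto simp: B_def)
    have sub: "reach E G' m {z} \<subseteq> G'" for m using reach_subset[of "{z}" G' E m] z by auto
    have grow: "M / 2 \<le> real (card (reach E G' m {z})) \<or> 2 ^ m \<le> card (reach E G' m {z})" for m
    proof (induction m)
      case (Suc m)
      let ?X = "reach E G' m {z}"
      have fX: "finite ?X" using sub G'R finite_subset by blast
      have inc: "card ?X \<le> card (reach E G' (Suc m) {z})"
        using sub G'R by (intro card_mono finite_subset[OF sub]) auto
      show ?case
      proof (cases "M / 2 \<le> real (card ?X)")
        case True
        then show ?thesis using inc of_nat_mono[OF inc, where 'a=real] by linarith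
      next
        case False
        have ne: "?X \<noteq> {}" using reach_increasing[of 0 m E G' "{z}"] by auto
        have "card ?X < card (nb E ?X \<inter> G' - ?X)"
          using double[OF sub ne] False Qhalf by linarith
        moreover have "reach E G' (Suc m) {z} = ?X \<union> (nb E ?X \<inter> G' - ?X)" by auto
        then have "card (reach E G' (Suc m) {z}) = card ?X + card (nb E ?X \<inter> G' - ?X)"
          using fX G'R by (metis Diff_disjoint card_Un_disjoint finite_Diff finite_Int)
        ultimately show ?thesis using Suc.IH False by simp
      qed
    qed simp
    have "card (reach E G' k {z}) \<le> card R" using sub G'R R by (intro card_mono) blast+
    then have "M / 2 \<le> real (card (reach E G' k {z}))" using grow[of k] k by linarith
    also have "\<dots> \<le> real (card (reach E G k (P i \<inter> G)))"
      using reach_mono[of "{z}" "P i \<inter> G" G' G E k] z reach_subset[of "P i \<inter> G" G E k] finG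
      by (intro of_nat_mono card_mono) (auto simp: G'_def intro: finite_subset)
    finally show ?thesis .
  qed
  then show ?thesis using BI B8 unfolding G_def by blast
qed

definition link_path :: "('a \<Rightarrow> 'a \<Rightarrow> bool) \<Rightarrow> 'a set \<Rightarrow> nat \<Rightarrow> 'a set \<Rightarrow> 'a set \<Rightarrow> 'a list \<Rightarrow> bool" where
  "link_path E R l P Q xs \<longleftrightarrow> xs \<noteq> [] \<and> hd xs \<in> P \<and> last xs \<in> Q \<and> distinct xs \<and> set xs \<subseteq> R \<and>
     successively E xs \<and> length xs \<le> l"

text \<open>The forward walk and the reversed backward walk share the vertex \<open>y\<close>, so
  the length is (k + 1) + (k + 1) - 1. They may also cross elsewhere, hence the passage from a walk
  to a path.\<close>

lemma reach_meet:
  assumes "y \<in> reach E G k (P \<inter> G)" "y \<in> reach (\<lambda>a b. E b a) G k (Q \<inter> G)"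
  shows "\<exists>xs. link_path E G (2 * k + 1) P Q xs"
proof -
  obtain xs where xs: "xs \<noteq> []" "hd xs \<in> P" "last xs = y" "successively E xs" "set xs \<subseteq> G" "length xs \<le> k + 1"
    using reach_walk[OF assms(1)] by auto
  obtain ys where ys: "ys \<noteq> []" "hd ys \<in> Q" "last ys = y" "successively (\<lambda>a b. E b a) ys" "set ys \<subseteq> G"
    "length ys \<le> k + 1"
    using reach_walk[OF assms(2)] by auto
  obtain y' zs where r: "rev ys = y' # zs" using ys(1) by (cases "rev ys") auto
  have y': "y' = y" using ys(3) r by (metis hd_rev list.sel(1))
  have "successively E (rev ys)" using ys(4) by simp
  then have sz: "successively E (y # zs)" using r y' by simp
  have w: "successively E (xs @ zs)"
    using xs sz by (auto simp: successively_append_iff successively_Cons)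
  have "last (xs @ zs) = last (y # zs)" using xs by (simp add: last_append)
  also have "\<dots> = hd ys" using r y' by (metis last_rev)
  finally have l: "last (xs @ zs) \<in> Q" using ys by simp
  have s: "set (xs @ zs) \<subseteq> G" using xs ys r by (metis Un_subset_iff set_append set_rev set_subset_Cons subset_trans)
  have "length ys = Suc (length zs)" using r by (metis length_Cons length_rev)
  then have len: "length (xs @ zs) \<le> 2 * k + 1" using xs ys by simp
  obtain us where "us \<noteq> []" "distinct us" "successively E us" "hd us = hd (xs @ zs)" "last us = last (xs @ zs)"
    "set us \<subseteq> set (xs @ zs)" "length us \<le> length (xs @ zs)"
    using walk_to_path[OF w] xs by auto
  then have "link_path E G (2 * k + 1) P Q us" using xs l s len by (auto simp: link_path_def)
  then show ?thesis by blast
qed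

text \<open>Greedy choice: while fewer than |I| / l pairs are linked, their paths block at most |I|
  vertices. Then some unlinked pair can still grow in both directions around the blocked set; both
  its searches cover more than half of \<open>C\<close>, so they meet there.\<close>

lemma link_a_fraction:
  fixes M :: real
  assumes R: "finite R" and I: "finite I" and M: "0 < M" and k: "card R < 2 ^ k"
    and C: "C \<subseteq> R"
    and small: "\<And>X. X \<subseteq> R \<Longrightarrow> real (card X) \<le> M \<Longrightarrow> 16 * card X \<le> card (nb E X \<inter> R)"
      "\<And>X. X \<subseteq> R \<Longrightarrow> real (card X) \<le> M \<Longrightarrow> 16 * card X \<le> card (nb (\<lambda>a b. E b a) X \<inter> R)"
    and large: "\<And>X. X \<subseteq> R \<Longrightarrow> M / 2 \<le> real (card X) \<Longrightarrow> real (card I) + 2 * M < real (card (nb E X \<inter> R))"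
      "\<And>X. X \<subseteq> R \<Longrightarrow> M / 2 \<le> real (card X) \<Longrightarrow> real (card I) + 2 * M < real (card (nb (\<lambda>a b. E b a) X \<inter> R))"
    and smallI: "\<And>X. X \<subseteq> I \<Longrightarrow> real (card X) \<le> M \<Longrightarrow> 16 * card X \<le> card (\<Union>(P ` X) \<inter> R)"
      "\<And>X. X \<subseteq> I \<Longrightarrow> real (card X) \<le> M \<Longrightarrow> 16 * card X \<le> card (\<Union>(Q ` X) \<inter> R)"
    and largeI: "\<And>X. X \<subseteq> I \<Longrightarrow> M / 2 \<le> real (card X) \<Longrightarrow> real (card I) + 2 * M < real (card (\<Union>(P ` X) \<inter> R))"
      "\<And>X. X \<subseteq> I \<Longrightarrow> M / 2 \<le> real (card X) \<Longrightarrow> real (card I) + 2 * M < real (card (\<Union>(Q ` X) \<inter> R))"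
    and half: "\<And>W X. W \<subseteq> R \<Longrightarrow> card W \<le> card I \<Longrightarrow> X \<subseteq> R - W \<Longrightarrow> M / 2 \<le> real (card X) \<Longrightarrow>
        card C < 2 * card (reach E (R - W) 5 X \<inter> C)"
      "\<And>W X. W \<subseteq> R \<Longrightarrow> card W \<le> card I \<Longrightarrow> X \<subseteq> R - W \<Longrightarrow> M / 2 \<le> real (card X) \<Longrightarrow>
        card C < 2 * card (reach (\<lambda>a b. E b a) (R - W) 5 X \<inter> C)"
  defines "l \<equiv> 2 * (k + 5) + 1"
  shows "\<exists>I0\<subseteq>I. \<exists>f. card I \<le> l * card I0 \<and> (\<forall>i\<in>I0. link_path E R l (P i) (Q i) (f i)) \<and>
           disjoint_family_on (\<lambda>i. set (f i)) I0"
proof -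
  let ?S = "\<lambda>I0 f. I0 \<subseteq> I \<and> (\<forall>i\<in>I0. link_path E R l (P i) (Q i) (f i)) \<and> disjoint_family_on (\<lambda>i. set (f i)) I0"
  have step: "\<exists>I1 f1. ?S I1 f1 \<and> card I1 = Suc (card I0)" if S: "?S I0 f" and less: "l * card I0 < card I" for I0 f
  proof -
    have finI0: "finite I0" using S I finite_subset by blast
    define W where "W = (\<Union>i\<in>I0. set (f i))"
    have WR: "W \<subseteq> R" using S by (auto simp: W_def link_path_def)
    have "card W \<le> (\<Sum>i\<in>I0. card (set (f i)))" unfolding W_def by (rule card_UN_le) fact
    also have "\<dots> \<le> (\<Sum>i\<in>I0. l)"
      using S by (intro sum_mono) (auto simp: link_path_def intro: le_trans[OF card_length])
    finally have Wl: "card W \<le> l * card I0" by (simp add: mult.commute)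
    with less have WI: "card W \<le> card I" by simp
    obtain B1 where B1: "B1 \<subseteq> I" "8 * card B1 \<le> card W"
        "\<And>i. i \<in> I - B1 \<Longrightarrow> M / 2 \<le> real (card (reach E (R - W) k (P i \<inter> (R - W))))"
      using most_reach_many[OF R WR of_nat_mono[OF WI] M small(1) large(1) I smallI(1) largeI(1) k] by blast
    obtain B2 where B2: "B2 \<subseteq> I" "8 * card B2 \<le> card W"
        "\<And>i. i \<in> I - B2 \<Longrightarrow> M / 2 \<le> real (card (reach (\<lambda>a b. E b a) (R - W) k (Q i \<inter> (R - W))))"
      using most_reach_many[OF R WR of_nat_mono[OF WI] M small(2) large(2) I smallI(2) largeI(2) k] by blast
    \<comment> \<open>Since l \<ge> 11, the linked indices are fewer than |I| / 11, and each of
      \<open>B1\<close>, \<open>B2\<close> has fewer than |I| / 8 elements.\<close>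
    have "card (I0 \<union> B1 \<union> B2) \<le> card I0 + card B1 + card B2"
      by (meson add_le_mono card_Un_le le_refl order_trans)
    also have "\<dots> < card I"
    proof -
      have "11 * card I0 \<le> l * card I0" by (rule mult_right_mono) (auto simp: l_def)
      then show ?thesis using B1(2) B2(2) Wl less by linarith
    qed
    finally have "I0 \<union> B1 \<union> B2 \<noteq> I" by auto
    then obtain i where i: "i \<in> I" "i \<notin> I0" "i \<notin> B1" "i \<notin> B2" using S B1 B2 by blast
    \<comment> \<open>\<open>k\<close> steps enlarge the start set to \<open>M / 2\<close> vertices,
      five more carry it into \<open>C\<close>.\<close>
    let ?A = "reach E (R - W) (5 + k) (P i \<inter> (R - W))"
    let ?B = "reach (\<lambda>a b. E b a) (R - W) (5 + k) (Q i \<inter> (R - W))"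
    have "card C < 2 * card (?A \<inter> C)"
      unfolding reach_add using i by (intro half(1) WR WI reach_subset B1(3)) auto
    moreover have "card C < 2 * card (?B \<inter> C)"
      unfolding reach_add using i by (intro half(2) WR WI reach_subset B2(3)) auto
    moreover have "finite C" using C R finite_subset by blast
    moreover have "card (?A \<inter> C) + card (?B \<inter> C) = card ((?A \<inter> C) \<union> (?B \<inter> C)) + card ((?A \<inter> C) \<inter> (?B \<inter> C))"
      by (rule card_Un_Int) (simp_all add: \<open>finite C\<close>)
    moreover have "card ((?A \<inter> C) \<union> (?B \<inter> C)) \<le> card C" using \<open>finite C\<close> by (intro card_mono) auto
    ultimately have "card ((?A \<inter> C) \<inter> (?B \<inter> C)) \<noteq> 0" by linarith
    then have "(?A \<inter> C) \<inter> (?B \<inter> C) \<noteq> {}" by (metis card.empty)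
    then obtain y where "y \<in> ?A" "y \<in> ?B" by blast
    from reach_meet[OF this] obtain xs where xs: "link_path E (R - W) l (P i) (Q i) xs"
      by (auto simp: l_def add.commute)
    let ?f = "f(i := xs)"
    have "?S (insert i I0) ?f"
      using S i xs unfolding disjoint_family_on_def
      by (auto simp: link_path_def W_def disjoint_iff)
    moreover have "card (insert i I0) = Suc (card I0)" using finI0 i by simp
    ultimately show ?thesis by blast
  qed
  \<comment> \<open>Either enough pairs are already linked or exactly \<open>m\<close> are. At
    \<open>m = card I\<close> the second case is enough as well, because l \<ge> 1.\<close>
  have "\<exists>I0 f. ?S I0 f \<and> (card I \<le> l * card I0 \<or> card I0 = m)" for m
  proof (induction m)
    case 0
    show ?case by (intro exI[of _ "{}"]) (auto simp: disjoint_family_on_def)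
  next
    case (Suc m)
    then obtain I0 f where S: "?S I0 f" "card I \<le> l * card I0 \<or> card I0 = m" by blast
    show ?case
    proof (cases "card I \<le> l * card I0")
      case True
      with S show ?thesis by blast
    next
      case False
      then have "l * card I0 < card I" by simp
      from step[OF S(1) this] S False show ?thesis by metis
    qed
  qed
  from this[of "card I"] obtain I0 f where "?S I0 f" "card I \<le> l * card I0 \<or> card I0 = card I" by blast
  moreover have "1 \<le> l" by (simp add: l_def)
  then have "card I \<le> l * card I" by simp
  ultimately show ?thesis by metis
qed

text \<open>A round leaves at most the proportion 1 - 1/l of its pairs, so by \<open>count\<close>
  less than one pair survives \<open>J\<close> rounds. Paths from different rounds are disjoint
  because every round has its own set \<open>R j\<close>.\<close>

lemma iterate_rounds:
  fixes ok :: "nat \<Rightarrow> 'i \<Rightarrow> 'a list \<Rightarrow> bool"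
  assumes I: "finite I"
    and round: "\<And>j I'. j < J \<Longrightarrow> I' \<subseteq> I \<Longrightarrow> \<exists>I0\<subseteq>I'. \<exists>f. card I' \<le> l * card I0 \<and> (\<forall>i\<in>I0. ok j i (f i)) \<and>
         disjoint_family_on (\<lambda>i. set (f i)) I0"
    and okR: "\<And>j i xs. j < J \<Longrightarrow> ok j i xs \<Longrightarrow> set xs \<subseteq> R j"
    and R: "disjoint_family_on R {..<J}"
    and count: "(l - 1) ^ J * card I < l ^ J" and l: "0 < l"
  shows "\<exists>f h. (\<forall>i\<in>I. h i < J \<and> ok (h i) i (f i)) \<and> disjoint_family_on (\<lambda>i. set (f i)) I"
proof -
  have "\<exists>I1\<subseteq>I. \<exists>f h. (\<forall>i\<in>I - I1. h i < m \<and> ok (h i) i (f i)) \<and> disjoint_family_on (\<lambda>i. set (f i)) (I - I1) \<and>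
          l ^ m * card I1 \<le> (l - 1) ^ m * card I" if "m \<le> J" for m
    using that
  proof (induction m)
    case 0
    show ?case by (intro exI[of _ I]) (auto simp: disjoint_family_on_def)
  next
    case (Suc m)
    then obtain I1 f h where I1: "I1 \<subseteq> I" "\<And>i. i \<in> I - I1 \<Longrightarrow> h i < m \<and> ok (h i) i (f i)"
      "disjoint_family_on (\<lambda>i. set (f i)) (I - I1)" "l ^ m * card I1 \<le> (l - 1) ^ m * card I"
      using Suc_leD by blast
    have m: "m < J" using Suc.prems by simp
    obtain I0 g where I0: "I0 \<subseteq> I1" "card I1 \<le> l * card I0" "\<And>i. i \<in> I0 \<Longrightarrow> ok m i (g i)"
      "disjoint_family_on (\<lambda>i. set (g i)) I0"
      using round[OF m I1(1)] by blast
    define f' where "f' = (\<lambda>i. if i \<in> I0 then g i else f i)"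
    define h' where "h' = (\<lambda>i. if i \<in> I0 then m else h i)"
    have ok': "h' i < Suc m \<and> ok (h' i) i (f' i)" if "i \<in> I - (I1 - I0)" for i
      using that I1(2)[of i] I0(3)[of i] by (auto simp: f'_def h'_def)
    have cross: "set (f' i) \<inter> set (f' i') = {}" if "i \<in> I0" "i' \<in> I - I1" for i i'
    proof -
      have "set (f' i) \<subseteq> R m" using okR[OF m I0(3)[OF that(1)]] that by (auto simp: f'_def)
      moreover have "i' \<notin> I0" using that I0 by auto
      then have "set (f' i') \<subseteq> R (h i')" "h i' < m"
        using okR[of "h i'" i' "f i'"] that I1(2)[of i'] m by (auto simp: f'_def)
      moreover have "R m \<inter> R (h i') = {}"
        using R \<open>h i' < m\<close> m by (auto simp: disjoint_family_on_def)
      ultimately show ?thesis by blast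
    qed
    have "disjoint_family_on (\<lambda>i. set (f' i)) (I - (I1 - I0))"
      unfolding disjoint_family_on_def
    proof (intro ballI impI)
      fix i i' assume ii: "i \<in> I - (I1 - I0)" "i' \<in> I - (I1 - I0)" "i \<noteq> i'"
      consider "i \<in> I0" "i' \<in> I0" | "i \<in> I0" "i' \<in> I - I1" | "i \<in> I - I1" "i' \<in> I0"
        | "i \<in> I - I1" "i' \<in> I - I1" "i \<notin> I0" "i' \<notin> I0" using ii I0 by blast
      then show "set (f' i) \<inter> set (f' i') = {}"
      proof cases
        case 1 then show ?thesis using I0(4) ii by (auto simp: disjoint_family_on_def f'_def)
      next
        case 2 then show ?thesis using cross by blast
      next
        case 3 then show ?thesis using cross by blast
      next
        case 4 then show ?thesis using I1(3) ii by (auto simp: disjoint_family_on_def f'_def)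
      qed
    qed
    moreover have "l ^ Suc m * card (I1 - I0) \<le> (l - 1) ^ Suc m * card I"
    proof -
      have "card (I1 - I0) = card I1 - card I0"
        using I0 I1 I by (meson card_Diff_subset finite_subset)
      moreover have "l * card I1 - l * card I0 \<le> l * card I1 - card I1" using I0(2) by simp
      ultimately have "l * card (I1 - I0) \<le> (l - 1) * card I1"
        by (simp add: diff_mult_distrib diff_mult_distrib2)
      then have "l ^ m * (l * card (I1 - I0)) \<le> l ^ m * ((l - 1) * card I1)" by (rule mult_left_mono) simp
      also have "\<dots> = (l - 1) * (l ^ m * card I1)" by simp
      also have "\<dots> \<le> (l - 1) * ((l - 1) ^ m * card I)" using I1(4) by (rule mult_left_mono) simp
      finally show ?thesis by (simp add: ac_simps)
    qed
    ultimately show ?case using ok' I1(1)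
      by (intro exI[of _ "I1 - I0"] conjI exI[of _ f'] exI[of _ h']) auto
  qed
  from this[of J] obtain I1 f h where I1: "I1 \<subseteq> I" "\<forall>i\<in>I - I1. h i < J \<and> ok (h i) i (f i)"
      "disjoint_family_on (\<lambda>i. set (f i)) (I - I1)" "l ^ J * card I1 \<le> (l - 1) ^ J * card I" by auto
  have "l ^ J * card I1 < l ^ J * 1" using order.strict_trans1[OF I1(4) count] by (simp only: mult_1_right)
  then have "card I1 = 0" by (meson less_one mult_less_cancel1)
  then have "I1 = {}" using I1(1) I finite_subset card_0_eq by metis
  then show ?thesis using I1 by auto
qed

section \<open>Expansion in pseudorandom relations\<close>

definition edges :: "('a \<Rightarrow> 'a \<Rightarrow> bool) \<Rightarrow> 'a set \<Rightarrow> 'a set \<Rightarrow> nat" where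
  "edges E X Y = card {(x, y). x \<in> X \<and> y \<in> Y \<and> E x y}"

lemma edges_flip: "edges (\<lambda>x y. E y x) X Y = edges E Y X"
proof -
  have "{(x, y). x \<in> X \<and> y \<in> Y \<and> E y x} = prod.swap ` {(x, y). x \<in> Y \<and> y \<in> X \<and> E x y}" by auto
  then show ?thesis unfolding edges_def by (simp add: card_image)
qed

lemma edges_conv_sum:
  assumes "finite X" "finite Y"
  shows "edges E X Y = (\<Sum>x\<in>X. card (nb E {x} \<inter> Y))"
proof -
  have "{(x, y). x \<in> X \<and> y \<in> Y \<and> E x y} = (SIGMA x:X. nb E {x} \<inter> Y)" by (auto simp: nb_def)
  then show ?thesis using assms by (simp add: edges_def)
qed

lemma edges_mono:
  assumes "finite X'" "finite Y'" "X \<subseteq> X'" "Y \<inter> nb E X \<subseteq> Y'"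
  shows "edges E X Y \<le> edges E X' Y'"
  unfolding edges_def
  by (rule card_mono, rule finite_subset[of _ "X' \<times> Y'"]) (use assms in \<open>auto simp: nb_def\<close>)

text \<open>A minimum semidegree relative to \<open>card S\<close>. Being relative, it passes to
  disjoint unions, so any union of colour classes is as rich as a single one.\<close>

definition rich :: "'a set \<Rightarrow> ('a \<Rightarrow> 'a \<Rightarrow> bool) \<Rightarrow> real \<Rightarrow> 'a set \<Rightarrow> bool" where
  "rich V E c S \<longleftrightarrow> S \<subseteq> V \<and> (\<forall>v\<in>V. c * real (card S) \<le> real (card (nb E {v} \<inter> S)) \<and>
     c * real (card S) \<le> real (card (nb (\<lambda>x y. E y x) {v} \<inter> S)))"

lemma rich_flip: "rich V (\<lambda>x y. E y x) c S \<longleftrightarrow> rich V E c S"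
  by (auto simp: rich_def)

lemma rich_UN:
  assumes "finite A" "disjoint_family_on S A" "finite V" "\<And>a. a \<in> A \<Longrightarrow> rich V E c (S a)"
  shows "rich V E c (\<Union>a\<in>A. S a)"
proof -
  have fin: "finite (S a)" if "a \<in> A" for a using assms(3,4) that by (auto simp: rich_def intro: finite_subset)
  have card: "card (X \<inter> (\<Union>a\<in>A. S a)) = (\<Sum>a\<in>A. card (X \<inter> S a))" for X
  proof -
    have "X \<inter> (\<Union>a\<in>A. S a) = (\<Union>a\<in>A. X \<inter> S a)" by auto
    moreover have "card (\<Union>a\<in>A. X \<inter> S a) = (\<Sum>a\<in>A. card (X \<inter> S a))"
      using assms(1,2) fin by (intro card_UN_disjoint) (auto simp: disjoint_family_on_def)
    ultimately show ?thesis by simp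
  qed
  have 1: "real (card (\<Union>a\<in>A. S a)) = (\<Sum>a\<in>A. real (card (S a)))"
    using card[of UNIV] by simp
  show ?thesis
    unfolding rich_def card 1 sum_distrib_left of_nat_sum
    using assms(4) by (auto simp: rich_def intro!: sum_mono)
qed

text \<open>A bare relation is used instead of a digraph so that reversing all arcs yields another
  instance, and each fact on out-neighbours also serves for in-neighbours. \<open>L\<close> stands
  for \<open>ln n\<close>. The constant 520 is 65 * 8: a set of \<open>8 * M0\<close> vertices,
  joined with 64 times as many neighbours, must still fall under (P2).\<close>

locale pseudorandom_relation =
  fixes V :: "'a set" and E :: "'a \<Rightarrow> 'a \<Rightarrow> bool" and \<alpha> p L :: real
  assumes finite_V: "finite V" and \<alpha>_pos: "\<alpha> > 0" and p_pos: "p > 0"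
    and L_ge_1: "1 \<le> L" and L_large: "520 * L powr 1.1 \<le> L\<^sup>2"
    and out_degree: "\<And>v. v \<in> V \<Longrightarrow> (1/2 + 2 * \<alpha>) * real (card V) * p \<le> real (card (nb E {v} \<inter> V))"
    and in_degree: "\<And>v. v \<in> V \<Longrightarrow> (1/2 + 2 * \<alpha>) * real (card V) * p \<le> real (card (nb (\<lambda>x y. E y x) {v} \<inter> V))"
    and sparse: "\<And>X. X \<subseteq> V \<Longrightarrow> real (card X) \<le> L\<^sup>2 / p \<Longrightarrow> real (edges E X X) \<le> real (card X) * L powr 2.1"
    and upper: "\<And>X Y. X \<subseteq> V \<Longrightarrow> Y \<subseteq> V \<Longrightarrow> X \<inter> Y = {} \<Longrightarrow> L powr 1.1 / p \<le> real (card X) \<Longrightarrow>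
      L powr 1.1 / p \<le> real (card Y) \<Longrightarrow> real (edges E X Y) \<le> (1 + \<alpha> / 2) * real (card X) * real (card Y) * p"
begin

text \<open>\<open>M0\<close> is the threshold of (P3), and \<open>1/2 + \<gamma>\<close> the proportion of a set of large minimum degree that
  is reached from \<open>M0\<close> vertices.\<close>

definition "M0 = L powr 1.1 / p"
definition "\<gamma> = \<alpha> / (24 + 24 * \<alpha>)"

lemma M0_pos: "0 < M0"
  using p_pos L_ge_1 by (simp add: M0_def)

lemma \<gamma>_pos: "0 < \<gamma>" and \<gamma>_less: "\<gamma> < 1/24"
  using \<alpha>_pos by (simp_all add: \<gamma>_def field_simps)

text \<open>This inequality determines \<gamma>. If the neighbourhood of \<open>X\<close> filled
  only 1/2 + \<gamma> of \<open>S\<close>, then (P3) would allow the left-hand side times |X| |S| p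
  arcs, while degrees of 1/2 + \<alpha>/3 supply the right-hand side.\<close>

lemma \<gamma>_bound: "(1 + \<alpha> / 2) * (1/2 + \<gamma>) < 1/2 + \<alpha> / 3"
proof -
  have "\<gamma> * (1 + \<alpha>) = \<alpha> / 24" using \<alpha>_pos by (simp add: \<gamma>_def field_simps)
  then have "\<gamma> + \<gamma> * \<alpha> = \<alpha> / 24" by (simp add: algebra_simps)
  moreover have "0 < \<gamma> * \<alpha>" using \<gamma>_pos \<alpha>_pos by simp
  moreover have "(1 + \<alpha> / 2) * (1/2 + \<gamma>) = 1/2 + \<alpha> / 4 + \<gamma> + \<gamma> * \<alpha> / 2" by (simp add: algebra_simps)
  ultimately show ?thesis using \<alpha>_pos \<gamma>_pos by linarith
qed

lemma flip: "pseudorandom_relation V (\<lambda>x y. E y x) \<alpha> p L"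
proof
  fix X Y assume "X \<subseteq> V" "Y \<subseteq> V" "X \<inter> Y = {}" "L powr 1.1 / p \<le> real (card X)" "L powr 1.1 / p \<le> real (card Y)"
  then show "real (edges (\<lambda>x y. E y x) X Y) \<le> (1 + \<alpha> / 2) * real (card X) * real (card Y) * p"
    using upper[of Y X] by (simp add: edges_flip[of E] mult_ac Int_commute)
next
  fix X assume "X \<subseteq> V" "real (card X) \<le> L\<^sup>2 / p"
  then show "real (edges (\<lambda>x y. E y x) X X) \<le> real (card X) * L powr 2.1"
    unfolding edges_flip[of E] by (rule sparse)
qed (fact finite_V \<alpha>_pos p_pos L_ge_1 L_large out_degree in_degree)+

text \<open>A neighbourhood that is too small may lie below the threshold of (P3). It is therefore
  padded inside \<open>S\<close> to a set \<open>T\<close> of \<open>m\<close> vertices, which still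
  receives all arcs from \<open>X\<close> to \<open>S\<close>. The size required of \<open>S\<close>
  guarantees m \<ge> M0 after rounding down.\<close>

lemma large_set_expands:
  assumes X: "X \<subseteq> V" "X \<inter> S = {}" "M0 \<le> real (card X)" and S: "S \<subseteq> V" "2 * M0 + 2 \<le> real (card S)"
    and deg: "real (card X) * ((1/2 + \<alpha> / 3) * p * real (card S)) \<le> real (edges E X S)"
  shows "(1/2 + \<gamma>) * real (card S) < real (card (nb E X \<inter> S))"
proof (rule ccontr)
  assume "\<not> ?thesis"
  then have less: "real (card (nb E X \<inter> S)) \<le> (1/2 + \<gamma>) * real (card S)" by simp
  define m where "m = nat \<lfloor>(1/2 + \<gamma>) * real (card S)\<rfloor>"
  have finS: "finite S" using S(1) finite_V finite_subset by blast
  have m1: "real m \<le> (1/2 + \<gamma>) * real (card S)" "(1/2 + \<gamma>) * real (card S) < real m + 1"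
    using \<gamma>_pos by (simp_all add: m_def of_nat_nat)
  have m2: "card (nb E X \<inter> S) \<le> m" using less by (simp add: m_def le_nat_floor)
  have m3: "m \<le> card S"
  proof -
    have "(1/2 + \<gamma>) * real (card S) \<le> 1 * real (card S)"
      using \<gamma>_less by (intro mult_right_mono) auto
    then show ?thesis using m1(1) by simp
  qed
  obtain T where T: "nb E X \<inter> S \<subseteq> T" "T \<subseteq> S" "card T = m"
    using exists_subset_between[OF m2 m3 _ finS] by auto
  have "real (edges E X S) \<le> real (edges E X T)"
    using T X(1) finite_subset[OF T(2) finS] finite_V by (intro of_nat_mono edges_mono) (auto intro: finite_subset)
  also have "\<dots> \<le> (1 + \<alpha> / 2) * real (card X) * real (card T) * p"
  proof (rule upper)
    have "0 \<le> \<gamma> * real (card S)" using \<gamma>_pos by simp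
    then have "M0 \<le> real m" using m1(2) S(2) by (simp add: algebra_simps)
    then show "L powr 1.1 / p \<le> real (card T)" using T by (simp add: M0_def)
  qed (use X S T in \<open>auto simp: M0_def\<close>)
  also have "\<dots> \<le> (1 + \<alpha> / 2) * real (card X) * ((1/2 + \<gamma>) * real (card S)) * p"
    using T m1 \<alpha>_pos p_pos by (intro mult_right_mono mult_left_mono) auto
  also have "\<dots> = ((1 + \<alpha> / 2) * (1/2 + \<gamma>)) * (real (card X) * p * real (card S))" by (simp add: mult_ac)
  also have "\<dots> < (1/2 + \<alpha> / 3) * (real (card X) * p * real (card S))"
    using \<gamma>_bound X(3) S(2) M0_pos p_pos by (intro mult_strict_right_mono mult_pos_pos) auto
  also have "\<dots> = real (card X) * ((1/2 + \<alpha> / 3) * p * real (card S))" by (simp add: mult_ac)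
  finally show False using deg by simp
qed

lemma rich_edges:
  assumes "rich V E c S" "X \<subseteq> V"
  shows "real (card X) * (c * real (card S)) \<le> real (edges E X S)"
proof -
  have "finite X" "finite S" using assms finite_V finite_subset by (auto simp: rich_def)
  moreover have "(\<Sum>x\<in>X. c * real (card S)) \<le> (\<Sum>x\<in>X. real (card (nb E {x} \<inter> S)))"
    using assms by (intro sum_mono) (auto simp: rich_def)
  ultimately show ?thesis by (simp add: edges_conv_sum)
qed

lemma rich_large_expands:
  assumes X: "X \<subseteq> V" "X \<inter> S = {}" "M0 \<le> real (card X)"
    and S: "rich V E ((1/2 + \<alpha>) * p) S" "2 * M0 + 2 \<le> real (card S)"
  shows "(1/2 + \<gamma>) * real (card S) < real (card (nb E X \<inter> S))"
proof (rule large_set_expands[OF X _ S(2)])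
  show "S \<subseteq> V" using S by (simp add: rich_def)
  have "real (card X) * ((1/2 + \<alpha> / 3) * p * real (card S)) \<le> real (card X) * ((1/2 + \<alpha>) * p * real (card S))"
    using \<alpha>_pos p_pos by (intro mult_left_mono mult_right_mono) auto
  also have "\<dots> \<le> real (edges E X S)" by (rule rich_edges[OF S(1) X(1)])
  finally show "real (card X) * ((1/2 + \<alpha> / 3) * p * real (card S)) \<le> real (edges E X S)" .
qed

text \<open>With fewer than 64 |X| neighbours, \<open>X\<close> and its neighbours would form a set
  of at most 65 |X| vertices, on which (P2) allows 65 |X| L^2.1 arcs; richness alone gives more than
  half of 130 |X| L^2.1 arcs.\<close>

lemma rich_small_expands:
  assumes X: "X \<subseteq> V" "real (card X) \<le> 8 * M0"
    and S: "rich V E ((1/2 + \<alpha>) * p) S" "130 * L powr 2.1 \<le> p * real (card S)"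
  shows "64 * card X \<le> card (nb E X \<inter> S)"
proof (rule ccontr)
  let ?T = "nb E X \<inter> S"
  assume "\<not> ?thesis"
  then have T: "card ?T < 64 * card X" by simp
  have fin: "finite X" "finite ?T" using X S finite_V by (auto simp: rich_def intro: finite_subset)
  have sub: "X \<union> ?T \<subseteq> V" using X S by (auto simp: rich_def)
  have Y: "real (card (X \<union> ?T)) \<le> 65 * real (card X)"
    using card_Un_le[of X ?T] T by linarith
  also have "\<dots> \<le> 65 * (8 * M0)" using X by simp
  also have "\<dots> = 520 * L powr 1.1 / p" by (simp add: M0_def)
  also have "\<dots> \<le> L\<^sup>2 / p" using L_large p_pos by (intro divide_right_mono) auto
  finally have 1: "real (edges E (X \<union> ?T) (X \<union> ?T)) \<le> real (card (X \<union> ?T)) * L powr 2.1"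
    using sparse sub by simp
  have "real (card X) * (65 * L powr 2.1) < real (card X) * ((1/2 + \<alpha>) * (130 * L powr 2.1))"
    using T L_ge_1 \<alpha>_pos by (intro mult_strict_left_mono) (auto simp: algebra_simps)
  also have "\<dots> \<le> real (card X) * ((1/2 + \<alpha>) * (p * real (card S)))"
    using S(2) \<alpha>_pos by (intro mult_left_mono) auto
  also have "\<dots> \<le> real (edges E X S)" using rich_edges[OF S(1) X(1)] by (simp add: mult.assoc)
  also have "\<dots> \<le> real (edges E (X \<union> ?T) (X \<union> ?T))"
    using fin by (intro of_nat_mono edges_mono) auto
  also have "\<dots> \<le> 65 * real (card X) * L powr 2.1"
    using 1 mult_right_mono[OF Y, of "L powr 2.1"] by simp
  finally show False by simp
qed

end

section \<open>Linking pairs through reservoirs\<close>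

text \<open>\<open>s\<close> sends each class to the one entered next: the successor for a forward
  search, the predecessor for a backward one. The constants are four times those needed in the union
  of the classes, because an arbitrary set is replaced by its part in its fullest class: 64 becomes
  16, and \<open>8 * M0 / 2\<close> vertices leave at least \<open>M0\<close>. \<open>t\<close>
  bounds the number of blocked vertices, and \<open>2 * t \<le> \<gamma> * \<sigma>\<close> keeps
  neighbourhoods above one half after removing them.\<close>

locale cyclic_expander =
  fixes G :: "'a \<Rightarrow> 'a \<Rightarrow> bool" and R :: "nat \<Rightarrow> 'a set" and s :: "nat \<Rightarrow> nat" and M0 \<gamma> \<sigma> t :: real
  assumes fin: "\<And>c. c < 4 \<Longrightarrow> finite (R c)" and s: "\<And>c. c < 4 \<Longrightarrow> s c < 4"
    and size: "\<And>c. c < 4 \<Longrightarrow> \<sigma> \<le> real (card (R c))"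
    and big: "\<And>c X. c < 4 \<Longrightarrow> X \<subseteq> R c \<Longrightarrow> M0 \<le> real (card X) \<Longrightarrow>
      (1/2 + \<gamma>) * real (card (R (s c))) < real (card (nb G X \<inter> R (s c)))"
    and small: "\<And>c X. c < 4 \<Longrightarrow> X \<subseteq> R c \<Longrightarrow> real (card X) \<le> 8 * M0 \<Longrightarrow>
      64 * card X \<le> card (nb G X \<inter> R (s c))"
    and M0: "0 < M0" "32 * M0 \<le> \<sigma>" and \<gamma>: "0 < \<gamma>" and t: "0 \<le> t" "2 * t \<le> \<gamma> * \<sigma>"
begin

definition "U = (\<Union>c<4. R c)"

lemma finite_U: "finite U"
  using fin by (simp add: U_def)

lemma R_subset_U: "c < 4 \<Longrightarrow> R c \<subseteq> U"
  by (auto simp: U_def)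

lemma \<gamma>_size: "c < 4 \<Longrightarrow> 2 * t \<le> \<gamma> * real (card (R c))"
  using t mult_left_mono[OF size, of c \<gamma>] \<gamma> by linarith

lemma pigeonhole:
  assumes "X \<subseteq> U"
  shows "\<exists>c<4. card X \<le> 4 * card (X \<inter> R c)"
proof (rule ccontr)
  assume n: "\<not> ?thesis"
  have "X = (\<Union>c<4. X \<inter> R c)" using assms by (auto simp: U_def)
  then have "card X \<le> (\<Sum>c<4. card (X \<inter> R c))" using card_UN_le[of "{..<4}" "\<lambda>c. X \<inter> R c"] by simp
  moreover have "(\<Sum>c<4. 4 * card (X \<inter> R c)) < (\<Sum>c<(4::nat). card X)"
    using n by (intro sum_strict_mono) (auto simp: not_le lessThan_empty_iff)
  ultimately show False by (simp add: sum_distrib_left[symmetric])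
qed

lemma small_union:
  assumes "X \<subseteq> U" "real (card X) \<le> 8 * M0"
  shows "16 * card X \<le> card (nb G X \<inter> U)"
proof -
  obtain c where c: "c < 4" "card X \<le> 4 * card (X \<inter> R c)" using pigeonhole assms by blast
  have finX: "finite X" using assms finite_U finite_subset by blast
  have "card (X \<inter> R c) \<le> card X" using finX by (intro card_mono) auto
  then have "64 * card (X \<inter> R c) \<le> card (nb G (X \<inter> R c) \<inter> R (s c))"
    using c assms by (intro small) auto
  also have "\<dots> \<le> card (nb G X \<inter> U)"
    using finite_U R_subset_U[OF s[OF c(1)]] by (intro card_mono) (auto simp: nb_def)
  finally show ?thesis using c by linarith
qed

lemma large_union:
  assumes "X \<subseteq> U" "8 * M0 / 2 \<le> real (card X)"
  shows "t + 2 * (8 * M0) < real (card (nb G X \<inter> U))"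
proof -
  obtain c where c: "c < 4" "card X \<le> 4 * card (X \<inter> R c)" using pigeonhole assms by blast
  have "(1/2 + \<gamma>) * real (card (R (s c))) < real (card (nb G (X \<inter> R c) \<inter> R (s c)))"
    using c assms by (intro big) auto
  also have "\<dots> \<le> real (card (nb G X \<inter> U))"
    using finite_U R_subset_U[OF s[OF c(1)]] by (intro of_nat_mono card_mono) (auto simp: nb_def)
  finally have "(1/2 + \<gamma>) * real (card (R (s c))) < real (card (nb G X \<inter> U))" .
  then show ?thesis
    using \<gamma>_size[OF s[OF c(1)]] size[OF s[OF c(1)]] M0 t by (simp add: distrib_right)
qed

text \<open>The fullest class of \<open>X\<close> contains at least \<open>M0\<close> vertices of
  it. From there each step conquers more than half of the next class, until the prescribed class
  \<open>d\<close> is entered.\<close>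

lemma reach_half:
  assumes W: "W \<subseteq> U" "real (card W) \<le> t" and X: "X \<subseteq> U - W" "8 * M0 / 2 \<le> real (card X)"
    and d: "\<And>c. c < 4 \<Longrightarrow> \<exists>m. 1 \<le> m \<and> m \<le> 5 \<and> (s ^^ m) c = d"
  shows "card (R d) < 2 * card (reach G (U - W) 5 X \<inter> R d)"
proof -
  have "X \<subseteq> U" using X by auto
  from pigeonhole[OF this] obtain c where c: "c < 4" "card X \<le> 4 * card (X \<inter> R c)" by blast
  have finW: "finite W" using W finite_U finite_subset by blast
  have sm: "(s ^^ m) c < 4" for m by (induction m) (use c s in auto)
  have half: "card (R (s c')) < 2 * card (reach G (U - W) (Suc m) X \<inter> R (s c'))"
    if "c' < 4" "M0 \<le> real (card (reach G (U - W) m X \<inter> R c'))" for c' m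
  proof -
    let ?Y = "reach G (U - W) m X \<inter> R c'" and ?C = "R (s c')"
    have finC: "finite ?C" using fin s that by simp
    have "real (card (?C)) / 2 + 2 * t \<le> (1/2 + \<gamma>) * real (card ?C)"
      using \<gamma>_size[OF s[OF that(1)]] by (simp add: distrib_right)
    also have "\<dots> < real (card (nb G ?Y \<inter> ?C))" using that by (intro big) auto
    also have "\<dots> \<le> real (card (reach G (U - W) (Suc m) X \<inter> ?C \<union> W))"
      using finC finW R_subset_U[OF s[OF that(1)]]
      by (intro of_nat_mono card_mono) (auto simp: nb_def)
    also have "\<dots> \<le> real (card (reach G (U - W) (Suc m) X \<inter> ?C)) + real (card W)"
      using card_Un_le of_nat_mono by (metis of_nat_add)
    finally show ?thesis using W t by linarith
  qed
  have "M0 \<le> real (card (reach G (U - W) 0 X \<inter> R c))" using c X by simp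
  then have start: "card (R (s c)) < 2 * card (reach G (U - W) (Suc 0) X \<inter> R (s c))"
    using half c by blast
  have it: "card (R ((s ^^ Suc m) c)) < 2 * card (reach G (U - W) (Suc m) X \<inter> R ((s ^^ Suc m) c))" for m
  proof (induction m)
    case 0
    then show ?case using start by simp
  next
    case (Suc m)
    have "real (card (R ((s ^^ Suc m) c))) < 2 * real (card (reach G (U - W) (Suc m) X \<inter> R ((s ^^ Suc m) c)))"
      using Suc by linarith
    \<comment> \<open>More than half of a class of at least \<open>32 * M0\<close> vertices is again
      large enough for a further step.\<close>
    then have "M0 \<le> real (card (reach G (U - W) (Suc m) X \<inter> R ((s ^^ Suc m) c)))"
      using size[OF sm[of "Suc m"]] M0 by linarith
    from half[OF sm this] show ?case by simp
  qed
  obtain m where m: "1 \<le> m" "m \<le> 5" "(s ^^ m) c = d" using d[OF c(1)] by blast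
  then obtain m' where m': "m = Suc m'" by (cases m) auto
  have "d < 4" using sm[of m] m by simp
  have "card (R d) < 2 * card (reach G (U - W) m X \<inter> R d)" using it[of m'] m m' by simp
  also have "\<dots> \<le> 2 * card (reach G (U - W) 5 X \<inter> R d)"
    using reach_increasing[OF m(2), of G "U - W" X] fin[OF \<open>d < 4\<close>]
    by (intro mult_left_mono card_mono) auto
  finally show ?thesis .
qed

end

text \<open>Paths run cyclically through four classes, so that the number of vertices of a path is determined
  modulo 4.  Absorbers need this: in them \<open>F c\<close> is the arc relation for even \<open>c\<close> and its converse for
  odd \<open>c\<close>, and the number of arcs that can be traded has to be odd.\<close>

definition cyc :: "(nat \<Rightarrow> 'a set) \<Rightarrow> (nat \<Rightarrow> 'a \<Rightarrow> 'a \<Rightarrow> bool) \<Rightarrow> 'a \<Rightarrow> 'a \<Rightarrow> bool" where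
  "cyc R F a b \<longleftrightarrow> (\<exists>c<4. a \<in> R c \<and> b \<in> R ((c + 1) mod 4) \<and> F c a b)"

text \<open>The classes are disjoint, so the class of a vertex reveals its position modulo 4.
  Starting in class 0 and ending in class 1 fixes the length modulo 4.\<close>

lemma cyc_path:
  assumes path: "link_path (cyc R F) (\<Union>c<4. R c) l P Q xs" "P \<subseteq> R 0" "Q \<subseteq> R 1"
    and disj: "disjoint_family_on R {..<4}"
  shows "length xs mod 4 = 2"
    and "\<And>m. m < length xs \<Longrightarrow> xs ! m \<in> R (m mod 4)"
    and "\<And>m. Suc m < length xs \<Longrightarrow> F (m mod 4) (xs ! m) (xs ! Suc m)"
proof -
  have D: "c = c'" if "x \<in> R c" "x \<in> R c'" "c < 4" "c' < 4" for x c c'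
    using disj that by (auto simp: disjoint_family_on_def)
  have succ: "successively (cyc R F) xs" "xs \<noteq> []" "hd xs \<in> R 0" "last xs \<in> R 1"
    using path by (auto simp: link_path_def)
  show cl: "xs ! m \<in> R (m mod 4)" if "m < length xs" for m
    using that
  proof (induction m)
    case 0
    then show ?case using succ by (simp add: hd_conv_nth)
  next
    case (Suc m)
    then have "cyc R F (xs ! m) (xs ! Suc m)" using succ by (simp add: successively_nth)
    then obtain c where c: "c < 4" "xs ! m \<in> R c" "xs ! Suc m \<in> R ((c + 1) mod 4)" by (auto simp: cyc_def)
    have "c = m mod 4" by (rule D[OF c(2)]) (use Suc c in auto)
    then show ?case using c by (metis Suc_eq_plus1 mod_Suc_eq)
  qed
  show "F (m mod 4) (xs ! m) (xs ! Suc m)" if "Suc m < length xs" for m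
  proof -
    have "cyc R F (xs ! m) (xs ! Suc m)" using succ that by (simp add: successively_nth)
    then obtain c where c: "c < 4" "xs ! m \<in> R c" "F c (xs ! m) (xs ! Suc m)" by (auto simp: cyc_def)
    have "c = m mod 4" by (rule D[OF c(2)]) (use cl that c in auto)
    then show ?thesis using c by simp
  qed
  have "xs ! (length xs - 1) \<in> R 1" using succ by (simp add: last_conv_nth)
  moreover have "xs ! (length xs - 1) \<in> R ((length xs - 1) mod 4)" using cl succ by simp
  ultimately have "(length xs - 1) mod 4 = 1" using D[of _ "(length xs - 1) mod 4" 1] by simp
  then show "length xs mod 4 = 2" using succ(2) by (cases xs) (auto, presburger)
qed

text \<open>\<open>xs\<close> lists the interior vertices only. The end \<open>x\<close> acts as a
  vertex of class 3 and \<open>y\<close> as one of class 2, which explains the relations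
  \<open>F 3\<close> and \<open>F 1\<close> at the two ends.\<close>

definition linking :: "nat \<Rightarrow> (nat \<Rightarrow> 'a set) \<Rightarrow> (nat \<Rightarrow> 'a \<Rightarrow> 'a \<Rightarrow> bool) \<Rightarrow> 'a \<Rightarrow> 'a \<Rightarrow> 'a list \<Rightarrow> bool" where
  "linking l R F x y xs \<longleftrightarrow> distinct xs \<and> length xs mod 4 = 2 \<and> length xs \<le> l \<and>
     (\<forall>m<length xs. xs ! m \<in> R (m mod 4)) \<and> (\<forall>m. Suc m < length xs \<longrightarrow> F (m mod 4) (xs ! m) (xs ! Suc m)) \<and>
     F 3 x (hd xs) \<and> F 1 (last xs) y"

context pseudorandom_relation
begin

definition "c0 = (1/2 + \<alpha>) * p"

lemma p_le_2:
  assumes "V \<noteq> {}"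
  shows "p \<le> 2"
proof -
  obtain v where v: "v \<in> V" using assms by blast
  have "(1/2 * p) * real (card V) \<le> (1/2 + 2 * \<alpha>) * real (card V) * p"
    using \<alpha>_pos p_pos by (simp add: algebra_simps)
  also have "\<dots> \<le> real (card (nb E {v} \<inter> V))" by (rule out_degree[OF v])
  also have "\<dots> \<le> 1 * real (card V)" using finite_V by (simp add: card_mono)
  finally have "1/2 * p \<le> 1"
    using assms finite_V by (simp add: card_gt_0_iff)
  then show ?thesis by simp
qed

text \<open>This lets multiples of \<open>M0\<close> swallow the additive constants that come from
  rounding.\<close>

lemma M0_ge_half:
  assumes "V \<noteq> {}"
  shows "1 / 2 \<le> M0"
proof -
  have "p \<le> 2" by (rule p_le_2[OF assms])
  have "1 \<le> L powr 1.1" using L_ge_1 by (simp add: ge_one_powr_ge_zero)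
  then have "1 / 2 \<le> L powr 1.1 / p" using \<open>p \<le> 2\<close> p_pos by (intro frac_le) auto
  then show ?thesis by (simp add: M0_def)
qed

lemma expands:
  assumes F: "F = E \<or> F = (\<lambda>x y. E y x)"
    and X: "X \<subseteq> V" "X \<inter> S = {}" and S: "rich V E c0 S" "130 * L powr 2.1 \<le> p * real (card S)"
      "32 * M0 \<le> real (card S)"
  shows "M0 \<le> real (card X) \<Longrightarrow> (1/2 + \<gamma>) * real (card S) < real (card (nb F X \<inter> S))"
    and "real (card X) \<le> 8 * M0 \<Longrightarrow> 64 * card X \<le> card (nb F X \<inter> S)"
proof -
  interpret rev: pseudorandom_relation V "\<lambda>x y. E y x" \<alpha> p L by (rule flip)
  have r: "rich V (\<lambda>x y. E y x) c0 S" using S by (simp add: rich_flip[of V E])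
  have "0 < real (card S)" using S(3) M0_pos by linarith
  then have "V \<noteq> {}" using S(1) by (auto simp: rich_def)
  from M0_ge_half[OF this] have s: "2 * M0 + 2 \<le> real (card S)" using S(3) by linarith
  note S' = S(1)[unfolded c0_def] and r' = r[unfolded c0_def]
  show "(1/2 + \<gamma>) * real (card S) < real (card (nb F X \<inter> S))" if M: "M0 \<le> real (card X)"
    using F rich_large_expands[OF X M S' s] rev.rich_large_expands[OF X M r' s] by blast
  show "64 * card X \<le> card (nb F X \<inter> S)" if M: "real (card X) \<le> 8 * M0"
    using F rich_small_expands[OF X(1) M S' S(2)] rev.rich_small_expands[OF X(1) M r' S(2)] by blast
qed

definition "reservoir \<sigma> R \<longleftrightarrow> disjoint_family_on R {..<4::nat} \<and>
  (\<forall>c<4. rich V E c0 (R c) \<and> \<sigma> \<le> real (card (R c)))"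

text \<open>Every step of \<open>cyc\<close> changes the class, so a set and the class that it
  expands into are disjoint, as (P3) requires.\<close>

lemma cyc_expander:
  fixes F :: "nat \<Rightarrow> 'a \<Rightarrow> 'a \<Rightarrow> bool"
  assumes R: "reservoir \<sigma> R" and F: "\<And>c. c < 4 \<Longrightarrow> F c = E \<or> F c = (\<lambda>x y. E y x)"
    and \<sigma>: "32 * M0 \<le> \<sigma>" "130 * L powr 2.1 \<le> p * \<sigma>" and t: "0 \<le> t" "2 * t \<le> \<gamma> * \<sigma>"
  shows "cyclic_expander (cyc R F) R (\<lambda>c. (c + 1) mod 4) M0 \<gamma> \<sigma> t"
    and "cyclic_expander (\<lambda>a b. cyc R F b a) R (\<lambda>c. (c + 3) mod 4) M0 \<gamma> \<sigma> t"
proof -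
  have rich: "rich V E c0 (R c)" "\<sigma> \<le> real (card (R c))" "R c \<subseteq> V" "finite (R c)" if "c < 4" for c
    using R that finite_V by (auto simp: reservoir_def rich_def intro: finite_subset)
  have disj: "R c \<inter> R c' = {}" if "c < 4" "c' < 4" "c \<noteq> c'" for c c'
    using R that by (auto simp: reservoir_def disjoint_family_on_def)
  have size: "130 * L powr 2.1 \<le> p * real (card (R c))" "32 * M0 \<le> real (card (R c))" if "c < 4" for c
    using rich(2)[OF that] \<sigma> p_pos mult_left_mono[OF rich(2)[OF that], of p] by linarith+
  have ex: "(M0 \<le> real (card X) \<longrightarrow> (1/2 + \<gamma>) * real (card (R c')) < real (card (nb H X \<inter> R c'))) \<and>
      (real (card X) \<le> 8 * M0 \<longrightarrow> 64 * card X \<le> card (nb H X \<inter> R c'))"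
    if "c < 4" "c' < 4" "c \<noteq> c'" "X \<subseteq> R c" "H = E \<or> H = (\<lambda>x y. E y x)" for c c' X H
  proof -
    have "X \<subseteq> V" "X \<inter> R c' = {}" using that disj[OF that(1-3)] rich(3) by blast+
    from expands[OF that(5) this rich(1)[OF that(2)] size[OF that(2)]] show ?thesis by blast
  qed
  show "cyclic_expander (cyc R F) R (\<lambda>c. (c + 1) mod 4) M0 \<gamma> \<sigma> t"
  proof
    fix c :: nat and X assume c: "c < 4" and X: "X \<subseteq> R c"
    have eq: "nb (F c) X \<inter> R ((c + 1) mod 4) \<subseteq> nb (cyc R F) X \<inter> R ((c + 1) mod 4)"
      using c X by (auto simp: nb_def cyc_def)
    have "c \<noteq> (c + 1) mod 4" by presburger
    note e = ex[OF c _ this X F[OF c]]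
    have le: "card (nb (F c) X \<inter> R ((c + 1) mod 4)) \<le> card (nb (cyc R F) X \<inter> R ((c + 1) mod 4))"
      using eq rich(4)[of "(c + 1) mod 4"] by (intro card_mono) auto
    show "(1/2 + \<gamma>) * real (card (R ((c + 1) mod 4))) < real (card (nb (cyc R F) X \<inter> R ((c + 1) mod 4)))"
      if "M0 \<le> real (card X)" using e that le by fastforce
    show "64 * card X \<le> card (nb (cyc R F) X \<inter> R ((c + 1) mod 4))"
      if "real (card X) \<le> 8 * M0" using e that le by fastforce
  qed (use rich M0_pos \<sigma> \<gamma>_pos t in auto)
  show "cyclic_expander (\<lambda>a b. cyc R F b a) R (\<lambda>c. (c + 3) mod 4) M0 \<gamma> \<sigma> t"
  proof
    fix c :: nat and X assume c: "c < 4" and X: "X \<subseteq> R c"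
    \<comment> \<open>The preceding class: an arc of \<open>cyc\<close> read backwards from class
      \<open>c\<close> leads there and belongs to \<open>F c'\<close>.\<close>
    define c' where "c' = (c + 3) mod 4"
    have c': "c' < 4" "(c' + 1) mod 4 = c" "c \<noteq> c'" using c unfolding c'_def by presburger+
    let ?H = "\<lambda>x y. F c' y x"
    have eq: "nb ?H X \<inter> R c' \<subseteq> nb (\<lambda>a b. cyc R F b a) X \<inter> R c'"
      using c' X by (auto simp: nb_def cyc_def)
    have "?H = E \<or> ?H = (\<lambda>x y. E y x)" using F[OF c'(1)] by auto
    note e = ex[OF c c'(1,3) X this]
    have le: "card (nb ?H X \<inter> R c') \<le> card (nb (\<lambda>a b. cyc R F b a) X \<inter> R c')"
      using eq rich(4)[OF c'(1)] by (intro card_mono) auto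
    show "(1/2 + \<gamma>) * real (card (R ((c + 3) mod 4))) < real (card (nb (\<lambda>a b. cyc R F b a) X \<inter> R ((c + 3) mod 4)))"
      if "M0 \<le> real (card X)" using e that le unfolding c'_def by fastforce
    show "64 * card X \<le> card (nb (\<lambda>a b. cyc R F b a) X \<inter> R ((c + 3) mod 4))"
      if "real (card X) \<le> 8 * M0" using e that le unfolding c'_def by fastforce
  qed (use rich M0_pos \<sigma> \<gamma>_pos t in auto)
qed

text \<open>The fractional linking with \<open>M = 8 * M0\<close> and class 0 as the meeting place.
  The start sets are the neighbours of \<open>a i\<close> in class 0, the end sets those of
  \<open>b i\<close> in class 1.\<close>

lemma link_round:
  fixes F :: "nat \<Rightarrow> 'a \<Rightarrow> 'a \<Rightarrow> bool"
  assumes R: "reservoir \<sigma> R" and F: "\<And>c. c < 4 \<Longrightarrow> F c = E \<or> F c = (\<lambda>x y. E y x)"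
    and \<sigma>: "32 * M0 \<le> \<sigma>" "130 * L powr 2.1 \<le> p * \<sigma>"
    and I: "finite I" "2 * real (card I) \<le> \<gamma> * \<sigma>"
    and a: "inj_on a I" "a ` I \<subseteq> V - (\<Union>c<4. R c)" and b: "inj_on b I" "b ` I \<subseteq> V - (\<Union>c<4. R c)"
    and k: "card V < 2 ^ k"
  shows "\<exists>I0\<subseteq>I. \<exists>f. card I \<le> (2 * (k + 5) + 1) * card I0 \<and>
     (\<forall>i\<in>I0. link_path (cyc R F) (\<Union>c<4. R c) (2 * (k + 5) + 1) (nb (F 3) {a i} \<inter> R 0)
        (nb (\<lambda>x y. F 1 y x) {b i} \<inter> R 1) (f i)) \<and> disjoint_family_on (\<lambda>i. set (f i)) I0"
proof -
  interpret fw: cyclic_expander "cyc R F" R "\<lambda>c. (c + 1) mod 4" M0 \<gamma> \<sigma> "real (card I)"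
    using cyc_expander(1)[OF R F \<sigma> _ I(2)] by simp
  interpret bw: cyclic_expander "\<lambda>a b. cyc R F b a" R "\<lambda>c. (c + 3) mod 4" M0 \<gamma> \<sigma> "real (card I)"
    using cyc_expander(2)[OF R F \<sigma> _ I(2)] by simp
  have U: "fw.U = (\<Union>c<4. R c)" "bw.U = (\<Union>c<4. R c)" by (simp_all add: fw.U_def bw.U_def)
  have UV: "(\<Union>c<4. R c) \<subseteq> V" using R by (auto simp: reservoir_def rich_def)
  have rich: "rich V E c0 (R c)" "\<sigma> \<le> real (card (R c))" if "c < 4" for c
    using R that by (auto simp: reservoir_def)
  have size: "130 * L powr 2.1 \<le> p * real (card (R c))" "32 * M0 \<le> real (card (R c))" if "c < 4" for c
    using rich(2)[OF that] \<sigma> p_pos mult_left_mono[OF rich(2)[OF that], of p] by linarith+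
  have P: "(real (card X) \<le> 8 * M0 \<longrightarrow> 16 * card X \<le> card (\<Union>((\<lambda>i. nb H {g i} \<inter> R c) ` X) \<inter> (\<Union>c<4. R c))) \<and>
      (8 * M0 / 2 \<le> real (card X) \<longrightarrow>
         real (card I) + 2 * (8 * M0) < real (card (\<Union>((\<lambda>i. nb H {g i} \<inter> R c) ` X) \<inter> (\<Union>c<4. R c))))"
    if X: "X \<subseteq> I" and g: "inj_on g I" "g ` I \<subseteq> V - (\<Union>c<4. R c)" and c: "c < 4"
      and H: "H = E \<or> H = (\<lambda>x y. E y x)" for X g c H
  proof -
    have eq: "\<Union>((\<lambda>i. nb H {g i} \<inter> R c) ` X) \<inter> (\<Union>c<4. R c) = nb H (g ` X) \<inter> R c"
      using c by (auto simp: nb_def)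
    have gX: "card (g ` X) = card X" using X g by (meson card_image inj_on_subset)
    have "g ` X \<subseteq> V" "g ` X \<inter> R c = {}" using X g(2) c by blast+
    note e = expands[OF H this rich(1)[OF c] size[OF c], unfolded gX]
    have "real (card I) + 2 * (8 * M0) \<le> (1/2 + \<gamma>) * real (card (R c))"
      using fw.\<gamma>_size[OF c] size(2)[OF c] M0_pos by (simp add: distrib_right)
    then show ?thesis unfolding eq using e M0_pos by fastforce
  qed
  have F3: "F 3 = E \<or> F 3 = (\<lambda>x y. E y x)" using F[of 3] by simp
  have F1: "(\<lambda>x y. F 1 y x) = E \<or> (\<lambda>x y. F 1 y x) = (\<lambda>x y. E y x)" using F[of 1] by auto
  have kU: "card (\<Union>c<4. R c) < 2 ^ k" using UV finite_V k card_mono le_less_trans by blast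
  show ?thesis
  proof (rule link_a_fraction[where M = "8 * M0" and C = "R 0"])
    show "finite (\<Union>c<4. R c)" using UV finite_V finite_subset by blast
    fix W X assume "W \<subseteq> (\<Union>c<4. R c)" "card W \<le> card I" "X \<subseteq> (\<Union>c<4. R c) - W" "8 * M0 / 2 \<le> real (card X)"
    note h = this
    show "card (R 0) < 2 * card (reach (cyc R F) ((\<Union>c<4. R c) - W) 5 X \<inter> R 0)"
    proof (rule fw.reach_half[unfolded U])
      fix c :: nat assume c: "c < 4"
      have "((\<lambda>c. (c + 1) mod 4) ^^ m) c = (c + m) mod 4" for m
        using c by (induction m) (auto simp: mod_Suc_eq)
      then show "\<exists>m. 1 \<le> m \<and> m \<le> 5 \<and> ((\<lambda>c. (c + 1) mod 4) ^^ m) c = 0"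
        using c by (intro exI[of _ "4 - c"]) auto
    qed (use h in auto)
    show "card (R 0) < 2 * card (reach (\<lambda>a b. cyc R F b a) ((\<Union>c<4. R c) - W) 5 X \<inter> R 0)"
    proof (rule bw.reach_half[unfolded U])
      fix c :: nat assume c: "c < 4"
      have "((\<lambda>c. (c + 3) mod 4) ^^ m) c = (c + 3 * m) mod 4" for m
      proof (induction m)
        case (Suc m)
        have "((c + 3 * m) mod 4 + 3) mod 4 = (c + 3 * Suc m) mod 4" by presburger
        then show ?case using Suc by simp
      qed (use c in simp)
      then show "\<exists>m. 1 \<le> m \<and> m \<le> 5 \<and> ((\<lambda>c. (c + 3) mod 4) ^^ m) c = 0"
        \<comment> \<open>From class 0 a full turn is made, because at least one step is
          required.\<close>
        using c by (intro exI[of _ "if c = 0 then 4 else c"]) auto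
    qed (use h in auto)
  next
    show "real (card X) \<le> 8 * M0 \<Longrightarrow> 16 * card X \<le> card (\<Union>((\<lambda>i. nb (F 3) {a i} \<inter> R 0) ` X) \<inter> (\<Union>c<4. R c))"
      "8 * M0 / 2 \<le> real (card X) \<Longrightarrow>
         real (card I) + 2 * (8 * M0) < real (card (\<Union>((\<lambda>i. nb (F 3) {a i} \<inter> R 0) ` X) \<inter> (\<Union>c<4. R c)))"
      if "X \<subseteq> I" for X using P[OF that a _ F3, of 0] by simp_all
    show "real (card X) \<le> 8 * M0 \<Longrightarrow> 16 * card X \<le> card (\<Union>((\<lambda>i. nb (\<lambda>x y. F 1 y x) {b i} \<inter> R 1) ` X) \<inter> (\<Union>c<4. R c))"
      "8 * M0 / 2 \<le> real (card X) \<Longrightarrow>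
         real (card I) + 2 * (8 * M0) < real (card (\<Union>((\<lambda>i. nb (\<lambda>x y. F 1 y x) {b i} \<inter> R 1) ` X) \<inter> (\<Union>c<4. R c)))"
      if "X \<subseteq> I" for X using P[OF that b _ F1, of 1] by simp_all
    show "0 < 8 * M0" using M0_pos by simp
    show "R 0 \<subseteq> (\<Union>c<4. R c)" using fw.R_subset_U[of 0] by (simp add: U)
  qed (fact I(1) kU fw.small_union[unfolded U] bw.small_union[unfolded U] fw.large_union[unfolded U] bw.large_union[unfolded U])+
qed

lemma link_all:
  fixes F :: "nat \<Rightarrow> 'a \<Rightarrow> 'a \<Rightarrow> bool" and R :: "nat \<Rightarrow> nat \<Rightarrow> 'a set"
  assumes R: "\<And>j. j < J \<Longrightarrow> reservoir \<sigma> (R j)" and disj: "disjoint_family_on (\<lambda>j. \<Union>c<4. R j c) {..<J}"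
    and F: "\<And>c. c < 4 \<Longrightarrow> F c = E \<or> F c = (\<lambda>x y. E y x)"
    and \<sigma>: "32 * M0 \<le> \<sigma>" "130 * L powr 2.1 \<le> p * \<sigma>"
    and I: "finite I" "2 * real (card I) \<le> \<gamma> * \<sigma>"
    and a: "inj_on a I" "a ` I \<subseteq> V - (\<Union>j<J. \<Union>c<4. R j c)"
    and b: "inj_on b I" "b ` I \<subseteq> V - (\<Union>j<J. \<Union>c<4. R j c)"
    and k: "card V < 2 ^ k" and l: "l = 2 * (k + 5) + 1" and count: "(l - 1) ^ J * card I < l ^ J"
  shows "\<exists>f. disjoint_family_on (\<lambda>i. set (f i)) I \<and>
    (\<forall>i\<in>I. linking l (\<lambda>c. \<Union>j<J. R j c) F (a i) (b i) (f i))"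
proof -
  let ?ok = "\<lambda>j i xs. link_path (cyc (R j) F) (\<Union>c<4. R j c) l (nb (F 3) {a i} \<inter> R j 0)
        (nb (\<lambda>x y. F 1 y x) {b i} \<inter> R j 1) xs"
  have "\<exists>f h. (\<forall>i\<in>I. h i < J \<and> ?ok (h i) i (f i)) \<and> disjoint_family_on (\<lambda>i. set (f i)) I"
  proof (rule iterate_rounds[where R = "\<lambda>j. \<Union>c<4. R j c" and l = l])
    fix j I' assume j: "j < J" and I': "I' \<subseteq> I"
    have fin: "finite I'" using I I' finite_subset by blast
    have 1: "2 * real (card I') \<le> \<gamma> * \<sigma>" using I card_mono[OF I(1) I'] by linarith
    have 2: "a ` I' \<subseteq> V - (\<Union>c<4. R j c)" using a(2) I' j by blast
    have 3: "b ` I' \<subseteq> V - (\<Union>c<4. R j c)" using b(2) I' j by blast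
    show "\<exists>I0\<subseteq>I'. \<exists>f. card I' \<le> l * card I0 \<and> (\<forall>i\<in>I0. ?ok j i (f i)) \<and>
         disjoint_family_on (\<lambda>i. set (f i)) I0"
      unfolding l
      by (rule link_round[OF R[OF j] F \<sigma> fin 1 inj_on_subset[OF a(1) I'] 2 inj_on_subset[OF b(1) I'] 3 k])
  next
    show "0 < l" by (simp add: l)
    show "\<And>j i xs. j < J \<Longrightarrow> ?ok j i xs \<Longrightarrow> set xs \<subseteq> (\<Union>c<4. R j c)" by (simp add: link_path_def)
  qed (fact I(1) disj count)+
  then obtain f h where f: "disjoint_family_on (\<lambda>i. set (f i)) I" "\<And>i. i \<in> I \<Longrightarrow> h i < J"
    "\<And>i. i \<in> I \<Longrightarrow> ?ok (h i) i (f i)" by blast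
  have "linking l (\<lambda>c. \<Union>j<J. R j c) F (a i) (b i) (f i)" if i: "i \<in> I" for i
  proof -
    have d: "disjoint_family_on (R (h i)) {..<4}" using R[OF f(2)[OF i]] by (simp add: reservoir_def)
    note c = cyc_path[OF f(3)[OF i] Int_lower2 Int_lower2 d]
    show ?thesis unfolding linking_def using c f(2,3)[OF i]
      by (auto simp: link_path_def nb_def)
  qed
  then show ?thesis using f(1) by blast
qed

end

section \<open>Covering by few paths\<close>

definition path_cover :: "('a \<Rightarrow> 'a \<Rightarrow> bool) \<Rightarrow> 'a set \<Rightarrow> 'a list set \<Rightarrow> bool" where
  "path_cover E Z \<P> \<longleftrightarrow> finite \<P> \<and> (\<forall>P\<in>\<P>. P \<noteq> [] \<and> distinct P \<and> successively E P) \<and>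
     disjoint_family_on set \<P> \<and> \<Union>(set ` \<P>) = Z"

lemma path_cover_replace:
  assumes "path_cover E Z \<P>" "\<Q> \<subseteq> \<P>" "path_cover E (\<Union>(set ` \<Q>)) \<Q>'"
  shows "path_cover E Z ((\<P> - \<Q>) \<union> \<Q>')"
proof -
  have dP: "set P \<inter> set R = {}" if "P \<in> \<P>" "R \<in> \<P>" "P \<noteq> R" for P R
    using assms(1) that by (auto simp: path_cover_def disjoint_family_on_def)
  have dQ: "set P \<inter> set R = {}" if "P \<in> \<Q>'" "R \<in> \<Q>'" "P \<noteq> R" for P R
    using assms(3) that by (auto simp: path_cover_def disjoint_family_on_def)
  have D: "set P \<inter> set Q = {}" if PQ: "P \<in> \<P> - \<Q>" "Q \<in> \<Q>'" for P Q
  proof -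
    have "set P \<inter> set R = {}" if R: "R \<in> \<Q>" for R
      using dP[of P R] PQ(1) R assms(2) by blast
    moreover have "set Q \<subseteq> \<Union>(set ` \<Q>)" using PQ assms(3) by (auto simp: path_cover_def)
    ultimately show ?thesis by blast
  qed
  have "disjoint_family_on set ((\<P> - \<Q>) \<union> \<Q>')"
    unfolding disjoint_family_on_def
  proof (intro ballI impI)
    fix P Q assume "P \<in> (\<P> - \<Q>) \<union> \<Q>'" "Q \<in> (\<P> - \<Q>) \<union> \<Q>'" "P \<noteq> Q"
    then consider "P \<in> \<P>" "Q \<in> \<P>" | "P \<in> \<P> - \<Q>" "Q \<in> \<Q>'" | "P \<in> \<Q>'" "Q \<in> \<P> - \<Q>" | "P \<in> \<Q>'" "Q \<in> \<Q>'"
      by blast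
    then show "set P \<inter> set Q = {}"
      using dP[OF _ _ \<open>P \<noteq> Q\<close>] dQ[OF _ _ \<open>P \<noteq> Q\<close>] D[of P Q] D[of Q P] by cases auto
  qed
  moreover have "\<Union>(set ` ((\<P> - \<Q>) \<union> \<Q>')) = Z"
  proof -
    have "\<Union>(set ` \<Q>') = \<Union>(set ` \<Q>)" using assms(3) by (simp add: path_cover_def)
    moreover have "\<Union>(set ` \<P>) = Z" using assms(1) by (simp add: path_cover_def)
    ultimately show ?thesis using assms(2) by blast
  qed
  moreover have "finite ((\<P> - \<Q>) \<union> \<Q>')" using assms by (simp add: path_cover_def)
  moreover have "\<forall>P\<in>(\<P> - \<Q>) \<union> \<Q>'. P \<noteq> [] \<and> distinct P \<and> successively E P"
    using assms(1,3) by (simp add: path_cover_def) blast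
  ultimately show ?thesis unfolding path_cover_def by blast
qed

context pseudorandom_relation
begin

lemma M0_le: "520 * M0 \<le> L\<^sup>2 / p"
  using L_large p_pos by (simp add: M0_def divide_right_mono)

text \<open>Here \<open>X\<close> may meet \<open>Z\<close>, whereas (P3) is about disjoint sets. So
  \<open>X\<close> is removed from \<open>Z\<close>: by (P2) this costs at most L^2.1 arcs per
  vertex of \<open>X\<close>, paid for by lowering \<alpha>/2 to \<alpha>/3, and the at most
  \<open>M0 + 1\<close> removed vertices are paid for by lowering \<gamma> to \<gamma>/2.\<close>

lemma set_expands_into:
  assumes Z: "rich V E ((1/2 + \<alpha> / 2) * p) Z" "6 * L powr 2.1 \<le> \<alpha> * p * real (card Z)"
      "4 * M0 + 4 \<le> \<gamma> * real (card Z)"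
    and X: "X \<subseteq> V" "M0 \<le> real (card X)" "real (card X) \<le> M0 + 1"
  shows "(1/2 + \<gamma> / 2) * real (card Z) < real (card (nb E X \<inter> Z))"
proof -
  let ?S = "Z - X"
  have ZV: "Z \<subseteq> V" using Z by (simp add: rich_def)
  have fin: "finite Z" "finite X" "finite V" using ZV X finite_V finite_subset by auto
  have "\<gamma> * real (card Z) \<le> 1 / 24 * real (card Z)" using \<gamma>_less by (intro mult_right_mono) auto
  then have big: "96 * M0 + 96 \<le> real (card Z)" using Z(3) by linarith
  then have "V \<noteq> {}" using ZV M0_pos by auto
  then have half: "1 / 2 \<le> M0" by (rule M0_ge_half)
  have "card Z \<le> card (?S \<union> X)" using fin by (intro card_mono) auto
  also have "\<dots> \<le> card ?S + card X" by (rule card_Un_le)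
  finally have cS: "real (card Z) \<le> real (card ?S) + real (card X)" by linarith
  have cS': "real (card ?S) \<le> real (card Z)" using fin by (simp add: card_mono)
  have eq: "edges E X Z \<le> edges E X ?S + edges E X X"
  proof -
    have "(\<Sum>x\<in>X. card (nb E {x} \<inter> Z)) \<le> (\<Sum>x\<in>X. card (nb E {x} \<inter> ?S) + card (nb E {x} \<inter> X))"
    proof (rule sum_mono)
      fix x
      have "card (nb E {x} \<inter> Z) \<le> card ((nb E {x} \<inter> ?S) \<union> (nb E {x} \<inter> X))"
        using fin by (intro card_mono) auto
      also have "\<dots> \<le> card (nb E {x} \<inter> ?S) + card (nb E {x} \<inter> X)" by (rule card_Un_le)
      finally show "card (nb E {x} \<inter> Z) \<le> card (nb E {x} \<inter> ?S) + card (nb E {x} \<inter> X)" .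
    qed
    then show ?thesis using fin by (simp add: edges_conv_sum sum.distrib)
  qed
  have XX: "real (edges E X X) \<le> real (card X) * L powr 2.1"
  proof (rule sparse[OF X(1)])
    show "real (card X) \<le> L\<^sup>2 / p" using X(3) M0_le half by linarith
  qed
  have "real (card X) * ((1/2 + \<alpha> / 2) * p * real (card Z)) \<le> real (edges E X Z)"
    by (rule rich_edges[OF Z(1) X(1)])
  also have "\<dots> \<le> real (edges E X ?S) + real (card X) * L powr 2.1" using eq XX by linarith
  finally have "real (card X) * ((1/2 + \<alpha> / 2) * p * real (card Z) - L powr 2.1) \<le> real (edges E X ?S)"
    by (simp add: right_diff_distrib)
  moreover have "real (card X) * ((1/2 + \<alpha> / 3) * p * real (card ?S))
      \<le> real (card X) * ((1/2 + \<alpha> / 2) * p * real (card Z) - L powr 2.1)"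
  proof (rule mult_left_mono)
    have "(1/2 + \<alpha> / 3) * p * real (card ?S) \<le> (1/2 + \<alpha> / 3) * p * real (card Z)"
      using cS' \<alpha>_pos p_pos by (intro mult_left_mono) auto
    also have "\<dots> = (1/2 + \<alpha> / 2) * p * real (card Z) - \<alpha> * p * real (card Z) / 6"
      by (simp add: field_simps)
    also have "\<dots> \<le> (1/2 + \<alpha> / 2) * p * real (card Z) - L powr 2.1" using Z(2) by linarith
    finally show "(1/2 + \<alpha> / 3) * p * real (card ?S) \<le> (1/2 + \<alpha> / 2) * p * real (card Z) - L powr 2.1" .
  qed simp
  ultimately have deg: "real (card X) * ((1/2 + \<alpha> / 3) * p * real (card ?S)) \<le> real (edges E X ?S)" by linarith
  have "(1/2 + \<gamma>) * real (card ?S) < real (card (nb E X \<inter> ?S))"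
    by (rule large_set_expands[OF X(1) _ X(2) _ _ deg]) (use ZV cS X(3) big half in auto)
  also have "\<dots> \<le> real (card (nb E X \<inter> Z))" using fin by (intro of_nat_mono card_mono) auto
  finally have 1: "(1/2 + \<gamma>) * real (card ?S) < real (card (nb E X \<inter> Z))" .
  have "(1/2 + \<gamma>) * real (card Z) \<le> (1/2 + \<gamma>) * real (card ?S) + (1/2 + \<gamma>) * (M0 + 1)"
    using cS X(3) \<gamma>_pos mult_left_mono[of "real (card Z)" "real (card ?S) + (M0 + 1)" "1/2 + \<gamma>"]
    by (simp add: distrib_left)
  moreover have "(1/2 + \<gamma>) * (M0 + 1) \<le> 1 * (M0 + 1)"
    using \<gamma>_less M0_pos by (intro mult_right_mono) auto
  moreover have "(1/2 + \<gamma> / 2) * real (card Z) = (1/2 + \<gamma>) * real (card Z) - \<gamma> * real (card Z) / 2"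
    by (simp add: algebra_simps)
  moreover have "x < n" if "a \<le> s + b" "b \<le> M0 + 1" "x = a - g / 2" "s < n" "4 * M0 + 4 \<le> g" for x n a b s g :: real
    using that M0_pos by linarith
  ultimately show ?thesis using 1 Z(3) unfolding mult_1 by blast
qed

text \<open>In a cover by fewest paths, no arc leads from the end of one path to the start of
  another. The ends and starts used for the recombination are taken from short paths, which together
  occupy so little of \<open>Z\<close> that the two neighbourhoods exceed half of \<open>Z\<close>
  even outside them; the third path is then different from the other two.\<close>

lemma small_path_cover:
  assumes Z: "rich V E ((1/2 + \<alpha> / 2) * p) Z" "6 * L powr 2.1 \<le> \<alpha> * p * real (card Z)"
      "4 * M0 + 4 \<le> \<gamma> * real (card Z)"
  shows "\<exists>\<P>. path_cover E Z \<P> \<and> real (card \<P>) \<le> 8 * (M0 + 1) / \<gamma>"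
proof -
  interpret rev: pseudorandom_relation V "\<lambda>x y. E y x" \<alpha> p L by (rule flip)
  have ZV: "Z \<subseteq> V" using Z by (simp add: rich_def)
  have finZ: "finite Z" using ZV finite_V finite_subset by blast
  have "path_cover E Z ((\<lambda>z. [z]) ` Z)"
    using finZ by (auto simp: path_cover_def disjoint_family_on_def)
  then obtain \<P> where \<P>: "path_cover E Z \<P>" and min: "\<And>\<P>'. path_cover E Z \<P>' \<Longrightarrow> card \<P> \<le> card \<P>'"
    using ex_has_least_nat[of "path_cover E Z" _ card] by blast
  have fin\<P>: "finite \<P>" and path: "\<And>P. P \<in> \<P> \<Longrightarrow> P \<noteq> [] \<and> distinct P \<and> successively E P"
    and disj: "\<And>P Q. P \<in> \<P> \<Longrightarrow> Q \<in> \<P> \<Longrightarrow> P \<noteq> Q \<Longrightarrow> set P \<inter> set Q = {}" and cover: "\<Union>(set ` \<P>) = Z"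
    using \<P> by (auto simp: path_cover_def disjoint_family_on_def)
  have no_replace: "card \<Q> \<le> card \<Q>'" if "\<Q> \<subseteq> \<P>" "path_cover E (\<Union>(set ` \<Q>)) \<Q>'" for \<Q> \<Q>'
  proof -
    have fin: "finite \<Q>" "finite \<Q>'" using that fin\<P> finite_subset by (auto simp: path_cover_def)
    have "card \<P> \<le> card ((\<P> - \<Q>) \<union> \<Q>')" by (rule min[OF path_cover_replace[OF \<P> that]])
    also have "\<dots> \<le> card (\<P> - \<Q>) + card \<Q>'" by (rule card_Un_le)
    also have "card (\<P> - \<Q>) = card \<P> - card \<Q>" using fin that by (intro card_Diff_subset)
    finally show ?thesis using card_mono[OF fin\<P> that(1)] by linarith
  qed
  have "real (card \<P>) \<le> 8 * (M0 + 1) / \<gamma>"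
  proof (rule ccontr)
    assume "\<not> ?thesis"
    then have r: "8 * (M0 + 1) < \<gamma> * real (card \<P>)" using \<gamma>_pos by (simp add: field_simps)
    define q where "q = nat \<lceil>M0\<rceil>"
    have q: "M0 \<le> real q" "real q \<le> M0 + 1" using M0_pos by (simp_all add: q_def)
    \<comment> \<open>The paths of at most twice the average length; at least half of all paths are
      of this kind.\<close>
    define \<S> where "\<S> = {P\<in>\<P>. card \<P> * length P \<le> 2 * card Z}"
    have len: "(\<Sum>P\<in>\<P>. length P) = card Z"
    proof -
      have "card (\<Union>(set ` \<P>)) = (\<Sum>P\<in>\<P>. card (set P))"
        using fin\<P> disj by (intro card_UN_disjoint) auto
      also have "\<dots> = (\<Sum>P\<in>\<P>. length P)" using path by (intro sum.cong) (auto simp: distinct_card)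
      finally show ?thesis using cover by simp
    qed
    have Zpos: "0 < card Z"
    proof (rule ccontr)
      assume "\<not> ?thesis"
      then have "4 * M0 + 4 \<le> 0" using Z(3) by simp
      then show False using M0_pos by simp
    qed
    have S\<P>: "\<S> \<subseteq> \<P>" by (auto simp: \<S>_def)
    have "card (\<P> - \<S>) * (2 * card Z) = (\<Sum>P\<in>\<P> - \<S>. 2 * card Z)" by simp
    also have "\<dots> \<le> (\<Sum>P\<in>\<P> - \<S>. card \<P> * length P)" by (intro sum_mono) (auto simp: \<S>_def)
    also have "\<dots> \<le> (\<Sum>P\<in>\<P>. card \<P> * length P)" using fin\<P> by (intro sum_mono2) auto
    also have "\<dots> = card \<P> * card Z" by (simp add: sum_distrib_left[symmetric] len)
    finally have "2 * card (\<P> - \<S>) \<le> card \<P>" using Zpos by simp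
    moreover have "card (\<P> - \<S>) = card \<P> - card \<S>"
      using S\<P> fin\<P> finite_subset by (intro card_Diff_subset) auto
    ultimately have S_half: "card \<P> \<le> 2 * card \<S>" using card_mono[OF fin\<P> S\<P>] by linarith
    have "\<gamma> * real (card \<P>) \<le> 1/24 * real (card \<P>)" using \<gamma>_less by (intro mult_right_mono) auto
    then have "24 * (8 * (M0 + 1)) \<le> real (card \<P>)" using r by linarith
    moreover have "real (card \<P>) \<le> 2 * real (card \<S>)" using of_nat_mono[OF S_half] by simp
    ultimately have "real (2 * q) \<le> real (card \<S>)" using q M0_pos by simp
    then have "2 * q \<le> card \<S>" by (simp only: of_nat_le_iff)
    then obtain G where G: "G \<subseteq> \<S>" "card G = 2 * q" by (meson obtain_subset_with_card_n)
    have finG: "finite G" using G S\<P> fin\<P> by (meson finite_subset)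
    obtain G1 where G1: "G1 \<subseteq> G" "card G1 = q" using obtain_subset_with_card_n[of q G] G by auto
    define G2 where "G2 = G - G1"
    have G2: "card G2 = q" "G1 \<inter> G2 = {}" "G2 \<subseteq> G"
      using G G1 finG by (auto simp: G2_def card_Diff_subset finite_subset)
    have GP: "G \<subseteq> \<P>" "G1 \<subseteq> \<P>" "G2 \<subseteq> \<P>" using G G1 G2 S\<P> by blast+
    define T where "T = \<Union>(set ` G)"
    \<comment> \<open>The \<open>2 * q\<close> short paths have at most 4 q |Z| / |\<P>| vertices.
      With \<open>q \<le> M0 + 1\<close> this is where the bound 8 (M0 + 1) / \<gamma>
      originates.\<close>
    have "real (card T) \<le> \<gamma> / 2 * real (card Z)"
    proof -
      have "card T \<le> (\<Sum>P\<in>G. card (set P))" unfolding T_def by (rule card_UN_le) fact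
      also have "\<dots> \<le> (\<Sum>P\<in>G. length P)" by (intro sum_mono card_length)
      finally have "card \<P> * card T \<le> card \<P> * (\<Sum>P\<in>G. length P)" by simp
      also have "\<dots> = (\<Sum>P\<in>G. card \<P> * length P)" by (simp add: sum_distrib_left)
      also have "\<dots> \<le> (\<Sum>P\<in>G. 2 * card Z)" using G by (intro sum_mono) (auto simp: \<S>_def)
      also have "\<dots> = 4 * q * card Z" using G by simp
      finally have "real (card \<P>) * real (card T) \<le> 4 * real q * real (card Z)"
        by (metis of_nat_le_iff of_nat_mult of_nat_numeral)
      also have "\<dots> \<le> (\<gamma> / 2 * real (card \<P>)) * real (card Z)"
        using r q by (intro mult_right_mono) auto
      finally have "real (card \<P>) * real (card T) \<le> real (card \<P>) * (\<gamma> / 2 * real (card Z))"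
        by (simp add: mult_ac)
      moreover have "0 < real (card \<P>)" using r M0_pos \<gamma>_pos by (cases "card \<P>") auto
      ultimately show ?thesis by simp
    qed
    note T = this
    define X where "X = last ` G1"
    define Y where "Y = hd ` G2"
    have "inj_on last \<P>" "inj_on hd \<P>"
      using disj path by (auto simp: inj_on_def) (metis disjoint_iff last_in_set, metis disjoint_iff hd_in_set)
    then have cXY: "card X = q" "card Y = q"
      using GP G1 G2 unfolding X_def Y_def by (metis card_image inj_on_subset)+
    have XYV: "X \<subseteq> V" "Y \<subseteq> V"
      using GP path cover ZV unfolding X_def Y_def by (force intro: last_in_set hd_in_set)+
    let ?A = "nb E X \<inter> Z - T" and ?B = "nb (\<lambda>x y. E y x) Y \<inter> Z - T"
    have "(1/2 + \<gamma> / 2) * real (card Z) < real (card (nb E X \<inter> Z))"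
      using cXY q by (intro set_expands_into[OF Z XYV(1)]) auto
    moreover have "card (nb E X \<inter> Z) - card T \<le> card ?A" by (rule diff_card_le_card_Diff) (simp add: T_def finG)
    ultimately have A: "card Z < 2 * card ?A" using T unfolding distrib_right by linarith
    have "(1/2 + \<gamma> / 2) * real (card Z) < real (card (nb (\<lambda>x y. E y x) Y \<inter> Z))"
      using cXY q Z(1) by (intro rev.set_expands_into[OF _ Z(2,3) XYV(2)]) (auto simp: rich_flip[of V E])
    moreover have "card (nb (\<lambda>x y. E y x) Y \<inter> Z) - card T \<le> card ?B" by (rule diff_card_le_card_Diff) (simp add: T_def finG)
    ultimately have B: "card Z < 2 * card ?B" using T unfolding distrib_right by linarith
    have "\<exists>z'. \<exists>Q\<in>\<P> - G. \<exists>Q1 Q2. Q = Q1 @ z' # z # Q2" if z: "z \<in> ?A" for z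
    proof -
      obtain Q where Q: "Q \<in> \<P>" "z \<in> set Q" using z cover by blast
      have QG: "Q \<notin> G" using Q z by (auto simp: T_def)
      obtain P where P: "P \<in> G1" "E (last P) z" using z by (auto simp: nb_def X_def)
      have PQ: "P \<noteq> Q" "P \<in> \<P>" using P G1 QG GP by auto
      obtain Q1 Q2 where Qs: "Q = Q1 @ z # Q2" using Q by (meson split_list)
      \<comment> \<open>If \<open>z\<close> were the first vertex of \<open>Q\<close>, then
        \<open>P\<close> and \<open>Q\<close> could be joined to one path. So \<open>z\<close> has a
        predecessor on \<open>Q\<close>.\<close>
      have "Q1 \<noteq> []"
      proof
        assume "Q1 = []"
        then have "path_cover E (\<Union>(set ` {P, Q})) {P @ Q}"
          using Qs path[OF PQ(2)] path[OF Q(1)] disj[OF PQ(2) Q(1) PQ(1)] P(2)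
          by (auto simp: path_cover_def disjoint_family_on_def successively_append_iff)
        from no_replace[OF _ this] show False using PQ Q by simp
      qed
      then obtain Q1' z' where "Q1 = Q1' @ [z']" by (meson rev_exhaust)
      then have "Q = Q1' @ z' # z # Q2" using Qs by simp
      then show ?thesis using Q QG by blast
    qed
    then obtain pre where pre: "\<And>z. z \<in> ?A \<Longrightarrow> \<exists>Q\<in>\<P> - G. \<exists>Q1 Q2. Q = Q1 @ pre z # z # Q2" by metis
    \<comment> \<open>A vertex lies on only one path and only once, so it precedes at most one
      \<open>z\<close>.\<close>
    have "inj_on pre ?A"
    proof (rule inj_onI)
      fix z w assume zw: "z \<in> ?A" "w \<in> ?A" "pre z = pre w"
      obtain Q Q1 Q2 where Q: "Q \<in> \<P>" "Q = Q1 @ pre z # z # Q2" using pre[OF zw(1)] by blast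
      obtain R R1 R2 where R: "R \<in> \<P>" "R = R1 @ pre w # w # R2" using pre[OF zw(2)] by blast
      have "pre z \<in> set Q \<inter> set R" using Q R zw by simp
      then have "Q = R" using disj[OF Q(1) R(1)] by blast
      have dQ: "distinct Q" using path Q by blast
      have "Q1 = R1 \<and> z # Q2 = w # R2"
        using dQ Q(2) R(2) \<open>Q = R\<close> zw(3) by (metis append_Cons_eq_iff distinct_append disjoint_iff
            distinct.simps(2) not_distinct_conv_prefix)
      then show "z = w" by simp
    qed
    then have cp: "card (pre ` ?A) = card ?A" by (rule card_image)
    \<comment> \<open>Both sets contain more than half of \<open>Z\<close>.\<close>
    have "pre ` ?A \<inter> ?B \<noteq> {}"
    proof
      assume "pre ` ?A \<inter> ?B = {}"
      then have "card (pre ` ?A \<union> ?B) = card (pre ` ?A) + card ?B"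
        using finZ by (intro card_Un_disjoint) auto
      moreover have "pre ` ?A \<union> ?B \<subseteq> Z"
      proof -
        have "pre z \<in> Z" if z: "z \<in> ?A" for z
        proof -
          obtain Q Q1 Q2 where "Q \<in> \<P>" "Q = Q1 @ pre z # z # Q2" using pre[OF z] by blast
          then show ?thesis using cover by force
        qed
        then show ?thesis by blast
      qed
      then have "card (pre ` ?A \<union> ?B) \<le> card Z" using finZ by (intro card_mono)
      ultimately show False using A B cp by linarith
    qed
    then obtain z where z: "z \<in> ?A" "pre z \<in> ?B" by blast
    obtain Q Q1 Q2 where Q: "Q \<in> \<P>" "Q \<notin> G" "Q = Q1 @ pre z # z # Q2" using pre[OF z(1)] by blast
    obtain P where P: "P \<in> G1" "E (last P) z" using z by (auto simp: nb_def X_def)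
    obtain R where R: "R \<in> G2" "E (pre z) (hd R)" using z by (auto simp: nb_def Y_def)
    have ne: "P \<noteq> Q" "Q \<noteq> R" "P \<noteq> R" "P \<in> \<P>" "R \<in> \<P>" using P R Q G1 G2 GP by auto
    have D: "set P \<inter> set Q = {}" "set Q \<inter> set R = {}" "set P \<inter> set R = {}"
      by (rule disj[OF ne(4) Q(1) ne(1)], rule disj[OF Q(1) ne(5) ne(2)], rule disj[OF ne(4,5,3)])
    \<comment> \<open>\<open>Q\<close> is cut between \<open>pre z\<close> and \<open>z\<close>; the
      tail is attached to \<open>P\<close>, and \<open>R\<close> is attached to the head.\<close>
    have "path_cover E (\<Union>(set ` {P, Q, R})) {P @ z # Q2, Q1 @ pre z # R}"
      using path[OF ne(4)] path[OF ne(5)] path[OF Q(1)] D P(2) R(2)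
      unfolding path_cover_def Q(3) disjoint_family_on_def
      by (auto simp: successively_append_iff successively_Cons)
    from no_replace[OF _ this] have "card {P, Q, R} \<le> card {P @ z # Q2, Q1 @ pre z # R}" using ne Q by auto
    also have "\<dots> \<le> 2" by (simp add: card_insert_if)
    finally show False using ne by simp
  qed
  then show ?thesis using \<P> by blast
qed

end

section \<open>Absorbers\<close>

definition joined :: "('a \<Rightarrow> 'a \<Rightarrow> bool) \<Rightarrow> 'a \<Rightarrow> 'a list \<Rightarrow> 'a \<Rightarrow> bool" where
  "joined E x xs y \<longleftrightarrow> xs \<noteq> [] \<and> E x (hd xs) \<and> successively E xs \<and> E (last xs) y"

primrec chain :: "(nat \<Rightarrow> 'a list) \<Rightarrow> (nat \<Rightarrow> 'a list) \<Rightarrow> nat \<Rightarrow> 'a list" where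
  "chain c g 0 = c 0"
| "chain c g (Suc n) = chain c g n @ g n @ c (Suc n)"

lemma mset_chain: "mset (chain c g n) = (\<Sum>i\<le>n. mset (c i)) + (\<Sum>i<n. mset (g i))"
  by (induction n) simp_all

lemma chain_path:
  assumes "\<And>i. i \<le> n \<Longrightarrow> c i \<noteq> [] \<and> successively E (c i)"
    and "\<And>i. i < n \<Longrightarrow> joined E (last (c i)) (g i) (hd (c (Suc i)))"
  shows "chain c g n \<noteq> []" "hd (chain c g n) = hd (c 0)" "last (chain c g n) = last (c n)"
    "successively E (chain c g n)"
proof -
  have "chain c g n \<noteq> [] \<and> hd (chain c g n) = hd (c 0) \<and> last (chain c g n) = last (c n) \<and>
    successively E (chain c g n)"
    using assms
  proof (induction n)
    case (Suc n)
    then have "chain c g n \<noteq> [] \<and> hd (chain c g n) = hd (c 0) \<and> last (chain c g n) = last (c n) \<and>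
      successively E (chain c g n)" by simp
    moreover have "joined E (last (c n)) (g n) (hd (c (Suc n)))" "c (Suc n) \<noteq> []" "successively E (c (Suc n))"
      using Suc.prems by auto
    ultimately show ?case by (auto simp: successively_append_iff joined_def)
  qed simp
  then show "chain c g n \<noteq> []" "hd (chain c g n) = hd (c 0)" "last (chain c g n) = last (c n)"
    "successively E (chain c g n)" by auto
qed

text \<open>In an absorber of \<open>x\<close> the arcs \<open>v k \<rightarrow> u k\<close> can be traded for the arcs \<open>v (k + 1) \<rightarrow> u k\<close>,
  \<open>v 0 \<rightarrow> x\<close> and \<open>x \<rightarrow> u m\<close>, while \<open>g k\<close> always joins \<open>u k\<close> to \<open>v (k - 1)\<close>.  The latter choice runs
  through every other index and, for even \<open>m\<close>, uses \<open>x\<close> to switch from the even to the odd ones.\<close>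

primrec direct :: "(nat \<Rightarrow> 'a) \<Rightarrow> (nat \<Rightarrow> 'a) \<Rightarrow> (nat \<Rightarrow> 'a list) \<Rightarrow> nat \<Rightarrow> 'a list" where
  "direct v u g 0 = [v 0, u 0]"
| "direct v u g (Suc k) = v (Suc k) # u (Suc k) # g (Suc k) @ direct v u g k"

fun skipping :: "(nat \<Rightarrow> 'a) \<Rightarrow> (nat \<Rightarrow> 'a) \<Rightarrow> (nat \<Rightarrow> 'a list) \<Rightarrow> nat \<Rightarrow> 'a list" where
  "skipping v u g 0 = [v 0]"
| "skipping v u g (Suc 0) = [v (Suc 0), u 0]"
| "skipping v u g (Suc (Suc k)) = v (Suc (Suc k)) # u (Suc k) # g (Suc k) @ skipping v u g k"

definition absorbing :: "(nat \<Rightarrow> 'a) \<Rightarrow> (nat \<Rightarrow> 'a) \<Rightarrow> (nat \<Rightarrow> 'a list) \<Rightarrow> 'a \<Rightarrow> nat \<Rightarrow> 'a list" where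
  "absorbing v u g x m = (case m of 0 \<Rightarrow> [v 0, x, u 0]
     | Suc k \<Rightarrow> skipping v u g m @ x # u m # g m @ skipping v u g k)"

lemma mset_direct:
  "mset (direct v u g m) = (\<Sum>k\<le>m. {#v k, u k#}) + (\<Sum>k\<in>{1..m}. mset (g k))"
  by (induction m) (simp_all add: add_ac)

text \<open>Strands of consecutive indices run through opposite parities and together use every
  vertex. The induction exchanges their roles, so both have to occur in the statement.\<close>

lemma mset_skipping:
  "mset (skipping v u g (Suc k)) + mset (skipping v u g k) + {#u (Suc k)#} + mset (g (Suc k))
     = mset (direct v u g (Suc k))"
proof (induction k)
  case (Suc k)
  have "mset (skipping v u g (Suc (Suc k))) + mset (skipping v u g (Suc k))
      = {#v (Suc (Suc k))#} + (mset (skipping v u g (Suc k)) + mset (skipping v u g k) + {#u (Suc k)#} + mset (g (Suc k)))"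
    by simp
  then show ?case unfolding Suc.IH by simp
qed simp

text \<open>Multisets record at once which vertices occur and that none is repeated, so the finished
  cycle can be checked by adding up its pieces.\<close>

lemma mset_absorbing: "mset (absorbing v u g x m) = add_mset x (mset (direct v u g m))"
proof (cases m)
  case (Suc k)
  then show ?thesis
    using mset_skipping[of v u g k] by (simp add: absorbing_def add_ac del: skipping.simps direct.simps)
qed (simp add: absorbing_def)

lemma direct_path:
  assumes "\<And>k. k \<le> m \<Longrightarrow> E (v k) (u k)" "\<And>k. 0 < k \<Longrightarrow> k \<le> m \<Longrightarrow> joined E (u k) (g k) (v (k - 1))"
  shows "hd (direct v u g m) = v m" "last (direct v u g m) = u 0" "successively E (direct v u g m)"
    "direct v u g m \<noteq> []"
proof -
  have "hd (direct v u g m) = v m \<and> last (direct v u g m) = u 0 \<and> successively E (direct v u g m) \<and> direct v u g m \<noteq> []"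
    using assms
  proof (induction m)
    case (Suc m)
    then have "hd (direct v u g m) = v m \<and> last (direct v u g m) = u 0 \<and> successively E (direct v u g m) \<and> direct v u g m \<noteq> []"
      by simp
    moreover have "joined E (u (Suc m)) (g (Suc m)) (v m)" "E (v (Suc m)) (u (Suc m))"
      using Suc.prems(1)[of "Suc m"] Suc.prems(2)[of "Suc m"] by auto
    ultimately show ?case by (auto simp: successively_append_iff successively_Cons joined_def)
  qed simp
  then show "hd (direct v u g m) = v m" "last (direct v u g m) = u 0" "successively E (direct v u g m)"
    "direct v u g m \<noteq> []" by auto
qed

lemma skipping_path:
  assumes "\<And>k. k < m \<Longrightarrow> E (v (Suc k)) (u k)" "\<And>k. 0 < k \<Longrightarrow> k < m \<Longrightarrow> joined E (u k) (g k) (v (k - 1))"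
  shows "hd (skipping v u g m) = v m \<and> last (skipping v u g m) = (if even m then v 0 else u 0) \<and>
     successively E (skipping v u g m) \<and> skipping v u g m \<noteq> []"
  using assms
proof (induction v u g m rule: skipping.induct)
  case (3 v u g k)
  have IH: "hd (skipping v u g k) = v k \<and> last (skipping v u g k) = (if even k then v 0 else u 0) \<and>
     successively E (skipping v u g k) \<and> skipping v u g k \<noteq> []"
    by (rule "3.IH") (use "3.prems" in auto)
  moreover have "joined E (u (Suc k)) (g (Suc k)) (v k)" "E (v (Suc (Suc k))) (u (Suc k))"
    using "3.prems"(1)[of "Suc k"] "3.prems"(2)[of "Suc k"] by auto
  ultimately show ?case by (auto simp: successively_append_iff successively_Cons joined_def)
qed simp_all

text \<open>For even \<open>m\<close> the strand from \<open>v m\<close> ends in \<open>v 0\<close>,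
  which has an arc to \<open>x\<close>. From \<open>x\<close> the path continues to
  \<open>u m\<close>, and \<open>g m\<close> leads on to the odd strand, which ends in
  \<open>u 0\<close>. Thus both variants of the absorber have the same ends, and swapping them does
  not disturb the rest of the cycle.\<close>

lemma absorbing_path:
  assumes "even m" "\<And>k. k < m \<Longrightarrow> E (v (Suc k)) (u k)"
    and "\<And>k. 0 < k \<Longrightarrow> k \<le> m \<Longrightarrow> joined E (u k) (g k) (v (k - 1))" and "E (v 0) x" "E x (u m)"
  shows "hd (absorbing v u g x m) = v m" "last (absorbing v u g x m) = u 0"
    "successively E (absorbing v u g x m)" "absorbing v u g x m \<noteq> []"
proof -
  have "hd (absorbing v u g x m) = v m \<and> last (absorbing v u g x m) = u 0 \<and>
    successively E (absorbing v u g x m) \<and> absorbing v u g x m \<noteq> []"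
  proof (cases m)
    case 0
    then show ?thesis using assms by (simp add: absorbing_def)
  next
    case (Suc k)
    have "hd (skipping v u g m) = v m \<and> last (skipping v u g m) = v 0 \<and>
     successively E (skipping v u g m) \<and> skipping v u g m \<noteq> []"
      using skipping_path[of m E v u g] assms by simp
    moreover have "hd (skipping v u g k) = v k \<and> last (skipping v u g k) = u 0 \<and>
     successively E (skipping v u g k) \<and> skipping v u g k \<noteq> []"
      using skipping_path[of k E v u g] assms Suc by simp
    moreover have "joined E (u m) (g m) (v k)" using assms(3)[of m] Suc by simp
    ultimately show ?thesis using assms(4,5) Suc
      by (auto simp: absorbing_def successively_append_iff successively_Cons joined_def
          simp del: skipping.simps)
  qed
  then show "hd (absorbing v u g x m) = v m" "last (absorbing v u g x m) = u 0"
    "successively E (absorbing v u g x m)" "absorbing v u g x m \<noteq> []" by auto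
qed

lemma mset_set_UN:
  assumes "finite A" "disjoint_family_on S A" "\<And>a. a \<in> A \<Longrightarrow> finite (S a)"
  shows "(\<Sum>a\<in>A. mset_set (S a)) = mset_set (\<Union>a\<in>A. S a)"
  using assms
proof (induction A rule: finite_induct)
  case (insert a A)
  have "S a \<inter> (\<Union>a\<in>A. S a) = {}" using insert.prems insert.hyps by (auto simp: disjoint_family_on_def)
  moreover have "disjoint_family_on S A" using insert.prems by (auto simp: disjoint_family_on_def)
  ultimately show ?case using insert by (simp add: mset_set_Union)
qed simp

lemma sum_mset_lists:
  assumes "finite A" "disjoint_family_on (\<lambda>a. set (f a)) A" "\<And>a. a \<in> A \<Longrightarrow> distinct (f a)"
  shows "(\<Sum>a\<in>A. mset (f a)) = mset_set (\<Union>a\<in>A. set (f a))"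
proof -
  have "(\<Sum>a\<in>A. mset (f a)) = (\<Sum>a\<in>A. mset_set (set (f a)))"
    using assms(3) by (intro sum.cong) (simp_all add: mset_set_set)
  then show ?thesis using mset_set_UN[OF assms(1,2)] by simp
qed

lemma mset_conv_sum_nth: "mset xs = (\<Sum>i<length xs. {#xs ! i#})"
  by (induction xs rule: rev_induct) (simp_all add: nth_append)

lemma mset_conv_sum_pairs:
  assumes "length xs = 2 * Suc m"
  shows "mset xs = (\<Sum>k\<le>m. {#xs ! (2 * k), xs ! Suc (2 * k)#})"
proof -
  have "(\<Sum>i<2 * j. {#xs ! i#}) = (\<Sum>k<j. {#xs ! (2 * k), xs ! Suc (2 * k)#})" for j
    by (induction j) (simp_all add: add_ac)
  from this[of "Suc m"] show ?thesis
    unfolding mset_conv_sum_nth[of xs] assms by (simp only: lessThan_Suc_atMost)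
qed

text \<open>The absorber of \<open>xs ! i\<close> is built on the vertices of \<open>f i\<close> and the joining paths \<open>g (i, k)\<close>; the
  paths \<open>g (i, 0)\<close> concatenate the absorbers.  The vertices of \<open>xs\<close> not used by the paths \<open>h\<close>, which
  close up the cycle, are absorbed.\<close>

lemma absorb_and_close:
  fixes E :: "'a \<Rightarrow> 'a \<Rightarrow> bool" and xs :: "'a list" and f :: "nat \<Rightarrow> 'a list" and g :: "nat \<times> nat \<Rightarrow> 'a list"
    and m :: "nat \<Rightarrow> nat" and ps :: "'a list list" and h :: "nat \<Rightarrow> 'a list"
  assumes xs: "distinct xs" "length xs = Suc t" and fin: "finite V"
    and f: "\<And>i. i \<le> t \<Longrightarrow> even (m i) \<and> length (f i) = 2 * Suc (m i) \<and> distinct (f i)"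
      "disjoint_family_on (\<lambda>i. set (f i)) {..t}"
    and fE: "\<And>i k. i \<le> t \<Longrightarrow> k \<le> m i \<Longrightarrow> E (f i ! (2 * k)) (f i ! Suc (2 * k))"
      "\<And>i k. i \<le> t \<Longrightarrow> k < m i \<Longrightarrow> E (f i ! (2 * Suc k)) (f i ! Suc (2 * k))"
      "\<And>i. i \<le> t \<Longrightarrow> E (f i ! 0) (xs ! i) \<and> E (xs ! i) (f i ! Suc (2 * m i))"
    and g: "\<And>i k. i \<le> t \<Longrightarrow> 0 < k \<Longrightarrow> k \<le> m i \<Longrightarrow> joined E (f i ! Suc (2 * k)) (g (i, k)) (f i ! (2 * (k - 1)))"
      "\<And>i. i < t \<Longrightarrow> joined E (f i ! 1) (g (i, 0)) (f (Suc i) ! (2 * m (Suc i)))"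
      "\<And>i k. i \<le> t \<Longrightarrow> k \<le> m i \<Longrightarrow> distinct (g (i, k))"
      "disjoint_family_on (\<lambda>ik. set (g ik)) (SIGMA i:{..t}. {..m i})"
  defines "Fs \<equiv> \<Union>i\<le>t. set (f i)" and "Gs \<equiv> \<Union>ik\<in>(SIGMA i:{..t}. {..m i}) - {(t, 0)}. set (g ik)"
  assumes disj: "Fs \<inter> Gs = {}" "Fs \<inter> set xs = {}" "Gs \<inter> set xs = {}"
    and sub: "Fs \<subseteq> V" "Gs \<subseteq> V" "set xs \<subseteq> V"
    and ps: "\<And>i. i < length ps \<Longrightarrow> ps ! i \<noteq> [] \<and> successively E (ps ! i) \<and> distinct (ps ! i)"
      "disjoint_family_on (\<lambda>i. set (ps ! i)) {..<length ps}"
      "(\<Union>i<length ps. set (ps ! i)) = V - Fs - Gs - set xs"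
  defines "start \<equiv> \<lambda>i. if i = 0 then f 0 ! (2 * m 0) else hd (ps ! (i - 1))"
    and "stop \<equiv> \<lambda>i. if i = 0 then f t ! 1 else last (ps ! (i - 1))"
  assumes h: "\<And>i. i \<le> length ps \<Longrightarrow> distinct (h i) \<and> set (h i) \<subseteq> set xs \<and>
        joined E (stop i) (h i) (start (if i = length ps then 0 else Suc i))"
      "disjoint_family_on (\<lambda>i. set (h i)) {..length ps}"
  shows "\<exists>c. c \<noteq> [] \<and> distinct c \<and> set c = V \<and> successively E c \<and> E (last c) (hd c)"
proof -
  define W where "W = (\<Union>i\<le>length ps. set (h i))"
  define u where "u = (\<lambda>i k. f i ! Suc (2 * k))"
  define v where "v = (\<lambda>i k. f i ! (2 * k))"
  \<comment> \<open>A vertex already used by the closing paths is bypassed, every other one is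
    absorbed.\<close>
  define c where "c = (\<lambda>i. if xs ! i \<in> W then direct (v i) (u i) (\<lambda>k. g (i, k)) (m i)
      else absorbing (v i) (u i) (\<lambda>k. g (i, k)) (xs ! i) (m i))"
  have c: "hd (c i) = v i (m i) \<and> last (c i) = u i 0 \<and> successively E (c i) \<and> c i \<noteq> []" if i: "i \<le> t" for i
  proof -
    have g': "joined E (u i k) (g (i, k)) (v i (k - 1))" if "0 < k" "k \<le> m i" for k
      using g(1)[OF i that] by (simp add: u_def v_def)
    have E: "\<And>k. k \<le> m i \<Longrightarrow> E (v i k) (u i k)" "\<And>k. k < m i \<Longrightarrow> E (v i (Suc k)) (u i k)"
      "E (v i 0) (xs ! i)" "E (xs ! i) (u i (m i))" "even (m i)"
      using fE(1)[OF i] fE(2)[OF i] fE(3)[OF i] f(1)[OF i] by (auto simp: u_def v_def)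
    show ?thesis
      using direct_path[of "m i" E "v i" "u i" "\<lambda>k. g (i, k)", OF E(1) g']
        absorbing_path[of "m i" E "v i" "u i" "\<lambda>k. g (i, k)" "xs ! i", OF E(5,2) g' E(3,4)]
      by (simp add: c_def)
  qed
  define B where "B = chain c (\<lambda>i. g (i, 0)) t"
  have B: "B \<noteq> []" "hd B = start 0" "last B = stop 0" "successively E B"
  proof -
    have "joined E (last (c i)) (g (i, 0)) (hd (c (Suc i)))" if "i < t" for i
      using g(2)[OF that] c[of i] c[of "Suc i"] that by (simp add: u_def v_def)
    with c have "B \<noteq> [] \<and> hd B = hd (c 0) \<and> last B = last (c t) \<and> successively E B"
      unfolding B_def using chain_path[of t c E "\<lambda>i. g (i, 0)"] by blast
    then show "B \<noteq> []" "hd B = start 0" "last B = stop 0" "successively E B"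
      using c[of 0] c[of t] by (simp_all add: start_def stop_def u_def v_def)
  qed
  have Wxs: "W \<subseteq> set xs" using h(1) by (auto simp: W_def)
  have mB: "mset B = mset_set Fs + mset_set Gs + mset_set (set xs - W)"
  proof -
    have mc: "mset (c i) = mset (f i) + (\<Sum>k\<in>{1..m i}. mset (g (i, k))) + (if xs ! i \<in> W then {#} else {#xs ! i#})"
      if "i \<le> t" for i
      using mset_conv_sum_pairs[of "f i" "m i"] f(1)[OF that]
      by (simp add: c_def mset_absorbing mset_direct u_def v_def)
    have "(\<Sum>i\<le>t. mset (c i)) = (\<Sum>i\<le>t. mset (f i)) + (\<Sum>i\<le>t. \<Sum>k\<in>{1..m i}. mset (g (i, k)))
        + (\<Sum>i\<le>t. if xs ! i \<in> W then {#} else {#xs ! i#})"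
      using mc by (simp add: sum.distrib)
    moreover have "(\<Sum>i\<le>t. mset (f i)) = mset_set Fs"
      unfolding Fs_def using f by (intro sum_mset_lists) auto
    moreover have "(\<Sum>i\<le>t. \<Sum>k\<in>{1..m i}. mset (g (i, k))) + (\<Sum>i<t. mset (g (i, 0))) = mset_set Gs"
    proof -
      \<comment> \<open>Indices with k \<ge> 1 belong to joins inside one absorber, those with k = 0
        to joins between consecutive absorbers. No absorber follows the last one, hence
        \<open>(t, 0)\<close> is excluded.\<close>
      let ?I = "SIGMA i:{..t}. {1..m i}" and ?J = "(\<lambda>i. (i, 0::nat)) ` {..<t}"
      let ?K = "(SIGMA i:{..t}. {..m i}) - {(t, 0)}"
      have K: "?K = ?I \<union> ?J" by (auto simp: not_le) 
      have "(\<Sum>i\<le>t. \<Sum>k\<in>{1..m i}. mset (g (i, k))) = (\<Sum>ik\<in>?I. mset (g ik))"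
        by (subst sum.Sigma) auto
      moreover have "(\<Sum>i<t. mset (g (i, 0))) = (\<Sum>ik\<in>?J. mset (g ik))"
        by (subst sum.reindex) (auto simp: inj_on_def)
      moreover have "(\<Sum>ik\<in>?I. mset (g ik)) + (\<Sum>ik\<in>?J. mset (g ik)) = (\<Sum>ik\<in>?K. mset (g ik))"
        unfolding K by (rule sum.union_disjoint[symmetric]) auto
      moreover have "(\<Sum>ik\<in>?K. mset (g ik)) = mset_set Gs"
        unfolding Gs_def
      proof (rule sum_mset_lists)
        show "disjoint_family_on (\<lambda>ik. set (g ik)) ?K" by (rule disjoint_family_on_mono[OF _ g(4)]) auto
      qed (use g(3) in auto)
      ultimately show ?thesis by simp
    qed
    moreover have "(\<Sum>i\<le>t. if xs ! i \<in> W then {#} else {#xs ! i#}) = mset_set (set xs - W)"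
    proof -
      have "(\<Sum>i\<le>t. if xs ! i \<in> W then {#} else {#xs ! i#}) = mset (filter (\<lambda>x. x \<notin> W) xs)"
      proof -
        have "mset (filter (\<lambda>x. x \<notin> W) ys) = (\<Sum>i<length ys. if ys ! i \<in> W then {#} else {#ys ! i#})" for ys
          by (induction ys rule: rev_induct) (auto intro!: sum.cong simp: nth_append)
        then show ?thesis using xs(2) by (simp add: lessThan_Suc_atMost)
      qed
      also have "\<dots> = mset_set (set (filter (\<lambda>x. x \<notin> W) xs))" by (rule mset_set_set[symmetric]) (simp add: xs(1))
      also have "set (filter (\<lambda>x. x \<notin> W) xs) = set xs - W" by auto
      finally show ?thesis .
    qed
    ultimately show ?thesis unfolding B_def mset_chain by (simp add: add_ac)
  qed
  define s where "s = (\<lambda>i. if i = 0 then B else ps ! (i - 1))"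
  have s: "s i \<noteq> [] \<and> successively E (s i) \<and> hd (s i) = start i \<and> last (s i) = stop i" if "i \<le> length ps" for i
    using B ps(1)[of "i - 1"] that by (auto simp: s_def start_def stop_def)
  let ?C = "chain s h (length ps)"
  have C: "?C \<noteq> []" "hd ?C = start 0" "last ?C = stop (length ps)" "successively E ?C"
  proof -
    have "joined E (last (s i)) (h i) (hd (s (Suc i)))" if "i < length ps" for i
      using h(1)[of i] s[of i] s[of "Suc i"] that by simp
    with s have "?C \<noteq> [] \<and> hd ?C = hd (s 0) \<and> last ?C = last (s (length ps)) \<and> successively E ?C"
      using chain_path[of "length ps" s E h] by blast
    then show "?C \<noteq> []" "hd ?C = start 0" "last ?C = stop (length ps)" "successively E ?C"
      using s[of 0] s[of "length ps"] by simp_all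
  qed
  define cy where "cy = ?C @ h (length ps)"
  have hl: "joined E (stop (length ps)) (h (length ps)) (start 0)" using h(1)[of "length ps"] by simp
  have "mset cy = mset_set V"
  proof -
    have "mset cy = (\<Sum>i\<le>length ps. mset (s i)) + (\<Sum>i\<le>length ps. mset (h i))"
      by (simp add: cy_def mset_chain lessThan_Suc_atMost[symmetric])
    also have "(\<Sum>i\<le>length ps. mset (s i)) = mset B + (\<Sum>i<length ps. mset (ps ! i))"
      by (subst sum.atMost_shift) (simp add: s_def)
    also have "(\<Sum>i<length ps. mset (ps ! i)) = mset_set (V - Fs - Gs - set xs)"
      unfolding ps(3)[symmetric] using ps by (intro sum_mset_lists) auto
    also have "(\<Sum>i\<le>length ps. mset (h i)) = mset_set W"
      unfolding W_def using h by (intro sum_mset_lists) auto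
    finally have "mset cy = mset_set Fs + mset_set Gs + mset_set (set xs - W) + mset_set (V - Fs - Gs - set xs) + mset_set W"
      unfolding mB .
    also have "\<dots> = mset_set Fs + mset_set Gs + (mset_set (set xs - W) + mset_set W) + mset_set (V - Fs - Gs - set xs)"
      by simp
    also have "mset_set (set xs - W) + mset_set W = mset_set ((set xs - W) \<union> W)"
      using Wxs by (intro mset_set_Union[symmetric]) (auto intro: finite_subset)
    also have "(set xs - W) \<union> W = set xs" using Wxs by auto
    also have "mset_set Fs + mset_set Gs = mset_set (Fs \<union> Gs)"
      using disj sub fin by (intro mset_set_Union[symmetric]) (auto intro: finite_subset)
    also have "mset_set (Fs \<union> Gs) + mset_set (set xs) = mset_set (Fs \<union> Gs \<union> set xs)"
      using disj sub fin by (intro mset_set_Union[symmetric]) (auto intro: finite_subset)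
    also have "mset_set (Fs \<union> Gs \<union> set xs) + mset_set (V - Fs - Gs - set xs)
       = mset_set ((Fs \<union> Gs \<union> set xs) \<union> (V - Fs - Gs - set xs))"
      using disj sub fin by (intro mset_set_Union[symmetric]) (auto intro: finite_subset)
    also have "(Fs \<union> Gs \<union> set xs) \<union> (V - Fs - Gs - set xs) = V" using sub by auto
    finally show ?thesis .
  qed
  note mcy = this
  \<comment> \<open>That every vertex is visited, and only once, is read off from the one multiset
    equation.\<close>
  have "set cy = V" using fin mcy by (metis finite_set_mset_mset_set set_mset_mset)
  moreover have "length cy = card V" using mcy by (metis size_mset size_mset_set)
  ultimately have "distinct cy" by (intro card_distinct) simp
  note \<open>set cy = V\<close> this
  moreover have "cy \<noteq> []" "successively E cy" "hd cy = start 0" "last cy = last (h (length ps))"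
    using C hl by (auto simp: cy_def successively_append_iff joined_def)
  ultimately show ?thesis using hl by (metis joined_def)
qed

section \<open>Translation between digraphs and relations on vertices\<close>

lemma (in wf_digraph) awalk_of_vertices:
  assumes "successively (dominates G) (x # ys)" "x \<in> verts G"
  shows "\<exists>p. awalk x p (last (x # ys)) \<and> awalk_verts x p = x # ys \<and> map (tail G) p = butlast (x # ys)"
  using assms
proof (induction ys arbitrary: x)
  case Nil
  then show ?case by (intro exI[of _ "[]"]) (simp add: awalk_Nil_iff)
next
  case (Cons y ys)
  then obtain e where e: "e \<in> arcs G" "tail G e = x" "head G e = y"
    by (auto simp: arcs_ends_def arc_to_ends_def)
  moreover have "y \<in> verts G" using e by auto
  moreover have "successively (dominates G) (y # ys)" using Cons.prems by simp
  ultimately obtain p where p: "awalk y p (last (y # ys))" "awalk_verts y p = y # ys"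
      "map (tail G) p = butlast (y # ys)"
    using Cons.IH by blast
  have "awalk x (e # p) (last (x # y # ys))" using p e by (simp add: awalk_Cons_iff)
  then show ?case using p e by (intro exI[of _ "e # p"]) simp
qed

lemma hamilton_cycle_of_vertices:
  assumes D: "digraph D" and c: "c \<noteq> []" "distinct c" "set c = verts D" "successively (dominates D) c"
    "last c \<rightarrow>\<^bsub>D\<^esub> hd c"
  shows "\<exists>p. hamilton_cycle D p"
proof -
  interpret digraph D by fact
  obtain x ys where xy: "c = x # ys" using c by (cases c) auto
  have "successively (dominates D) (x # (ys @ [x]))"
    using c(4,5) by (simp add: xy successively_Cons successively_append_iff split: if_splits)
  moreover have "x \<in> verts D" using c xy by auto
  ultimately obtain p where p: "awalk x p (last (x # (ys @ [x])))" "awalk_verts x p = x # (ys @ [x])"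
      "map (tail D) p = butlast (x # (ys @ [x]))"
    using awalk_of_vertices by blast
  have "p \<noteq> []" using p(2) by auto
  moreover have "distinct (tl (awalk_verts x p))" using p(2) c(2) xy by simp
  ultimately have "cycle p" using p(1) by (auto simp: cycle_def)
  moreover have "tail D ` set p = verts D"
  proof -
    have "tail D ` set p = set (map (tail D) p)" by simp
    also have "\<dots> = set (x # ys)" unfolding p(3) by (simp add: butlast_append)
    finally show ?thesis using c(3) xy by simp
  qed
  ultimately show ?thesis by (auto simp: hamilton_cycle_def)
qed

lemma arcs_between_conv_edges:
  assumes "digraph D"
  shows "arcs_between D X Y = edges (dominates D) X Y"
proof -
  interpret digraph D by fact
  let ?A = "{a \<in> arcs D. tail D a \<in> X \<and> head D a \<in> Y}"
  have "inj_on (arc_to_ends D) ?A" using no_multi_arcs by (auto simp: inj_on_def)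
  moreover have "arc_to_ends D ` ?A = {(x, y). x \<in> X \<and> y \<in> Y \<and> x \<rightarrow>\<^bsub>D\<^esub> y}"
    by (auto simp: arcs_ends_def arc_to_ends_def image_iff)
  ultimately show ?thesis unfolding arcs_between_def edges_def by (simp only: card_image[symmetric])
qed

lemma pseudorandom_relation_of_digraph:
  assumes D: "pseudorandom n \<alpha> p D" and "0 < \<alpha>" "0 < p" "1 \<le> ln (real n)"
    "520 * ln (real n) powr 1.1 \<le> (ln (real n))\<^sup>2"
  shows "pseudorandom_relation (verts D) (dominates D) \<alpha> p (ln (real n))"
proof
  have dg: "digraph D" and n: "card (verts D) = n" using D by (simp_all add: pseudorandom_def)
  interpret digraph D by fact
  show "finite (verts D)" by simp
  fix v assume v: "v \<in> verts D"
  have "(1/2 + 2 * \<alpha>) * real n * p \<le> real (semidegree D v (verts D))" using D v by (simp add: pseudorandom_def)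
  moreover have "out_nbrs D v (verts D) = nb (dominates D) {v} \<inter> verts D"
    "in_nbrs D v (verts D) = nb (\<lambda>x y. y \<rightarrow>\<^bsub>D\<^esub> x) {v} \<inter> verts D"
    by (auto simp: out_nbrs_def in_nbrs_def nb_def)
  ultimately show "(1/2 + 2 * \<alpha>) * real (card (verts D)) * p \<le> real (card (nb (dominates D) {v} \<inter> verts D))"
    "(1/2 + 2 * \<alpha>) * real (card (verts D)) * p \<le> real (card (nb (\<lambda>x y. y \<rightarrow>\<^bsub>D\<^esub> x) {v} \<inter> verts D))"
    by (simp_all add: semidegree_def n)
next
  have dg: "digraph D" using D by (simp add: pseudorandom_def)
  note eq = arcs_between_conv_edges[OF dg, symmetric]
  show "real (edges (dominates D) X X) \<le> real (card X) * ln (real n) powr 2.1"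
    if "X \<subseteq> verts D" "real (card X) \<le> (ln (real n))\<^sup>2 / p" for X
    unfolding eq using D that unfolding pseudorandom_def by blast
  show "real (edges (dominates D) X Y) \<le> (1 + \<alpha> / 2) * real (card X) * real (card Y) * p"
    if "X \<subseteq> verts D" "Y \<subseteq> verts D" "X \<inter> Y = {}" "ln (real n) powr 1.1 / p \<le> real (card X)"
      "ln (real n) powr 1.1 / p \<le> real (card Y)" for X Y
    unfolding eq using D that unfolding pseudorandom_def by blast
qed fact+

text \<open>This path from \<open>x\<close> to itself is the skeleton of an absorber: the entries at
  even positions are the \<open>v k\<close>, those at odd positions the \<open>u k\<close>. Arcs
  alternate in direction because \<open>F\<close> does, and length 2 modulo 4 makes \<open>m\<close>
  even.\<close>

lemma alternating_linking:
  fixes E :: "'a \<Rightarrow> 'a \<Rightarrow> bool"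
  assumes "linking l R (\<lambda>c. if even c then E else (\<lambda>x y. E y x)) x x f" and m: "m = length f div 2 - 1"
  shows "even m" "length f = 2 * Suc m" "distinct f"
    "\<And>k. k \<le> m \<Longrightarrow> E (f ! (2 * k)) (f ! Suc (2 * k))"
    "\<And>k. k < m \<Longrightarrow> E (f ! (2 * Suc k)) (f ! Suc (2 * k))"
    "E (f ! 0) x" "E x (f ! Suc (2 * m))"
proof -
  have len: "length f mod 4 = 2" and
    step: "\<And>i. Suc i < length f \<Longrightarrow> (if even (i mod 4) then E else (\<lambda>x y. E y x)) (f ! i) (f ! Suc i)"
    and ends: "E (hd f) x" "E x (last f)" and d: "distinct f"
    using assms(1) by (auto simp: linking_def)
  show "distinct f" by fact
  show m2: "length f = 2 * Suc m" "even m" using len unfolding m by presburger+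
  have ev: "even (i mod 4) = even i" for i :: nat by presburger
  show "E (f ! (2 * k)) (f ! Suc (2 * k))" if "k \<le> m" for k
    using step[of "2 * k"] that m2 by (simp add: ev)
  show "E (f ! (2 * Suc k)) (f ! Suc (2 * k))" if "k < m" for k
    using step[of "Suc (2 * k)"] that m2 by (simp add: ev)
  have "f \<noteq> []" using m2 by auto
  then show "E (f ! 0) x" "E x (f ! Suc (2 * m))"
    using ends m2 by (simp_all add: hd_conv_nth last_conv_nth)
qed

lemma linking_joined:
  assumes "linking l R (\<lambda>_. E) x y xs"
  shows "joined E x xs y"
proof -
  have "xs \<noteq> []" using assms by (auto simp: linking_def)
  then show ?thesis using assms by (auto simp: linking_def joined_def successively_conv_nth)
qed

lemma linking_subset:
  fixes R :: "nat \<Rightarrow> 'a set"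
  assumes "linking l R F x y xs"
  shows "set xs \<subseteq> (\<Union>c<4. R c)"
proof
  fix z assume "z \<in> set xs"
  then obtain i where i: "i < length xs" "z = xs ! i" by (auto simp: in_set_conv_nth)
  then have "z \<in> R (i mod 4)" using assms by (simp add: linking_def)
  then show "z \<in> (\<Union>c<4. R c)" by (intro UN_I[of "i mod 4"]) auto
qed

section \<open>Colour classes and their grouping into reservoirs\<close>

context pseudorandom_relation
begin

definition colour_class :: "('a \<Rightarrow> nat) \<Rightarrow> nat set \<Rightarrow> 'a set" where
  "colour_class \<chi> A = {v\<in>V. \<chi> v \<in> A}"

text \<open>Block \<open>e\<close> consists of \<open>K\<close> consecutive colours. With
  \<open>e = 4 * j + c\<close> it becomes class \<open>c\<close> of the reservoir for round
  \<open>j\<close>.\<close>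

definition block :: "('a \<Rightarrow> nat) \<Rightarrow> nat \<Rightarrow> nat \<Rightarrow> nat \<Rightarrow> 'a set" where
  "block \<chi> b K e = colour_class \<chi> {b + e * K..<b + e * K + K}"

text \<open>\<rho> is the average size of a class. The factors 3/4 and 3/2 are 1 - \<delta> and 1 +
  2 \<delta> at \<delta> = 1/4.\<close>

definition balanced :: "('a \<Rightarrow> nat) \<Rightarrow> nat \<Rightarrow> real \<Rightarrow> bool" where
  "balanced \<chi> N \<rho> \<longleftrightarrow> (\<forall>i<N. rich V E c0 (colour_class \<chi> {i}) \<and>
     3 / 4 * \<rho> \<le> real (card (colour_class \<chi> {i})) \<and> real (card (colour_class \<chi> {i})) \<le> 3 / 2 * \<rho>)"

lemma balanced_class:
  assumes "balanced \<chi> N \<rho>" "A \<subseteq> {..<N}"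
  shows "rich V E c0 (colour_class \<chi> A)" "real (card A) * (3 / 4 * \<rho>) \<le> real (card (colour_class \<chi> A))"
    "real (card (colour_class \<chi> A)) \<le> real (card A) * (3 / 2 * \<rho>)"
proof -
  have fin: "finite A" using assms(2) finite_subset by blast
  have eq: "colour_class \<chi> A = (\<Union>i\<in>A. colour_class \<chi> {i})" by (auto simp: colour_class_def)
  have disj: "disjoint_family_on (\<lambda>i. colour_class \<chi> {i}) A" by (auto simp: disjoint_family_on_def colour_class_def)
  have b: "rich V E c0 (colour_class \<chi> {i})" "3 / 4 * \<rho> \<le> real (card (colour_class \<chi> {i}))"
    "real (card (colour_class \<chi> {i})) \<le> 3 / 2 * \<rho>" if "i \<in> A" for i
    using assms that by (auto simp: balanced_def)
  show "rich V E c0 (colour_class \<chi> A)"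
    unfolding eq by (rule rich_UN[OF fin disj finite_V b(1)])
  have "card (colour_class \<chi> A) = (\<Sum>i\<in>A. card (colour_class \<chi> {i}))"
    unfolding eq using fin disj finite_V
    by (intro card_UN_disjoint) (auto simp: disjoint_family_on_def colour_class_def)
  then have card: "real (card (colour_class \<chi> A)) = (\<Sum>i\<in>A. real (card (colour_class \<chi> {i})))" by simp
  show "real (card A) * (3 / 4 * \<rho>) \<le> real (card (colour_class \<chi> A))"
    unfolding card using sum_mono[of A "\<lambda>_. 3 / 4 * \<rho>" "\<lambda>i. real (card (colour_class \<chi> {i}))"] b by simp
  show "real (card (colour_class \<chi> A)) \<le> real (card A) * (3 / 2 * \<rho>)"
    unfolding card using sum_mono[of A "\<lambda>i. real (card (colour_class \<chi> {i}))" "\<lambda>_. 3 / 2 * \<rho>"] b by simp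
qed

lemma block_disjoint: "0 < K \<Longrightarrow> e \<noteq> e' \<Longrightarrow> block \<chi> b K e \<inter> block \<chi> b K e' = {}"
proof (rule ccontr)
  assume K: "0 < K" "e \<noteq> e'" and "block \<chi> b K e \<inter> block \<chi> b K e' \<noteq> {}"
  then obtain v where v: "b + e * K \<le> \<chi> v" "\<chi> v < b + e * K + K" "b + e' * K \<le> \<chi> v" "\<chi> v < b + e' * K + K"
    by (auto simp: block_def colour_class_def)
  have "(\<chi> v - b) div K = e" using v K by (intro div_nat_eqI) (auto simp: algebra_simps)
  moreover have "(\<chi> v - b) div K = e'" using v K by (intro div_nat_eqI) (auto simp: algebra_simps)
  ultimately show False using K by simp
qed

lemma blocks:
  assumes \<chi>: "balanced \<chi> N \<rho>" and b: "b + 4 * J * K \<le> N" and K: "0 < K"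
  shows "\<And>j. j < J \<Longrightarrow> reservoir (real K * (3 / 4 * \<rho>)) (\<lambda>c. block \<chi> b K (4 * j + c))"
    and "disjoint_family_on (\<lambda>j. \<Union>c<4. block \<chi> b K (4 * j + c)) {..<J}"
    and "(\<Union>j<J. \<Union>c<4. block \<chi> b K (4 * j + c)) \<subseteq> colour_class \<chi> {b..<b + 4 * J * K}"
proof -
  have sub: "{b + e * K..<b + e * K + K} \<subseteq> {b..<b + 4 * J * K}" if "e < 4 * J" for e
  proof -
    have "Suc e * K \<le> 4 * J * K" using that by (intro mult_right_mono) auto
    then show ?thesis by auto
  qed
  show "reservoir (real K * (3 / 4 * \<rho>)) (\<lambda>c. block \<chi> b K (4 * j + c))" if j: "j < J" for j
    unfolding reservoir_def
  proof (intro conjI allI impI)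
    show "disjoint_family_on (\<lambda>c. block \<chi> b K (4 * j + c)) {..<4}"
      using block_disjoint[OF K] by (auto simp: disjoint_family_on_def)
    fix c :: nat assume c: "c < 4"
    have "{b + (4 * j + c) * K..<b + (4 * j + c) * K + K} \<subseteq> {..<N}"
      using sub[of "4 * j + c"] c j b by fastforce
    from balanced_class[OF \<chi> this]
    show "rich V E c0 (block \<chi> b K (4 * j + c))" "real K * (3 / 4 * \<rho>) \<le> real (card (block \<chi> b K (4 * j + c)))"
      by (simp_all add: block_def)
  qed
  show "disjoint_family_on (\<lambda>j. \<Union>c<4. block \<chi> b K (4 * j + c)) {..<J}"
    unfolding disjoint_family_on_def
  proof (intro ballI impI)
    fix j j' :: nat assume "j \<noteq> j'"
    have "block \<chi> b K (4 * j + c) \<inter> block \<chi> b K (4 * j' + c') = {}" if "c < 4" "c' < 4" for c c'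
      using \<open>j \<noteq> j'\<close> that by (intro block_disjoint[OF K]) presburger
    then show "(\<Union>c<4. block \<chi> b K (4 * j + c)) \<inter> (\<Union>c<4. block \<chi> b K (4 * j' + c)) = {}" by blast
  qed
  show "(\<Union>j<J. \<Union>c<4. block \<chi> b K (4 * j + c)) \<subseteq> colour_class \<chi> {b..<b + 4 * J * K}"
  proof (intro UN_least)
    fix j c :: nat assume "j \<in> {..<J}" "c \<in> {..<4}"
    then show "block \<chi> b K (4 * j + c) \<subseteq> colour_class \<chi> {b..<b + 4 * J * K}"
      using sub[of "4 * j + c"] unfolding block_def colour_class_def by auto
  qed
qed

end

section \<open>Assembling the cycle\<close>

lemma nth_disjoint_inj:
  assumes "disjoint_family_on (\<lambda>i. set (f i)) A" "i \<in> A" "i' \<in> A" "distinct (f i)"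
    and "x < length (f i)" "y < length (f i')" "f i ! x = f i' ! y"
  shows "i = i' \<and> x = y"
proof -
  have "f i ! x \<in> set (f i) \<inter> set (f i')" using assms(5-7) by (metis IntI nth_mem)
  then have "i = i'" using assms(1-3) by (auto simp: disjoint_family_on_def)
  then show ?thesis using assms by (simp add: nth_eq_iff_index_eq)
qed

context pseudorandom_relation
begin

text \<open>All three linkings of the construction have this form. The bound on the rounds is stated
  for \<open>card V\<close>, so that one \<open>J\<close> serves them all; injectivity of
  \<open>b\<close> makes \<open>card I\<close> at most that.\<close>

lemma link_pairs:
  fixes a b :: "'i \<Rightarrow> 'a"
  assumes \<chi>: "balanced \<chi> N \<rho>" and blk: "b0 + 4 * J * K \<le> N" "0 < K"
    and \<rho>: "0 < \<rho>" "32 * M0 \<le> 3 / 4 * \<rho>" "130 * L powr 2.1 \<le> p * (3 / 4 * \<rho>)"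
    and k: "card V < 2 ^ k" "l = 2 * (k + 5) + 1" "(l - 1) ^ J * card V < l ^ J"
    and I: "finite I" "2 * real (card I) \<le> \<gamma> * (real K * (3 / 4 * \<rho>))"
    and F: "\<And>c. c < 4 \<Longrightarrow> F c = E \<or> F c = (\<lambda>x y. E y x)"
  defines "R \<equiv> \<lambda>c. \<Union>j<J. block \<chi> b0 K (4 * j + c)"
  assumes a: "inj_on a I" "a ` I \<subseteq> V - (\<Union>c<4. R c)" and b: "inj_on b I" "b ` I \<subseteq> V - (\<Union>c<4. R c)"
  shows "\<exists>f. disjoint_family_on (\<lambda>i. set (f i)) I \<and> (\<forall>i\<in>I. linking l R F (a i) (b i) (f i))"
proof -
  have R: "(\<Union>c<4. R c) = (\<Union>j<J. \<Union>c<4. block \<chi> b0 K (4 * j + c))" by (auto simp: R_def)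
  have K1: "3 / 4 * \<rho> \<le> real K * (3 / 4 * \<rho>)" using blk(2) \<rho>(1) by simp
  have "card I = card (b ` I)" using b(1) by (simp add: card_image)
  also have "\<dots> \<le> card V" using b(2) finite_V by (intro card_mono) auto
  finally have "(l - 1) ^ J * card I \<le> (l - 1) ^ J * card V" by simp
  then have count: "(l - 1) ^ J * card I < l ^ J" using k(3) by linarith
  have 1: "32 * M0 \<le> real K * (3 / 4 * \<rho>)" using \<rho>(2) K1 by linarith
  have 2: "130 * L powr 2.1 \<le> p * (real K * (3 / 4 * \<rho>))"
    using \<rho>(3) mult_left_mono[OF K1, of p] p_pos by linarith
  show ?thesis
    using link_all[OF blocks(1)[OF \<chi> blk] blocks(2)[OF \<chi> blk] F 1 2 I a[unfolded R] b[unfolded R] k(1,2) count]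
    unfolding R_def .
qed

text \<open>The colours are split into intervals: \<open>4 * J\<close> of them form
  \<open>U\<close>, then \<open>4 * J * K\<close> carry the antidirected paths and another
  \<open>4 * J * K\<close> the directed joins; the remaining ones are kept free to provide degrees
  for the path cover. Separate intervals make the parts disjoint whatever paths are found.\<close>

lemma hamilton_order:
  assumes \<chi>: "balanced \<chi> N \<rho>" and \<chi>_less: "\<And>v. v \<in> V \<Longrightarrow> \<chi> v < N" and JK: "0 < J" "0 < K"
    and \<rho>: "0 < \<rho>" "real N * \<rho> = real (card V)" "32 * M0 \<le> 3 / 4 * \<rho>" "130 * L powr 2.1 \<le> p * (3 / 4 * \<rho>)"
    and k: "card V < 2 ^ k" "l = 2 * (k + 5) + 1" "(l - 1) ^ J * card V < l ^ J"
    and K: "8 * real J * real l \<le> \<gamma> * real K"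
    and T: "3 * real (4 * J + 8 * J * K) \<le> real N" "(1/2 + \<alpha>) * (3 * real (4 * J + 8 * J * K)) \<le> \<alpha> * real N"
    and Z: "12 * L powr 2.1 \<le> \<alpha> * p * real (card V)" "8 * M0 + 8 \<le> \<gamma> * real (card V)"
      "16 * (M0 + 1) + 2 * \<gamma> \<le> \<gamma> * (\<gamma> * (3 / 4 * \<rho>))"
  shows "\<exists>c. c \<noteq> [] \<and> distinct c \<and> set c = V \<and> successively E c \<and> E (last c) (hd c)"
proof -
  define T where "T = 4 * J + 8 * J * K"
  have TN: "T \<le> N"
  proof -
    have "real T \<le> real N" using T(1)[folded T_def] of_nat_0_le_iff[of T, where 'a = real] by linarith
    then show ?thesis by simp
  qed
  have bU: "0 + 4 * J * 1 \<le> N" and bH: "4 * J + 4 * J * K \<le> N" and bG: "4 * J + 4 * J * K + 4 * J * K \<le> N"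
    using TN by (simp_all add: T_def)
  \<comment> \<open>Blocks of a single class: \<open>U\<close> must stay small against the
    reservoirs, since each of its vertices demands up to \<open>l / 2\<close> joining paths.\<close>
  define RU where "RU = (\<lambda>c. \<Union>j<J. block \<chi> 0 1 (4 * j + c))"
  define RH where "RH = (\<lambda>c. \<Union>j<J. block \<chi> (4 * J) K (4 * j + c))"
  define RG where "RG = (\<lambda>c. \<Union>j<J. block \<chi> (4 * J + 4 * J * K) K (4 * j + c))"
  define U where "U = (\<Union>c<4. RU c)"
  have UR: "U = (\<Union>j<J. \<Union>c<4. block \<chi> 0 1 (4 * j + c))" by (auto simp: U_def RU_def)
  have col: "U \<subseteq> colour_class \<chi> {0..<4 * J}"
    "(\<Union>c<4. RH c) \<subseteq> colour_class \<chi> {4 * J..<4 * J + 4 * J * K}"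
    "(\<Union>c<4. RG c) \<subseteq> colour_class \<chi> {4 * J + 4 * J * K..<T}"
  proof -
    show "U \<subseteq> colour_class \<chi> {0..<4 * J}"
      using blocks(3)[OF \<chi> bU] unfolding UR by simp
    show "(\<Union>c<4. RH c) \<subseteq> colour_class \<chi> {4 * J..<4 * J + 4 * J * K}"
      using blocks(3)[OF \<chi> bH JK(2)] unfolding RH_def by blast
    have "4 * J + 4 * J * K + 4 * J * K = T" by (simp add: T_def)
    then show "(\<Union>c<4. RG c) \<subseteq> colour_class \<chi> {4 * J + 4 * J * K..<T}"
      using blocks(3)[OF \<chi> bG JK(2)] unfolding RG_def by (simp only:) blast
  qed
  have sep: "U \<inter> (\<Union>c<4. RH c) = {}" "U \<inter> (\<Union>c<4. RG c) = {}" "(\<Union>c<4. RH c) \<inter> (\<Union>c<4. RG c) = {}"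
    using col unfolding colour_class_def by fastforce+
  have subV: "U \<subseteq> V" "(\<Union>c<4. RH c) \<subseteq> V" "(\<Union>c<4. RG c) \<subseteq> V"
    using col unfolding colour_class_def by blast+
  have finU: "finite U" using subV finite_V finite_subset by blast
  have cardU: "real (card U) \<le> 6 * real J * \<rho>"
  proof -
    have "{0..<4 * J} \<subseteq> {..<N}" using bU by auto
    note b = balanced_class(3)[OF \<chi> this]
    have "card U \<le> card (colour_class \<chi> {0..<4 * J})"
      using finite_V by (intro card_mono[OF _ col(1)]) (auto simp: colour_class_def)
    then have "real (card U) \<le> real (card (colour_class \<chi> {0..<4 * J}))" by simp
    also have "\<dots> \<le> real (4 * J) * (3 / 2 * \<rho>)" using b by simp
    also have "\<dots> = 6 * real J * \<rho>" by simp
    finally show ?thesis .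
  qed
  have "U \<noteq> {}"
  proof -
    have "reservoir (real 1 * (3 / 4 * \<rho>)) (\<lambda>c. block \<chi> 0 1 (4 * 0 + c))" by (rule blocks(1)[OF \<chi> bU _ JK(1)]) simp
    then have "3 / 4 * \<rho> \<le> real (card (block \<chi> 0 1 (4 * 0 + 0)))" by (simp add: reservoir_def)
    then have "block \<chi> 0 1 (4 * 0 + 0) \<noteq> {}" using \<rho>(1) by auto
    then show ?thesis using JK(1) unfolding UR by force
  qed
  obtain xs where xs: "distinct xs" "set xs = U" using finite_distinct_list[OF finU] by blast
  then obtain t where t: "length xs = Suc t" using \<open>U \<noteq> {}\<close> by (cases xs) auto
  have cU: "card U = Suc t" using xs t by (metis distinct_card)
  have xU: "xs ! i \<in> U" if "i \<le> t" for i using that t xs by (metis le_imp_less_Suc nth_mem)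
  have inj_xs: "inj_on (\<lambda>i. xs ! i) {..t}"
    using xs t by (auto simp: inj_on_def nth_eq_iff_index_eq)
  let ?F = "\<lambda>c::nat. if even c then E else (\<lambda>x y. E y x)"
  have l2: "2 \<le> l" "11 \<le> l" by (simp_all add: k(2))
  \<comment> \<open>\<open>6 * J * \<rho>\<close> bounds \<open>card U\<close> and
    \<open>l / 2\<close> the number of joins per absorber. One class of a reservoir has at least
    \<open>K * (3 / 4 * \<rho>)\<close> vertices, and 6 = 8 * 3/4 turns the hypothesis
    \<open>K\<close> into this inequality.\<close>
  have bound: "2 * (6 * real J * \<rho> * (real l / 2)) \<le> \<gamma> * (real K * (3 / 4 * \<rho>))"
  proof -
    have "8 * real J * real l * (3 / 4 * \<rho>) \<le> \<gamma> * real K * (3 / 4 * \<rho>)"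
      using K \<rho>(1) by (intro mult_right_mono) auto
    then show ?thesis by (simp add: mult_ac)
  qed
  have "\<exists>f. disjoint_family_on (\<lambda>i. set (f i)) {..t} \<and> (\<forall>i\<in>{..t}. linking l RH ?F (xs ! i) (xs ! i) (f i))"
    unfolding RH_def
  proof (rule link_pairs[OF \<chi> bH JK(2) \<rho>(1,3,4) k])
    have "2 * real (card {..t}) \<le> 2 * (6 * real J * \<rho>)" using cardU cU by simp
    also have "\<dots> \<le> 2 * (6 * real J * \<rho> * (real l / 2))"
    proof -
      have "6 * real J * \<rho> * 1 \<le> 6 * real J * \<rho> * (real l / 2)"
        using l2 \<rho>(1) by (intro mult_left_mono) simp_all
      then show ?thesis by simp
    qed
    also note bound
    finally show "2 * real (card {..t}) \<le> \<gamma> * (real K * (3 / 4 * \<rho>))" .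
    show "(\<lambda>i. xs ! i) ` {..t} \<subseteq> V - (\<Union>c<4. \<Union>j<J. block \<chi> (4 * J) K (4 * j + c))"
      "(\<lambda>i. xs ! i) ` {..t} \<subseteq> V - (\<Union>c<4. \<Union>j<J. block \<chi> (4 * J) K (4 * j + c))"
      using xU sep(1) subV(1) unfolding RH_def by blast+
  qed (use inj_xs in auto)
  then obtain f where fd: "disjoint_family_on (\<lambda>i. set (f i)) {..t}"
    and fl: "\<And>i. i \<le> t \<Longrightarrow> linking l RH ?F (xs ! i) (xs ! i) (f i)" by auto
  define m where "m = (\<lambda>i. length (f i) div 2 - 1)"
  note fa = alternating_linking[OF fl m_def[THEN fun_cong]]
  have fRH: "set (f i) \<subseteq> (\<Union>c<4. RH c)" if "i \<le> t" for i by (rule linking_subset[OF fl[OF that]])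
  define Fs where "Fs = (\<Union>i\<le>t. set (f i))"
  have FsRH: "Fs \<subseteq> (\<Union>c<4. RH c)" using fRH by (auto simp: Fs_def)
  have fFs: "f i ! x \<in> Fs" if "i \<le> t" "x < length (f i)" for i x
    unfolding Fs_def using that by (intro UN_I[of i]) auto
  have finj: "i = i' \<and> x = y" if "f i ! x = f i' ! y" "i \<le> t" "i' \<le> t" "x < length (f i)" "y < length (f i')" for i i' x y
    using nth_disjoint_inj[OF fd _ _ fa(3)] that by simp
  let ?I = "SIGMA i:{..t}. {..m i}"
  \<comment> \<open>The successor is taken cyclically, which makes \<open>b\<close> injective on all
    indices. The path that would close the absorbers to a ring, with index \<open>(t, 0)\<close>, is
    discarded, and its vertices fall to \<open>Z\<close>.\<close>
  define nxt where "nxt = (\<lambda>(i, k). if 0 < k then (i, k - 1) else let i' = (if i = t then 0 else Suc i) in (i', m i' :: nat))"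
  define a where "a = (\<lambda>(i, k). f i ! Suc (2 * k))"
  define b where "b = (\<lambda>ik. case nxt ik of (i, k) \<Rightarrow> f i ! (2 * k))"
  have nxtI: "nxt ik \<in> ?I" if "ik \<in> ?I" for ik using that by (auto simp: nxt_def Let_def)
  have lenf: "Suc (2 * k) < length (f i)" "2 * k < length (f i)" if "i \<le> t" "k \<le> m i" for i k
    using fa(2)[OF that(1)] that(2) by simp_all
  have inj_a: "inj_on a ?I"
  proof (rule inj_onI, clarsimp simp: a_def)
    fix i k i' k' assume "i \<le> t" "i' \<le> t" "k \<le> m i" "k' \<le> m i'" "f i ! Suc (2 * k) = f i' ! Suc (2 * k')"
    with finj[OF this(5)] lenf show "i = i' \<and> k = k'" by simp
  qed
  have inj_nxt: "inj_on nxt ?I"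
    unfolding inj_on_def nxt_def Let_def by (auto split: if_splits)
  have inj_b: "inj_on b ?I"
  proof (rule inj_onI)
    fix x y assume xy: "x \<in> ?I" "y \<in> ?I" "b x = b y"
    obtain i k i' k' where n: "nxt x = (i, k)" "nxt y = (i', k')" by fastforce
    then have "i \<le> t" "k \<le> m i" "i' \<le> t" "k' \<le> m i'" using nxtI[OF xy(1)] nxtI[OF xy(2)] by auto
    moreover have "f i ! (2 * k) = f i' ! (2 * k')" using xy(3) n by (simp add: b_def)
    ultimately have "nxt x = nxt y" using finj[of i "2 * k" i' "2 * k'"] lenf n by simp
    then show "x = y" by (rule inj_onD[OF inj_nxt _ xy(1,2)])
  qed
  have "\<exists>g. disjoint_family_on (\<lambda>i. set (g i)) ?I \<and> (\<forall>i\<in>?I. linking l RG (\<lambda>_. E) (a i) (b i) (g i))"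
    unfolding RG_def
  proof (rule link_pairs[OF \<chi> bG JK(2) \<rho>(1,3,4) k])
    show "finite ?I" by simp
    have "2 * Suc (m i) \<le> l" if "i \<le> t" for i using fa(2)[OF that] fl[OF that] by (simp add: linking_def)
    then have m2: "2 * real (Suc (m i)) \<le> real l" if "i \<le> t" for i
      using that of_nat_mono[of "2 * Suc (m i)" l, where 'a = real] by simp
    have "real (card ?I) = (\<Sum>i\<le>t. real (Suc (m i)))" by simp
    also have "\<dots> \<le> (\<Sum>i\<le>t. real l / 2)"
    proof (rule sum_mono)
      fix i assume "i \<in> {..t}"
      then show "real (Suc (m i)) \<le> real l / 2" using m2[of i] by simp
    qed
    also have "\<dots> = real (card U) * (real l / 2)" by (simp add: cU)
    also have "\<dots> \<le> 6 * real J * \<rho> * (real l / 2)" using cardU by (intro mult_right_mono) auto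
    finally show "2 * real (card ?I) \<le> \<gamma> * (real K * (3 / 4 * \<rho>))" using bound by linarith
    have "a ` ?I \<subseteq> Fs" using fFs lenf by (auto simp: a_def)
    then show "a ` ?I \<subseteq> V - (\<Union>c<4. \<Union>j<J. block \<chi> (4 * J + 4 * J * K) K (4 * j + c))"
      using FsRH sep(3) subV(2) unfolding RG_def by blast
    have "b ik \<in> Fs" if "ik \<in> ?I" for ik using nxtI[OF that] fFs lenf by (auto simp: b_def)
    then show "b ` ?I \<subseteq> V - (\<Union>c<4. \<Union>j<J. block \<chi> (4 * J + 4 * J * K) K (4 * j + c))"
      using FsRH sep(3) subV(2) unfolding RG_def by blast
  qed (use inj_a inj_b in auto)
  then obtain g where gd: "disjoint_family_on (\<lambda>i. set (g i)) ?I"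
    and gl: "\<And>ik. ik \<in> ?I \<Longrightarrow> linking l RG (\<lambda>_. E) (a ik) (b ik) (g ik)" by blast
  have gj: "joined E (a ik) (g ik) (b ik)" "distinct (g ik)" "set (g ik) \<subseteq> (\<Union>c<4. RG c)" if "ik \<in> ?I" for ik
    using linking_joined[OF gl[OF that]] linking_subset[OF gl[OF that]] gl[OF that] by (simp_all add: linking_def)
  define Gs where "Gs = (\<Union>ik\<in>?I - {(t, 0)}. set (g ik))"
  have GsRG: "Gs \<subseteq> (\<Union>c<4. RG c)" using gj(3) unfolding Gs_def by blast
  define Z where "Z = V - Fs - Gs - U"
  have finZ: "finite Z" using finite_V by (simp add: Z_def)
  \<comment> \<open>\<open>Z\<close> also contains leftovers of the reservoirs, where no degrees are
    known because they depend on the paths found. Degrees into \<open>Z\<close> are therefore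
    bounded by those into the untouched classes \<open>Z0\<close>.\<close>
  define Z0 where "Z0 = colour_class \<chi> {T..<N}"
  have Z0Z: "Z0 \<subseteq> Z"
    using col FsRH GsRG unfolding Z0_def Z_def colour_class_def T_def by fastforce
  have Z0: "rich V E c0 Z0" unfolding Z0_def by (rule balanced_class(1)[OF \<chi>]) auto
  have finZ0: "finite Z0" using Z0Z finZ finite_subset by blast
  have TN\<rho>: "3 * (real T * \<rho>) \<le> real (card V)" "(1/2 + \<alpha>) * (3 * (real T * \<rho>)) \<le> \<alpha> * real (card V)"
    using mult_right_mono[OF T(1), of \<rho>] mult_right_mono[OF T(2), of \<rho>] \<rho>(1)
    unfolding T_def \<rho>(2)[symmetric] by (simp_all only: mult.assoc less_imp_le)
  have cZ0: "real (card V) - 3 / 2 * (real T * \<rho>) \<le> real (card Z0)"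
  proof -
    have fin: "finite (colour_class \<chi> {..<T})" using finite_V by (simp add: colour_class_def)
    have "V \<subseteq> colour_class \<chi> {..<T} \<union> Z0" using \<chi>_less by (auto simp: colour_class_def Z0_def)
    then have "card V \<le> card (colour_class \<chi> {..<T} \<union> Z0)" using fin finZ0 by (intro card_mono) auto
    also have "\<dots> \<le> card (colour_class \<chi> {..<T}) + card Z0" by (rule card_Un_le)
    finally have "real (card V) \<le> real (card (colour_class \<chi> {..<T})) + real (card Z0)" by linarith
    moreover have "real (card (colour_class \<chi> {..<T})) \<le> real (card {..<T}) * (3 / 2 * \<rho>)"
      by (rule balanced_class(3)[OF \<chi>]) (use TN in auto)
    ultimately show ?thesis by simp
  qed
  have cZ: "real (card Z0) \<le> real (card Z)" "real (card Z) \<le> real (card V)"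
    using Z0Z finZ finite_V by (auto intro!: card_mono simp: Z_def)
  have halfZ: "real (card V) \<le> 2 * real (card Z)" using cZ0 cZ TN\<rho> by linarith
  have "(1/2 + \<alpha> / 2) * p * real (card Z) \<le> (1/2 + \<alpha> / 2) * p * real (card V)"
    using cZ(2) \<alpha>_pos p_pos by (intro mult_left_mono) auto
  also have "\<dots> = p * ((1/2 + \<alpha>) * real (card V) - \<alpha> * real (card V) / 2)" by (simp add: algebra_simps)
  \<comment> \<open>The first \<open>T\<close> colours contain so few vertices that restricting
    degrees to \<open>Z0\<close> costs at most half of \<alpha>.\<close>
  also have "\<dots> \<le> p * ((1/2 + \<alpha>) * (real (card V) - 3 / 2 * (real T * \<rho>)))"
  proof (rule mult_left_mono)
    have "(1/2 + \<alpha>) * (real (card V) - 3 / 2 * (real T * \<rho>))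
        = (1/2 + \<alpha>) * real (card V) - (1/2 + \<alpha>) * (3 * (real T * \<rho>)) / 2" by (simp add: algebra_simps)
    then show "(1/2 + \<alpha>) * real (card V) - \<alpha> * real (card V) / 2 \<le> (1/2 + \<alpha>) * (real (card V) - 3 / 2 * (real T * \<rho>))"
      using TN\<rho>(2) by linarith
  qed (use p_pos in simp)
  also have "\<dots> \<le> p * ((1/2 + \<alpha>) * real (card Z0))"
    using cZ0 \<alpha>_pos p_pos by (intro mult_left_mono) auto
  also have "\<dots> = c0 * real (card Z0)" by (simp add: c0_def)
  finally have degZ: "(1/2 + \<alpha> / 2) * p * real (card Z) \<le> c0 * real (card Z0)" .
  have rZ: "rich V E ((1/2 + \<alpha> / 2) * p) Z"
    unfolding rich_def
  proof (intro conjI ballI)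
    show "Z \<subseteq> V" by (auto simp: Z_def)
    have mono: "real (card (A \<inter> Z0)) \<le> real (card (A \<inter> Z))" for A
      using Z0Z finZ by (auto intro!: card_mono)
    fix v assume v: "v \<in> V"
    show "(1/2 + \<alpha> / 2) * p * real (card Z) \<le> real (card (nb E {v} \<inter> Z))"
      "(1/2 + \<alpha> / 2) * p * real (card Z) \<le> real (card (nb (\<lambda>x y. E y x) {v} \<inter> Z))"
      using degZ Z0 v mono[of "nb E {v}"] mono[of "nb (\<lambda>x y. E y x) {v}"] unfolding rich_def by fastforce+
  qed
  have "\<alpha> * p * real (card V) \<le> \<alpha> * p * (2 * real (card Z))" "\<gamma> * real (card V) \<le> \<gamma> * (2 * real (card Z))"
    using halfZ \<alpha>_pos p_pos \<gamma>_pos by (simp_all add: mult_left_mono)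
  then have "6 * L powr 2.1 \<le> \<alpha> * p * real (card Z)" "4 * M0 + 4 \<le> \<gamma> * real (card Z)"
    using Z(1,2) by (simp_all add: algebra_simps)
  then obtain \<P> where \<P>: "path_cover E Z \<P>" "real (card \<P>) \<le> 8 * (M0 + 1) / \<gamma>"
    using small_path_cover[OF rZ] by blast
  have "finite \<P>" using \<P> by (simp add: path_cover_def)
  then obtain ps where ps: "distinct ps" "set ps = \<P>" using finite_distinct_list by blast
  define r where "r = length ps"
  have psi: "ps ! i \<noteq> [] \<and> successively E (ps ! i) \<and> distinct (ps ! i)" if "i < r" for i
    using \<P> ps that by (auto simp: path_cover_def r_def)
  have psd: "disjoint_family_on (\<lambda>i. set (ps ! i)) {..<r}"
    unfolding disjoint_family_on_def
  proof (intro ballI impI)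
    fix i j assume ij: "i \<in> {..<r}" "j \<in> {..<r}" "i \<noteq> j"
    then have "ps ! i \<noteq> ps ! j" using ps(1) by (simp add: r_def nth_eq_iff_index_eq)
    moreover have "ps ! i \<in> \<P>" "ps ! j \<in> \<P>" using ij ps(2) by (auto simp: r_def)
    ultimately show "set (ps ! i) \<inter> set (ps ! j) = {}"
      using \<P>(1) unfolding path_cover_def disjoint_family_on_def by blast
  qed
  have psZ: "(\<Union>i<r. set (ps ! i)) = Z"
  proof -
    have "set ps = (\<lambda>i. ps ! i) ` {..<r}" unfolding r_def set_conv_nth by auto
    then have "(\<Union>i<r. set (ps ! i)) = \<Union>(set ` set ps)" by simp
    then show ?thesis using \<P>(1) ps by (simp add: path_cover_def)
  qed
  define start where "start = (\<lambda>i. if i = 0 then f 0 ! (2 * m 0) else hd (ps ! (i - 1)))"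
  define stop where "stop = (\<lambda>i. if i = 0 then f t ! 1 else last (ps ! (i - 1)))"
  \<comment> \<open>The path through all absorbers has number 0 and \<open>ps ! (i - 1)\<close> has
    number \<open>i\<close>; \<open>sc\<close> is their cyclic order.\<close>
  define sc where "sc = (\<lambda>i. if i = r then 0 else Suc i)"
  have f0: "f 0 ! (2 * m 0) \<in> Fs" "f t ! 1 \<in> Fs"
    using fFs[of 0] fFs[of t] lenf[of 0 "m 0"] lenf[of t 0] by auto
  have ends: "hd (ps ! i) \<in> set (ps ! i)" "last (ps ! i) \<in> set (ps ! i)" "set (ps ! i) \<subseteq> Z" if "i < r" for i
    using psi[OF that] psZ that by auto
  have FZ: "Fs \<inter> Z = {}" by (auto simp: Z_def)
  have psd': "set (ps ! i) \<inter> set (ps ! j) = {}" if "i < r" "j < r" "i \<noteq> j" for i j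
    using psd that by (auto simp: disjoint_family_on_def)
  have inj_start: "inj_on start {..r}" and inj_stop: "inj_on stop {..r}"
  proof -
    have eq: "i = j" if "w i = w j" "i \<le> r" "j \<le> r" "w 0 \<in> Fs"
      "\<And>i. 0 < i \<Longrightarrow> i \<le> r \<Longrightarrow> w i \<in> set (ps ! (i - 1))" for w :: "nat \<Rightarrow> 'a" and i j
    proof (cases "i = 0 \<or> j = 0")
      case True
      then show ?thesis using that ends(3)[of "i - 1"] ends(3)[of "j - 1"] FZ
        by (metis (no_types, lifting) Suc_pred' disjoint_iff less_eq_Suc_le not_gr_zero subsetD)
    next
      case False
      then have "w i \<in> set (ps ! (i - 1))" "w i \<in> set (ps ! (j - 1))" "i - 1 < r" "j - 1 < r"
        using that(1-3) that(5)[of i] that(5)[of j] by auto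
      then have "i - 1 = j - 1" using psd'[of "i - 1" "j - 1"] by blast
      then show ?thesis using False by arith
    qed
    show "inj_on start {..r}"
      by (rule inj_onI, rule eq[of start]) (use f0 ends(1) in \<open>auto simp: start_def\<close>)
    show "inj_on stop {..r}"
      by (rule inj_onI, rule eq[of stop]) (use f0 ends(2) in \<open>auto simp: stop_def\<close>)
  qed
  have V': "start i \<in> V - U" "stop i \<in> V - U" if "i \<le> r" for i
  proof -
    have "Fs \<subseteq> V - U" using FsRH sep(1) subV(2) by blast
    moreover have "Z \<subseteq> V - U" by (auto simp: Z_def)
    moreover have "start i \<in> Fs \<union> Z" "stop i \<in> Fs \<union> Z"
    proof -
      have "i = 0 \<or> i - 1 < r" using that by arith
      then show "start i \<in> Fs \<union> Z" "stop i \<in> Fs \<union> Z"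
        using f0 ends[of "i - 1"] unfolding start_def stop_def by auto
    qed
    ultimately show "start i \<in> V - U" "stop i \<in> V - U" by blast+
  qed
  have sc: "sc i \<le> r" if "i \<le> r" for i using that by (auto simp: sc_def)
  have "\<exists>h. disjoint_family_on (\<lambda>i. set (h i)) {..r} \<and>
      (\<forall>i\<in>{..r}. linking l RU (\<lambda>_. E) (stop i) (start (sc i)) (h i))"
    unfolding RU_def
  proof (rule link_pairs[OF \<chi> bU _ \<rho>(1,3,4) k])
    have "real r \<le> 8 * (M0 + 1) / \<gamma>" using \<P>(2) ps by (metis distinct_card r_def)
    then have "\<gamma> * real r \<le> 8 * (M0 + 1)" using \<gamma>_pos by (simp add: field_simps)
    \<comment> \<open>There are \<open>r + 1\<close> gaps, because the absorbing path counts as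
      well. The bound on the number of covering paths makes this fit into the small reservoir
      \<open>U\<close>.\<close>
    then have "\<gamma> * (2 * real (card {..r})) \<le> 16 * (M0 + 1) + 2 * \<gamma>" by (simp add: algebra_simps)
    also have "\<dots> \<le> \<gamma> * (\<gamma> * (3 / 4 * \<rho>))" by (rule Z(3))
    finally have "2 * real (card {..r}) \<le> \<gamma> * (3 / 4 * \<rho>)" using \<gamma>_pos by (simp only: mult_le_cancel_left_pos)
    then show "2 * real (card {..r}) \<le> \<gamma> * (real 1 * (3 / 4 * \<rho>))" by simp
    show "stop ` {..r} \<subseteq> V - (\<Union>c<4. \<Union>j<J. block \<chi> 0 1 (4 * j + c))"
      using V'(2) unfolding U_def RU_def by blast
    show "(\<lambda>i. start (sc i)) ` {..r} \<subseteq> V - (\<Union>c<4. \<Union>j<J. block \<chi> 0 1 (4 * j + c))"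
      using V'(1) sc unfolding U_def RU_def by blast
    show "inj_on (\<lambda>i. start (sc i)) {..r}"
    proof (rule inj_onI)
      fix i j assume ij: "i \<in> {..r}" "j \<in> {..r}" "start (sc i) = start (sc j)"
      then have "sc i = sc j" using inj_onD[OF inj_start] sc by auto
      then show "i = j" by (auto simp: sc_def split: if_splits)
    qed
  qed (use inj_stop in auto)
  then obtain h where hd': "disjoint_family_on (\<lambda>i. set (h i)) {..r}"
    and hl: "\<And>i. i \<le> r \<Longrightarrow> linking l RU (\<lambda>_. E) (stop i) (start (sc i)) (h i)" by auto
  show ?thesis
  proof (rule absorb_and_close[where xs = xs and t = t and f = f and g = g and m = m and ps = ps and h = h])
    show "distinct xs" "length xs = Suc t" "finite V" by (fact xs(1) t finite_V)+
    show "even (m i) \<and> length (f i) = 2 * Suc (m i) \<and> distinct (f i)" if "i \<le> t" for i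
      using fa(1,2,3)[OF that] by blast
    show "disjoint_family_on (\<lambda>i. set (f i)) {..t}" by fact
    show "E (f i ! (2 * k)) (f i ! Suc (2 * k))" if "i \<le> t" "k \<le> m i" for i k by (rule fa(4)[OF that])
    show "E (f i ! (2 * Suc k)) (f i ! Suc (2 * k))" if "i \<le> t" "k < m i" for i k by (rule fa(5)[OF that])
    show "E (f i ! 0) (xs ! i) \<and> E (xs ! i) (f i ! Suc (2 * m i))" if "i \<le> t" for i
      using fa(6,7)[OF that] by blast
    show "joined E (f i ! Suc (2 * k)) (g (i, k)) (f i ! (2 * (k - 1)))" if "i \<le> t" "0 < k" "k \<le> m i" for i k
      using gj(1)[of "(i, k)"] that by (simp add: a_def b_def nxt_def)
    show "joined E (f i ! 1) (g (i, 0)) (f (Suc i) ! (2 * m (Suc i)))" if "i < t" for i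
      using gj(1)[of "(i, 0)"] that by (simp add: a_def b_def nxt_def)
    show "distinct (g (i, k))" if "i \<le> t" "k \<le> m i" for i k using gj(2)[of "(i, k)"] that by simp
    show "disjoint_family_on (\<lambda>ik. set (g ik)) ?I" by fact
    show "(\<Union>i\<le>t. set (f i)) \<inter> (\<Union>ik\<in>?I - {(t, 0)}. set (g ik)) = {}"
      using FsRH GsRG sep(3) unfolding Fs_def Gs_def by blast
    show "(\<Union>i\<le>t. set (f i)) \<inter> set xs = {}" using FsRH sep(1) unfolding Fs_def xs(2) by blast
    show "(\<Union>ik\<in>?I - {(t, 0)}. set (g ik)) \<inter> set xs = {}" using GsRG sep(2) unfolding Gs_def xs(2) by blast
    show "(\<Union>i\<le>t. set (f i)) \<subseteq> V" using FsRH subV(2) unfolding Fs_def by blast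
    show "(\<Union>ik\<in>?I - {(t, 0)}. set (g ik)) \<subseteq> V" using GsRG subV(3) unfolding Gs_def by blast
    show "set xs \<subseteq> V" using xs(2) subV(1) by simp
    show "ps ! i \<noteq> [] \<and> successively E (ps ! i) \<and> distinct (ps ! i)" if "i < length ps" for i
      using psi that by (simp add: r_def)
    show "disjoint_family_on (\<lambda>i. set (ps ! i)) {..<length ps}" using psd by (simp add: r_def)
    show "(\<Union>i<length ps. set (ps ! i)) = V - (\<Union>i\<le>t. set (f i)) - (\<Union>ik\<in>?I - {(t, 0)}. set (g ik)) - set xs"
      using psZ unfolding Z_def Fs_def Gs_def r_def xs(2) .
    show "distinct (h i) \<and> set (h i) \<subseteq> set xs \<and>
        joined E (if i = 0 then f t ! 1 else last (ps ! (i - 1))) (h i)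
          (if (if i = length ps then 0 else Suc i) = 0 then f 0 ! (2 * m 0)
           else hd (ps ! ((if i = length ps then 0 else Suc i) - 1)))" if "i \<le> length ps" for i
    proof -
      have i: "i \<le> r" using that by (simp add: r_def)
      have "distinct (h i)" using hl[OF i] by (simp add: linking_def)
      moreover have "set (h i) \<subseteq> set xs" using linking_subset[OF hl[OF i]] unfolding U_def[symmetric] xs(2) .
      ultimately show ?thesis
        using linking_joined[OF hl[OF i]] unfolding stop_def start_def sc_def r_def by blast
    qed
    show "disjoint_family_on (\<lambda>i. set (h i)) {..length ps}" using hd' by (simp add: r_def)
  qed
qed

end

section \<open>Choice of the parameters\<close>

context pseudorandom_relation
begin

text \<open>The sets to be balanced are \<open>V\<close> and all out- and in-neighbourhoods, at most
  2 n + 1 in number and each of size at least n p / 2. \<delta> is chosen so that a neighbourhood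
  losing the factor 1 - \<delta>, compared with a class gaining 1 + 2 \<delta>, reduces the relative
  degree from 1/2 + 2 \<alpha> to no less than 1/2 + \<alpha>.\<close>

lemma balanced_colouring_exists:
  fixes N :: nat
  defines "\<delta> \<equiv> \<alpha> / (2 + 4 * \<alpha>)"
  assumes N: "0 < N" and V: "V \<noteq> {}"
    and small: "2 * (2 * real (card V) + 1) * real N * exp (- (\<delta>\<^sup>2 * (real (card V) * p / 2) / (2 * real N))) < 1"
  shows "\<exists>\<chi>. (\<forall>v\<in>V. \<chi> v < N) \<and> balanced \<chi> N (real (card V) / real N)"
proof -
  have \<delta>: "0 < \<delta>" "\<delta> \<le> 1 / 4" "\<delta> * (2 + 4 * \<alpha>) = \<alpha>"
    using \<alpha>_pos by (simp_all add: \<delta>_def field_simps)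
  let ?out = "\<lambda>v. nb E {v} \<inter> V" and ?in = "\<lambda>v. nb (\<lambda>x y. E y x) {v} \<inter> V"
  let ?S = "?out ` V \<union> ?in ` V \<union> {V}"
  let ?n = "real (card V)"
  let ?d = "?n * p / 2"
  have npd: "?d \<le> (1/2 + 2 * \<alpha>) * ?n * p" using \<alpha>_pos p_pos by (simp add: field_simps)
  have cS: "real (card ?S) \<le> 2 * ?n + 1"
  proof -
    have "card ?S \<le> card (?out ` V) + card (?in ` V) + 1"
      using card_Un_le[of "?out ` V \<union> ?in ` V" "{V}"] card_Un_le[of "?out ` V" "?in ` V"] by simp
    also have "\<dots> \<le> card V + card V + 1"
      using finite_V by (intro add_mono card_image_le) auto
    finally show ?thesis by simp
  qed
  have "\<exists>\<chi>. (\<forall>v\<in>V. \<chi> v < N) \<and> (\<forall>S\<in>?S. \<forall>c<N.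
           (1 - \<delta>) * real (card S) / real N < real (card {v\<in>S. \<chi> v = c}) \<and>
           real (card {v\<in>S. \<chi> v = c}) < (1 + 2 * \<delta>) * real (card S) / real N)"
  proof (rule balanced_colouring[where d = ?d])
    show "finite ?S" using finite_V by simp
    show "2 * real (card ?S) * real N * exp (- (\<delta>\<^sup>2 * ?d / (2 * real N))) < 1"
    proof (rule order.strict_trans1[OF _ small])
      show "2 * real (card ?S) * real N * exp (- (\<delta>\<^sup>2 * ?d / (2 * real N)))
         \<le> 2 * (2 * ?n + 1) * real N * exp (- (\<delta>\<^sup>2 * ?d / (2 * real N)))"
        using cS by (intro mult_right_mono mult_left_mono) auto
    qed
    fix S assume "S \<in> ?S"
    then consider v where "v \<in> V" "S = ?out v" | v where "v \<in> V" "S = ?in v" | "S = V" by blast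
    then show "S \<subseteq> V \<and> ?d \<le> real (card S)"
    proof cases
      case 1
      then show ?thesis using out_degree npd by fastforce
    next
      case 2
      then show ?thesis using in_degree npd by fastforce
    next
      case 3
      have "?n * p \<le> ?n * 2" using p_le_2[OF V] by (intro mult_left_mono) auto
      then show ?thesis using 3 by simp
    qed
  qed (use finite_V N \<delta> in auto)
  then obtain \<chi> where \<chi>: "\<And>v. v \<in> V \<Longrightarrow> \<chi> v < N"
    and lo: "\<And>S c. S \<in> ?S \<Longrightarrow> c < N \<Longrightarrow> (1 - \<delta>) * real (card S) / real N < real (card {v\<in>S. \<chi> v = c})"
    and up: "\<And>S c. S \<in> ?S \<Longrightarrow> c < N \<Longrightarrow> real (card {v\<in>S. \<chi> v = c}) < (1 + 2 * \<delta>) * real (card S) / real N"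
    by blast
  let ?\<rho> = "?n / real N"
  have \<rho>: "0 \<le> ?\<rho>" by simp
  have "balanced \<chi> N ?\<rho>"
    unfolding balanced_def
  proof (intro allI impI)
    fix i assume i: "i < N"
    let ?C = "colour_class \<chi> {i}"
    have C: "?C = {v\<in>V. \<chi> v = i}" by (simp add: colour_class_def)
    have "3 / 4 * ?\<rho> \<le> (1 - \<delta>) * ?\<rho>" using \<delta> \<rho> by (intro mult_right_mono) auto
    then have C1: "3 / 4 * ?\<rho> \<le> real (card ?C)" using lo[of V i] i C by simp
    have C3: "real (card ?C) \<le> (1 + 2 * \<delta>) * ?\<rho>" using up[of V i] i C by simp
    have "(1 + 2 * \<delta>) * ?\<rho> \<le> 3 / 2 * ?\<rho>" using \<delta> \<rho> by (intro mult_right_mono) auto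
    then have C2: "real (card ?C) \<le> 3 / 2 * ?\<rho>" using C3 by linarith
    have rich: "c0 * real (card ?C) \<le> real (card (A \<inter> ?C))"
      if A: "A \<inter> V \<in> ?S" "(1/2 + 2 * \<alpha>) * ?n * p \<le> real (card (A \<inter> V))" for A
    proof -
      have "c0 * real (card ?C) \<le> c0 * ((1 + 2 * \<delta>) * ?\<rho>)"
        using C3 \<alpha>_pos p_pos by (intro mult_left_mono) (auto simp: c0_def)
      also have "\<dots> = ((1/2 + \<alpha>) * (1 + 2 * \<delta>)) * (p * ?\<rho>)" by (simp add: c0_def)
      also have "\<dots> \<le> ((1 - \<delta>) * (1/2 + 2 * \<alpha>)) * (p * ?\<rho>)"
      proof (rule mult_right_mono)
        \<comment> \<open>By the choice of \<delta> the difference is exactly \<delta> / 2.\<close>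
        have "(1 - \<delta>) * (1/2 + 2 * \<alpha>) - (1/2 + \<alpha>) * (1 + 2 * \<delta>) = \<alpha> - \<delta> * (3 / 2 + 4 * \<alpha>)"
          by (simp add: algebra_simps diff_divide_distrib)
        moreover have "\<delta> * (3 / 2 + 4 * \<alpha>) + \<delta> / 2 = \<delta> * (2 + 4 * \<alpha>)" by (simp add: distrib_left)
        ultimately show "(1/2 + \<alpha>) * (1 + 2 * \<delta>) \<le> (1 - \<delta>) * (1/2 + 2 * \<alpha>)" using \<delta>(1,3) by linarith
      qed (use p_pos \<rho> in simp)
      also have "\<dots> = (1 - \<delta>) * ((1/2 + 2 * \<alpha>) * ?n * p) / real N" by simp
      also have "\<dots> \<le> (1 - \<delta>) * real (card (A \<inter> V)) / real N"
        using A(2) \<delta> by (intro divide_right_mono mult_left_mono) auto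
      also have "\<dots> \<le> real (card {v\<in>A \<inter> V. \<chi> v = i})" using lo[OF A(1) i] by simp
      also have "{v\<in>A \<inter> V. \<chi> v = i} = A \<inter> ?C" by (auto simp: colour_class_def)
      finally show ?thesis .
    qed
    have "rich V E c0 ?C"
      unfolding rich_def
    proof (intro conjI ballI)
      fix v assume v: "v \<in> V"
      show "c0 * real (card ?C) \<le> real (card (nb E {v} \<inter> ?C))"
        by (rule rich[OF _ out_degree[OF v]]) (use v in blast)
      show "c0 * real (card ?C) \<le> real (card (nb (\<lambda>x y. E y x) {v} \<inter> ?C))"
        by (rule rich[OF _ in_degree[OF v]]) (use v in blast)
    qed (auto simp: colour_class_def)
    then show "rich V E c0 ?C \<and> 3 / 4 * ?\<rho> \<le> real (card ?C) \<and> real (card ?C) \<le> 3 / 2 * ?\<rho>"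
      using C1 C2 by blast
  qed
  then show ?thesis using \<chi> by blast
qed

end

text \<open>Sums of exponents show the origins: 6.6 = 1.1 + 5.5 and 7.6 = 2.1 + 5.5 compare the
  thresholds of (P3) and (P2) with the size of a class, 5.2 = 2 + 3.2 is the order of
  \<open>J * K\<close>, and 2.5 = 8 - 5.5 the order of the expected degree into a class. The
  exponential condition is the union bound for the colouring, with \<open>exp L\<close> for the
  number of vertices.\<close>

definition large_enough :: "real \<Rightarrow> real \<Rightarrow> real \<Rightarrow> real \<Rightarrow> bool" where
  "large_enough \<alpha> \<gamma> \<delta> L \<longleftrightarrow> 13 \<le> L \<and> 520 * L powr 1.1 \<le> L\<^sup>2 \<and> 64 * L powr 6.6 \<le> 3 / 4 * L ^ 8 \<and>
     260 * L powr 7.6 \<le> 3 / 4 * L ^ 8 \<and> 240 * L ^ 3 \<le> \<gamma> * L powr 3.2 \<and>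
     360 * L powr 5.2 \<le> L powr 5.5 \<and> (1/2 + \<alpha>) * (360 * L powr 5.2) \<le> \<alpha> * L powr 5.5 \<and>
     12 * L powr 2.1 \<le> \<alpha> * L ^ 8 \<and> 24 * L powr 1.1 \<le> \<gamma> * L ^ 8 \<and>
     100 * L powr 6.6 \<le> 3 / 4 * \<gamma>\<^sup>2 * L ^ 8 \<and>
     12 * L powr 5.5 * exp (L - \<delta>\<^sup>2 * L powr 2.5 / 8) < 1"

lemma eventually_large_enough:
  assumes "0 < \<alpha>" "0 < \<gamma>" "0 < \<delta>"
  shows "eventually (large_enough \<alpha> \<gamma> \<delta>) at_top"
proof -
  have "\<forall>\<^sub>F L in at_top. 13 \<le> (L::real)" by (rule eventually_ge_at_top)
  moreover have "\<forall>\<^sub>F L in at_top. 520 * L powr 1.1 \<le> (L::real)\<^sup>2" by real_asymp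
  moreover have "\<forall>\<^sub>F L in at_top. 64 * L powr 6.6 \<le> 3 / 4 * (L::real) ^ 8" by real_asymp
  moreover have "\<forall>\<^sub>F L in at_top. 260 * L powr 7.6 \<le> 3 / 4 * (L::real) ^ 8" by real_asymp
  moreover have "\<forall>\<^sub>F L in at_top. 240 * L ^ 3 \<le> \<gamma> * (L::real) powr 3.2" using assms(2) by real_asymp
  moreover have "\<forall>\<^sub>F L in at_top. 360 * L powr 5.2 \<le> (L::real) powr 5.5" by real_asymp
  moreover have "\<forall>\<^sub>F L in at_top. (1/2 + \<alpha>) * (360 * L powr 5.2) \<le> \<alpha> * (L::real) powr 5.5" using assms(1) by real_asymp
  moreover have "\<forall>\<^sub>F L in at_top. 12 * L powr 2.1 \<le> \<alpha> * (L::real) ^ 8" using assms(1) by real_asymp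
  moreover have "\<forall>\<^sub>F L in at_top. 24 * L powr 1.1 \<le> \<gamma> * (L::real) ^ 8" using assms(2) by real_asymp
  moreover have "\<forall>\<^sub>F L in at_top. 100 * L powr 6.6 \<le> 3 / 4 * \<gamma>\<^sup>2 * (L::real) ^ 8" using assms(2) by real_asymp
  moreover have "\<forall>\<^sub>F L in at_top. 12 * L powr 5.5 * exp (L - \<delta>\<^sup>2 * (L::real) powr 2.5 / 8) < 1" using assms(3) by real_asymp
  ultimately show ?thesis unfolding large_enough_def by eventually_elim blast
qed

context pseudorandom_relation
begin

lemma hamilton_order_if_large:
  assumes L: "L = ln (real (card V))" and large: "large_enough \<alpha> \<gamma> (\<alpha> / (2 + 4 * \<alpha>)) L"
    and np: "L ^ 8 \<le> real (card V) * p"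
  shows "\<exists>c. c \<noteq> [] \<and> distinct c \<and> set c = V \<and> successively E c \<and> E (last c) (hd c)"
proof -
  let ?n = "real (card V)"
  have l: "13 \<le> L" "64 * L powr 6.6 \<le> 3 / 4 * L ^ 8"
     "260 * L powr 7.6 \<le> 3 / 4 * L ^ 8" "240 * L ^ 3 \<le> \<gamma> * L powr 3.2"
     "360 * L powr 5.2 \<le> L powr 5.5" "(1/2 + \<alpha>) * (360 * L powr 5.2) \<le> \<alpha> * L powr 5.5"
     "12 * L powr 2.1 \<le> \<alpha> * L ^ 8" "24 * L powr 1.1 \<le> \<gamma> * L ^ 8"
     "100 * L powr 6.6 \<le> 3 / 4 * \<gamma>\<^sup>2 * L ^ 8"
     "12 * L powr 5.5 * exp (L - (\<alpha> / (2 + 4 * \<alpha>))\<^sup>2 * L powr 2.5 / 8) < 1"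
    using large unfolding large_enough_def by blast+
  have V: "V \<noteq> {}" using l(1) unfolding L by auto
  have n: "0 < ?n" "?n = exp L" using V finite_V by (simp_all add: L card_gt_0_iff)
  have half: "1 / 2 \<le> M0" by (rule M0_ge_half[OF V])
  define N where "N = nat \<lceil>L powr 5.5\<rceil>"
  \<comment> \<open>2 ln 2 > 1 gives 2 ^ k > exp L = n. Similarly \<open>J\<close> below is chosen
    larger than \<open>lk * L\<close>, so that (1 - 1 / lk) ^ J < exp (- L) = 1 / n.\<close>
  define k where "k = nat \<lceil>2 * L\<rceil>"
  define lk where "lk = 2 * (k + 5) + 1"
  define J where "J = nat \<lceil>real lk * L\<rceil> + 1"
  define K where "K = nat \<lceil>L powr 3.2\<rceil>"
  have pow1: "1 \<le> L powr 5.5" "1 \<le> L powr 3.2" using l(1) by (simp_all add: ge_one_powr_ge_zero)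
  have N: "L powr 5.5 \<le> real N" "real N \<le> 2 * L powr 5.5"
    using pow1 unfolding N_def by linarith+
  have K: "L powr 3.2 \<le> real K" "real K \<le> 2 * L powr 3.2"
    using pow1 unfolding K_def by linarith+
  have lk: "real lk \<le> 5 * L" "0 < real lk"
  proof -
    have "real k \<le> 2 * L + 1" using l(1) unfolding k_def by linarith
    then show "real lk \<le> 5 * L" "0 < real lk" using l(1) by (simp_all add: lk_def)
  qed
  have J: "real J \<le> 6 * L\<^sup>2" "real lk * L < real J"
  proof -
    have "0 \<le> real lk * L" using lk l(1) by simp
    then have J2: "real J \<le> real lk * L + 2" "real lk * L < real J" unfolding J_def by linarith+
    have "real lk * L \<le> 5 * L * L" using lk(1) l(1) by (intro mult_right_mono) auto
    then have "real J \<le> 5 * L\<^sup>2 + 2" using J2(1) by (simp add: power2_eq_square)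
    moreover have "1 * 2 \<le> L * L" using l(1) by (intro mult_mono) auto
    then have "2 \<le> L\<^sup>2" by (simp add: power2_eq_square)
    ultimately show "real J \<le> 6 * L\<^sup>2" by linarith
    show "real lk * L < real J" by (rule J2(2))
  qed
  have Npos: "0 < N" "0 < real N" using N pow1 by linarith+
  define \<rho> where "\<rho> = ?n / real N"
  have \<rho>: "0 < \<rho>" "real N * \<rho> = ?n" using Npos n by (simp_all add: \<rho>_def)
  \<comment> \<open>From n p \<ge> L^8 and N \<le> 2 L^5.5, lower bounds on \<rho> reduce, after
    multiplication by \<open>p\<close>, to comparisons of powers of \<open>L\<close>.\<close>
  have scale: "a \<le> b * \<rho>" if "a * (2 * L powr 5.5) * p \<le> b * L ^ 8" "0 \<le> a" "0 \<le> b" for a b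
  proof -
    have "a * real N * p \<le> a * (2 * L powr 5.5) * p"
      using N p_pos that(2) by (intro mult_right_mono mult_left_mono) auto
    also have "\<dots> \<le> b * L ^ 8" by fact
    also have "\<dots> \<le> b * (?n * p)" using np that(3) by (rule mult_left_mono)
    also have "\<dots> = b * ?n * p" by simp
    finally have "a * real N \<le> b * ?n" using p_pos by (simp only: mult_le_cancel_right_pos)
    then show ?thesis using Npos by (simp add: \<rho>_def le_divide_eq)
  qed
  have M0p: "M0 * p = L powr 1.1" using p_pos by (simp add: M0_def)
  have "L powr 1.1 * L powr 5.5 = L powr 6.6" by (simp add: powr_add[symmetric])
  moreover have "M0 * (2 * L powr 5.5) * p = 2 * ((M0 * p) * L powr 5.5)" by simp
  ultimately have pw1: "M0 * (2 * L powr 5.5) * p = 2 * L powr 6.6" unfolding M0p by simp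
  have pw2: "L powr 2.1 * L powr 5.5 = L powr 7.6" by (simp add: powr_add[symmetric])
  have c1: "32 * M0 \<le> 3 / 4 * \<rho>"
    by (rule scale) (use pw1 l(2) M0_pos in simp_all)
  have c2: "130 * L powr 2.1 \<le> p * (3 / 4 * \<rho>)"
  proof -
    have "130 * L powr 2.1 / p * (2 * L powr 5.5) * p = 260 * (L powr 2.1 * L powr 5.5)" using p_pos by simp
    then have "130 * L powr 2.1 / p \<le> 3 / 4 * \<rho>"
      using l(3) p_pos unfolding pw2 by (intro scale) auto
    then show ?thesis using p_pos by (simp add: field_simps)
  qed
  have c3: "16 * (M0 + 1) + 2 * \<gamma> \<le> \<gamma> * (\<gamma> * (3 / 4 * \<rho>))"
  proof -
    have "50 * M0 \<le> (3 / 4 * \<gamma>\<^sup>2) * \<rho>"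
      by (rule scale) (use pw1 l(9) M0_pos in simp_all)
    \<comment> \<open>1 \<le> 2 M0 turns the constant 16 into 32 M0, and 2 \<gamma> < 1/12 is below
      the remaining 2 M0.\<close>
    moreover have "16 * (M0 + 1) + 2 * \<gamma> \<le> 50 * M0"
      using half \<gamma>_less unfolding distrib_left by linarith
    ultimately show ?thesis by (simp add: power2_eq_square)
  qed
  have c4: "12 * L powr 2.1 \<le> \<alpha> * p * ?n"
  proof -
    have "\<alpha> * L ^ 8 \<le> \<alpha> * (?n * p)" using np \<alpha>_pos by (intro mult_left_mono) auto
    also have "\<dots> = \<alpha> * p * ?n" by simp
    finally show ?thesis using l(7) by linarith
  qed
  have c5: "8 * M0 + 8 \<le> \<gamma> * ?n"
  proof -
    have "24 * M0 * p = 24 * L powr 1.1" using M0p by simp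
    also note l(8)
    also have "\<gamma> * L ^ 8 \<le> \<gamma> * (?n * p)" using np \<gamma>_pos by (intro mult_left_mono) auto
    also have "\<dots> = \<gamma> * ?n * p" by simp
    finally have "24 * M0 * p \<le> \<gamma> * ?n * p" .
    then have "24 * M0 \<le> \<gamma> * ?n" using p_pos by (simp only: mult_le_cancel_right_pos)
    then show ?thesis using half by linarith
  qed
  have c6: "8 * real J * real lk \<le> \<gamma> * real K"
  proof -
    have "8 * real J * real lk \<le> 8 * (6 * L\<^sup>2) * (5 * L)"
      using J lk l(1) by (intro mult_mono) auto
    also have "\<dots> = 240 * L ^ 3" by (simp add: power2_eq_square power3_eq_cube)
    also have "\<dots> \<le> \<gamma> * L powr 3.2" by (rule l(4))
    also have "\<dots> \<le> \<gamma> * real K" using K \<gamma>_pos by (intro mult_left_mono) auto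
    finally show ?thesis .
  qed
  have T: "real (4 * J + 8 * J * K) \<le> 120 * L powr 5.2"
  proof -
    have sq: "L\<^sup>2 = L powr 2" using l(1) by (simp add: powr_numeral)
    have "real J * real K \<le> 6 * L\<^sup>2 * (2 * L powr 3.2)" using J K by (intro mult_mono) auto
    also have "\<dots> = 12 * L powr 5.2" unfolding sq by (simp add: powr_add[symmetric])
    finally have 1: "real J * real K \<le> 12 * L powr 5.2" .
    have "L\<^sup>2 \<le> L powr 5.2" unfolding sq using l(1) by (intro powr_mono) auto
    then have "real J \<le> 6 * L powr 5.2" using J by linarith
    then have "4 * real J + 8 * (real J * real K) \<le> 120 * L powr 5.2" using 1 by linarith
    then show ?thesis by (simp add: mult.assoc)
  qed
  have c7: "3 * real (4 * J + 8 * J * K) \<le> real N"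
  proof -
    have "3 * real (4 * J + 8 * J * K) \<le> 3 * (120 * L powr 5.2)" using T by (rule mult_left_mono) simp
    also have "\<dots> = 360 * L powr 5.2" by simp
    also note l(5)
    also note N(1)
    finally show ?thesis .
  qed
  have c8: "(1/2 + \<alpha>) * (3 * real (4 * J + 8 * J * K)) \<le> \<alpha> * real N"
  proof -
    have "(1/2 + \<alpha>) * (3 * real (4 * J + 8 * J * K)) \<le> (1/2 + \<alpha>) * (360 * L powr 5.2)"
    proof (rule mult_left_mono)
      have "3 * real (4 * J + 8 * J * K) \<le> 3 * (120 * L powr 5.2)" using T by (rule mult_left_mono) simp
      then show "3 * real (4 * J + 8 * J * K) \<le> 360 * L powr 5.2" by simp
    qed (use \<alpha>_pos in simp)
    also note l(6)
    also have "\<alpha> * L powr 5.5 \<le> \<alpha> * real N" using N \<alpha>_pos by (intro mult_left_mono) auto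
    finally show ?thesis .
  qed
  have c9: "card V < 2 ^ k"
  proof -
    \<comment> \<open>The needed ln 2 > 1/2 follows from e \<le> 3 < 4.\<close>
    have "exp (1 / 2) ^ 2 = exp (1::real)" by (simp add: exp_of_nat_mult[symmetric])
    also have "\<dots> < 2 ^ 2" using exp_le by simp
    finally have "exp (1 / 2) < (2::real)" by (rule power2_less_imp_less) simp
    then have "exp (1 / 2) < exp (ln (2::real))" by simp
    then have "1 / 2 < ln (2::real)" by (simp only: exp_less_cancel_iff)
    then have "2 * L * (1 / 2) < 2 * L * ln 2" using l(1) by (intro mult_strict_left_mono) auto
    also have "\<dots> \<le> real k * ln 2" unfolding k_def by (intro mult_right_mono real_nat_ceiling_ge) simp
    finally have "exp L < exp (real k * ln 2)" by simp
    also have "\<dots> = 2 ^ k" by (simp add: exp_of_nat_mult)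
    finally have "real (card V) < real (2 ^ k)" using n by simp
    then show ?thesis by (simp only: of_nat_less_iff)
  qed
  have c10: "(lk - 1) ^ J * card V < lk ^ J"
  proof -
    have "real (lk - 1) / real lk = 1 + - (1 / real lk)" using lk(2) by (simp add: of_nat_diff field_simps)
    also have "\<dots> \<le> exp (- (1 / real lk))" by (rule exp_ge_add_one_self)
    finally have "(real (lk - 1) / real lk) ^ J \<le> exp (- (1 / real lk)) ^ J" by (intro power_mono) auto
    also have "\<dots> = exp (- (real J / real lk))" by (simp add: exp_of_nat_mult[symmetric])
    also have "\<dots> < exp (- L)" using J(2) lk(2) by (simp add: less_divide_eq mult.commute)
    finally have "(real (lk - 1) / real lk) ^ J * exp L < exp (- L) * exp L"
      by (intro mult_strict_right_mono) auto
    then have "real (lk - 1) ^ J * ?n < real lk ^ J"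
      using lk(2) by (simp add: n(2) exp_minus power_divide divide_less_eq)
    then have "real ((lk - 1) ^ J * card V) < real (lk ^ J)" by simp
    then show ?thesis by (simp only: of_nat_less_iff)
  qed
  have "2 * (2 * ?n + 1) * real N * exp (- ((\<alpha> / (2 + 4 * \<alpha>))\<^sup>2 * (?n * p / 2) / (2 * real N))) < 1"
  proof -
    let ?\<delta> = "\<alpha> / (2 + 4 * \<alpha>)"
    have "1 \<le> ?n" using V finite_V by (simp add: Suc_le_eq card_gt_0_iff)
    \<comment> \<open>The degree per class, n p / N, is at least L^2.5 / 2; the failure probability
      exp (- c L^2.5) then beats the number of events, which is exp (O(L)).\<close>
    have "L powr 2.5 / 2 * real N \<le> L powr 2.5 / 2 * (2 * L powr 5.5)" using N by (intro mult_left_mono) auto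
    also have "\<dots> = L powr (2.5 + 5.5)" by (subst powr_add) simp
    also have "\<dots> = L powr (real 8)" by simp
    also have "\<dots> = L ^ 8" using l(1) by (subst powr_realpow) auto
    finally have "L powr 2.5 / 2 * real N \<le> ?n * p" using np by linarith
    then have "L powr 2.5 / 2 \<le> ?n * p / real N" using Npos by (simp add: le_divide_eq)
    then have "?\<delta>\<^sup>2 / 4 * (L powr 2.5 / 2) \<le> ?\<delta>\<^sup>2 / 4 * (?n * p / real N)" by (intro mult_left_mono) auto
    then have e: "exp (- (?\<delta>\<^sup>2 * (?n * p / 2) / (2 * real N))) \<le> exp (- (?\<delta>\<^sup>2 * L powr 2.5 / 8))" by simp
    have "2 * (2 * ?n + 1) * real N * exp (- (?\<delta>\<^sup>2 * (?n * p / 2) / (2 * real N)))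
       \<le> (2 * (3 * ?n)) * (2 * L powr 5.5) * exp (- (?\<delta>\<^sup>2 * L powr 2.5 / 8))"
      using e N \<open>1 \<le> ?n\<close> by (intro mult_mono) auto
    also have "\<dots> = 12 * L powr 5.5 * exp (L - ?\<delta>\<^sup>2 * L powr 2.5 / 8)"
      unfolding n(2) exp_diff exp_minus by (simp add: field_simps)
    also have "\<dots> < 1" by (rule l(10))
    finally show ?thesis .
  qed
  from balanced_colouring_exists[OF Npos(1) V this] obtain \<chi> where
    \<chi>: "\<forall>v\<in>V. \<chi> v < N" "balanced \<chi> N \<rho>" unfolding \<rho>_def by blast
  have JK: "0 < J" "0 < K" using K pow1 by (simp_all add: J_def)
  show ?thesis
    by (rule hamilton_order[OF \<chi>(2) _ JK \<rho> c1 c2 c9 lk_def c10 c6 c7 c8 c4 c5 c3]) (use \<chi>(1) in blast)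
qed

end

theorem theorem3p2:
  fixes \<alpha> :: real and p :: "nat \<Rightarrow> real"
  assumes "\<alpha> > 0"
    and "p \<in> \<omega>(\<lambda>n. (ln (real n))^8 / real n)"
  shows "\<forall>\<^sub>F n in sequentially. \<forall>D :: ('a, 'b) pre_digraph.
           pseudorandom n \<alpha> (p n) D \<longrightarrow> (\<exists>c. hamilton_cycle D c)"
proof -
  have \<gamma>: "0 < \<alpha> / (24 + 24 * \<alpha>)" and \<delta>: "0 < \<alpha> / (2 + 4 * \<alpha>)" using assms(1) by simp_all
  have "filterlim (\<lambda>n. ln (real n)) at_top sequentially" by real_asymp
  then have 1: "\<forall>\<^sub>F n in sequentially. large_enough \<alpha> (\<alpha> / (24 + 24 * \<alpha>)) (\<alpha> / (2 + 4 * \<alpha>)) (ln (real n))"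
    using eventually_large_enough[OF assms(1) \<gamma> \<delta>] by (simp add: filterlim_iff)
  have 2: "\<forall>\<^sub>F n in sequentially. norm (p n) \<ge> 1 * norm ((ln (real n))^8 / real n)"
    by (rule landau_omega.smallD[OF assms(2)]) simp
  have 3: "\<forall>\<^sub>F n in sequentially. 2 \<le> (n::nat)" by (rule eventually_ge_at_top)
  show ?thesis
    using 1 2 3
  proof eventually_elim
    case (elim n)
    show ?case
    proof (intro allI impI)
      fix D :: "('a, 'b) pre_digraph" assume D: "pseudorandom n \<alpha> (p n) D"
      have dg: "digraph D" and card: "card (verts D) = n" using D by (simp_all add: pseudorandom_def)
      let ?L = "ln (real n)"
      have L: "1 \<le> ?L" "520 * ?L powr 1.1 \<le> ?L\<^sup>2" using elim(1) by (simp_all add: large_enough_def)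
      \<comment> \<open>The growth condition only controls the absolute value of \<open>p n\<close>.
        A negative value would put single vertices above the threshold of (P3), which would then
        bound a number of arcs by a negative number.\<close>
      have pos: "0 < p n"
      proof (rule ccontr)
        assume neg: "\<not> 0 < p n"
        have "0 < ?L ^ 8 / real n" using elim(3) L(1) by simp
        then have "p n \<noteq> 0" using elim(2) by auto
        then have "p n < 0" using neg by simp
        then have q: "?L powr 1.1 / p n \<le> real (card X)" for X :: "'a set"
          by (intro order.trans[OF _ of_nat_0_le_iff] divide_nonneg_neg) auto
        obtain x where x: "x \<in> verts D" using card elim(3) by (cases "verts D = {}") auto
        have "verts D - {x} \<noteq> {}"
        proof
          assume "verts D - {x} = {}"
          then have "verts D = {x}" using x by blast
          then show False using card elim(3) by simp
        qed
        then obtain y where y: "y \<in> verts D" "y \<noteq> x" by blast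
        have "{x} \<subseteq> verts D" "{y} \<subseteq> verts D" "{x} \<inter> {y} = {}" using x y by auto
        then have "real (arcs_between D {x} {y}) \<le> (1 + \<alpha> / 2) * real (card {x}) * real (card {y}) * p n"
          using D q[of "{x}"] q[of "{y}"] unfolding pseudorandom_def by blast
        also have "\<dots> < 0" using \<open>p n < 0\<close> assms(1) by (simp add: mult_pos_neg)
        finally show False by simp
      qed
      interpret pseudorandom_relation "verts D" "dominates D" \<alpha> "p n" ?L
        by (rule pseudorandom_relation_of_digraph[OF D assms(1) pos L])
      have "?L ^ 8 / real n \<le> p n" using elim(2,3) pos L(1) by simp
      then have "?L ^ 8 \<le> real (card (verts D)) * p n"
        using elim(3) by (simp add: card divide_le_eq mult.commute)
      then obtain c where "c \<noteq> []" "distinct c" "set c = verts D" "successively (dominates D) c"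
          "last c \<rightarrow>\<^bsub>D\<^esub> hd c"
        using hamilton_order_if_large elim(1) unfolding card \<gamma>_def by blast
      from hamilton_cycle_of_vertices[OF dg this] show "\<exists>c. hamilton_cycle D c" .
    qed
  qed
qed

end
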